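(* Let $1\le p<q\le\infty$ and let $E$ be a $D^*$-convex r.i. space on $[0,1]$ that is an interpolation space for $(L_p,L_q)$. Then there exists a constant $c>0$ such that for every $x\in E$ with $\|x\|_E=1$ there exists an increasing, $p$-convex, $q$-concave function $M:[0,\infty)\to[0,\infty)$ such that $$\int_0^1M(|x|)\,ds\le c,\quad\text{and}\quad\int_0^1M(|y|)\,ds\ge c^{-1}\ \text{ whenever }\ \|y\|_E\ge c.$$ Thus there exists a family of increasing, $p$-convex, $q$-concave functions $M_\alpha:[0,\infty)\to[0,\infty)$ ($\alpha\in A$) such that $\|\cdot\|_E$ is equivalent to $\inf_{\alpha\in A}\|\cdot\|_{L_{M_\alpha}}$.
   Context: For a measurable $x$ on $[0,1]$, $x^*$ is the decreasing rearrangement of $|x|$. A Banach space $E$ of measurable functions on $[0,1]$ is rearrangement invariant (r.i.) if $y\in E$ and $x^*\le y^*$ imply $x\in E$ and $\|x\|_E\le\|y\|_E$. Standing assumption: $E$ is maximal or minimal in the sense of Lindenstrauss and Tzafriri (e.g. separable or isometric to the dual of a separable r.i. space), so that $\lim_{t\to\infty}\|\min\{x,t\}\|_E=\|x\|_E$ for $0\le x\in E$. For functions $x_1,\dots,x_n$ on $[0,1]$ the dilated disjoint sum is $C(x_1,\dots,x_n)(t)=|x_k(nt-k+1)|$ for $(k-1)/n<t<k/n$. $E$ is $D^*$-convex if there is a constant $c>0$ such that $\|C(x_1,\dots,x_n)\|_E\ge c^{-1}\inf_{1\le k\le n}\|x_k\|_E$ for all $n$ and all $x_1,\dots,x_n$.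 $E$ is an interpolation space for $(L_p,L_q)$ if there is a constant $c>0$ such that whenever $T:L_p\cap L_q\to L_p\cap L_q$ is linear with $\|T\|_{L_p\to L_p}\le1$ and $\|T\|_{L_q\to L_q}\le1$, then $\|T\|_{E\to E}\le c$. An increasing $M:[0,\infty)\to[0,\infty)$ is $p$-convex if $t\mapsto M(t^{1/p})$ is convex, and $q$-concave if $t\mapsto-M(t^{1/q})$ is convex; every such $M$ is by convention $\infty$-concave. $\|x\|_{L_M}=\inf\{\lambda>0:\int_0^1M(|x(t)|/\lambda)\,dt\le1\}$. Equivalence means two-sided domination up to a positive constant. *)

theory Defs
  imports "HOL-Probability.Essential_Supremum"
begin

abbreviation unit_int :: "real measure" where
  "unit_int \<equiv> lebesgue_on {0..1}"

text \<open>A space of measurable functions is a pair of a set \<open>E\<close> of functions and a norm \<open>N\<close>,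
  which is only meaningful on \<open>E\<close>. Functions are not quotiented by almost everywhere equality;
  instead \<open>N\<close> vanishes exactly on the null functions. Values of functions outside the unit
  interval play no role.\<close>

definition banach_function_space :: "(real \<Rightarrow> real) set \<Rightarrow> ((real \<Rightarrow> real) \<Rightarrow> real) \<Rightarrow> bool" where
  "banach_function_space E N \<longleftrightarrow>
     E \<subseteq> borel_measurable unit_int \<and>
     (\<lambda>t. 0) \<in> E \<and>
     (\<forall>x\<in>E. \<forall>y\<in>E. (\<lambda>t. x t + y t) \<in> E \<and> N (\<lambda>t. x t + y t) \<le> N x + N y) \<and>
     (\<forall>x\<in>E. \<forall>a. (\<lambda>t. a * x t) \<in> E \<and> N (\<lambda>t. a * x t) = \<bar>a\<bar> * N x) \<and>
     (\<forall>x\<in>E. 0 \<le> N x \<and> (N x = 0 \<longleftrightarrow> (AE t in unit_int. x t = 0))) \<and>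
     (\<forall>u. (\<forall>n. u n \<in> E) \<and>
          (\<forall>e>0. \<exists>K. \<forall>m\<ge>K. \<forall>n\<ge>K. N (\<lambda>t. u m t - u n t) < e) \<longrightarrow>
          (\<exists>x\<in>E. (\<lambda>n::nat. N (\<lambda>t. u n t - x t)) \<longlonglongrightarrow> 0))"

definition rearrangement :: "(real \<Rightarrow> real) \<Rightarrow> real \<Rightarrow> real" where
  "rearrangement x t = Inf {s. 0 \<le> s \<and> measure unit_int {u \<in> {0..1}. s < \<bar>x u\<bar>} \<le> t}"

text \<open>The point \<open>t = 0\<close> is left out below because the rearrangement of an unbounded function
  is infinite there.\<close>

definition ri_space :: "(real \<Rightarrow> real) set \<Rightarrow> ((real \<Rightarrow> real) \<Rightarrow> real) \<Rightarrow> bool" where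
  "ri_space E N \<longleftrightarrow>
     banach_function_space E N \<and>
     (\<forall>y\<in>E. \<forall>x\<in>borel_measurable unit_int.
        (\<forall>t\<in>{0<..<1}. rearrangement x t \<le> rearrangement y t) \<longrightarrow> x \<in> E \<and> N x \<le> N y)"

definition ext_norm :: "(real \<Rightarrow> real) set \<Rightarrow> ((real \<Rightarrow> real) \<Rightarrow> real) \<Rightarrow> (real \<Rightarrow> real) \<Rightarrow> ennreal" where
  "ext_norm E N x = (if x \<in> E then ennreal (N x) else \<infinity>)"

text \<open>The norm of the associate space (Koethe dual), infinite outside of that space.\<close>

definition associate_norm :: "((real \<Rightarrow> real) \<Rightarrow> ennreal) \<Rightarrow> (real \<Rightarrow> real) \<Rightarrow> ennreal" where
  "associate_norm F y =
     (SUP x\<in>{x \<in> borel_measurable unit_int. F x \<le> 1}. \<integral>\<^sup>+ t. ennreal \<bar>x t * y t\<bar> \<partial>unit_int)"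

abbreviation second_associate_norm ::
    "(real \<Rightarrow> real) set \<Rightarrow> ((real \<Rightarrow> real) \<Rightarrow> real) \<Rightarrow> (real \<Rightarrow> real) \<Rightarrow> ennreal" where
  "second_associate_norm E N \<equiv> associate_norm (associate_norm (ext_norm E N))"

text \<open>Maximal and minimal in the sense of Lindenstrauss and Tzafriri: isometrically, \<open>E\<close> is
  all of its second associate space, respectively the closed linear span of the simple functions
  in it.\<close>

definition maximal_space :: "(real \<Rightarrow> real) set \<Rightarrow> ((real \<Rightarrow> real) \<Rightarrow> real) \<Rightarrow> bool" where
  "maximal_space E N \<longleftrightarrow>
     (\<forall>x\<in>borel_measurable unit_int. ext_norm E N x = second_associate_norm E N x)"

definition minimal_space :: "(real \<Rightarrow> real) set \<Rightarrow> ((real \<Rightarrow> real) \<Rightarrow> real) \<Rightarrow> bool" where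
  "minimal_space E N \<longleftrightarrow>
     (\<forall>x\<in>borel_measurable unit_int. x \<in> E \<longleftrightarrow>
        (\<forall>e>0. \<exists>s. simple_function unit_int s \<and>
           second_associate_norm E N (\<lambda>t. x t - s t) < ennreal e)) \<and>
     (\<forall>x\<in>E. ext_norm E N x = second_associate_norm E N x)"

definition dilated_disjoint_sum :: "nat \<Rightarrow> (nat \<Rightarrow> real \<Rightarrow> real) \<Rightarrow> real \<Rightarrow> real" where
  "dilated_disjoint_sum n x t =
     (\<Sum>k=1..n. indicator {(real k - 1) / real n <..< real k / real n} t
                  * \<bar>x k (real n * t - real k + 1)\<bar>)"

definition D_star_convex :: "(real \<Rightarrow> real) set \<Rightarrow> ((real \<Rightarrow> real) \<Rightarrow> real) \<Rightarrow> bool" where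
  "D_star_convex E N \<longleftrightarrow>
     (\<exists>c>0. \<forall>n\<ge>1. \<forall>x. (\<forall>k\<in>{1..n}. x k \<in> E) \<longrightarrow>
        N (dilated_disjoint_sum n x) \<ge> inverse c * (INF k\<in>{1..n}. N (x k)))"

definition L_space :: "ereal \<Rightarrow> (real \<Rightarrow> real) set" where
  "L_space p = {x \<in> borel_measurable unit_int.
     if p = \<infinity> then esssup unit_int (\<lambda>t. ereal \<bar>x t\<bar>) < \<infinity>
     else integrable unit_int (\<lambda>t. \<bar>x t\<bar> powr real_of_ereal p)}"

definition L_norm :: "ereal \<Rightarrow> (real \<Rightarrow> real) \<Rightarrow> real" where
  "L_norm p x =
     (if p = \<infinity> then real_of_ereal (esssup unit_int (\<lambda>t. ereal \<bar>x t\<bar>))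
      else (\<integral>t. \<bar>x t\<bar> powr real_of_ereal p \<partial>unit_int) powr (1 / real_of_ereal p))"

text \<open>Linearity is required up to null sets, as for operators on equivalence classes; together
  with the norm bounds it implies that \<open>T\<close> respects almost everywhere equality. As \<open>T\<close> is only
  given on the intersection of the two Lebesgue spaces, its norm on \<open>E\<close> is the norm on the
  elements of \<open>E\<close> which lie in this intersection.\<close>

definition interpolation_space ::
    "(real \<Rightarrow> real) set \<Rightarrow> ((real \<Rightarrow> real) \<Rightarrow> real) \<Rightarrow> ereal \<Rightarrow> ereal \<Rightarrow> bool" where
  "interpolation_space E N p q \<longleftrightarrow>
     (\<exists>c>0. \<forall>T :: (real \<Rightarrow> real) \<Rightarrow> real \<Rightarrow> real.
        (\<forall>x\<in>L_space p \<inter> L_space q. T x \<in> L_space p \<inter> L_space q) \<and>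
        (\<forall>x\<in>L_space p \<inter> L_space q. \<forall>y\<in>L_space p \<inter> L_space q.
           AE t in unit_int. T (\<lambda>s. x s + y s) t = T x t + T y t) \<and>
        (\<forall>x\<in>L_space p \<inter> L_space q. \<forall>a. AE t in unit_int. T (\<lambda>s. a * x s) t = a * T x t) \<and>
        (\<forall>x\<in>L_space p \<inter> L_space q. L_norm p (T x) \<le> L_norm p x) \<and>
        (\<forall>x\<in>L_space p \<inter> L_space q. L_norm q (T x) \<le> L_norm q x) \<longrightarrow>
        (\<forall>x\<in>E \<inter> L_space p \<inter> L_space q. T x \<in> E \<and> N (T x) \<le> c * N x))"

text \<open>Functions on the half line are represented by their values on \<open>{0..}\<close>.\<close>

definition increasing_fun :: "(real \<Rightarrow> real) \<Rightarrow> bool" where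
  "increasing_fun M \<longleftrightarrow> (\<forall>t\<ge>0. 0 \<le> M t) \<and> mono_on {0..} M"

definition p_convex :: "real \<Rightarrow> (real \<Rightarrow> real) \<Rightarrow> bool" where
  "p_convex p M \<longleftrightarrow> convex_on {0..} (\<lambda>t. M (t powr (1 / p)))"

definition q_concave :: "ereal \<Rightarrow> (real \<Rightarrow> real) \<Rightarrow> bool" where
  "q_concave q M \<longleftrightarrow>
     q = \<infinity> \<or> convex_on {0..} (\<lambda>t. - M (t powr (1 / real_of_ereal q)))"

text \<open>The infimum of the empty set is \<open>\<infinity>\<close>.\<close>

definition orlicz_norm :: "(real \<Rightarrow> real) \<Rightarrow> (real \<Rightarrow> real) \<Rightarrow> ennreal" where
  "orlicz_norm M x =
     (INF l\<in>{l. 0 < l \<and> (\<integral>\<^sup>+ t. ennreal (M (\<bar>x t\<bar> / l)) \<partial>unit_int) \<le> 1}. ennreal l)"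

end

theory Submission
  imports Defs
begin

text \<open>The bound for all \<open>y\<close> is reduced by a minimax argument to a bound for one \<open>y\<close> at a time. Let \<open>K\<close>
  be the set of increasing, \<open>p\<close>-convex, \<open>q\<close>-concave \<open>M\<close> vanishing at \<open>0\<close> with \<open>\<integral> M(|x|) \<le> 1\<close>; it is convex and,
  after \<open>x\<close> has been enlarged to an unbounded function, compact for pointwise convergence. The
  functional \<open>M \<mapsto> \<integral> M(|y|)\<close> depends only on the distribution of \<open>y\<close>, and an average of distributions of
  functions of large norm is the distribution of a dilated disjoint sum, which has large norm by
  \<open>D\<^sup>*\<close>-convexity. So a single \<open>M \<in> K\<close> works for all \<open>y\<close> of large norm as soon as each such \<open>y\<close> has its
  own \<open>M \<in> K\<close>.

  For one \<open>y\<close> the functions \<open>M(u) = (a\<^sup>q + u\<^sup>q)\<^bsup>p/q\<^esup> - a\<^sup>p\<close> with \<open>a > 0\<close>, divided by \<open>\<integral> M(|x|)\<close>, suffice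
  (for \<open>q = \<infinity>\<close>, the functions \<open>max 0 (u\<^sup>p - a\<^sup>p)\<close>). They
  are comparable to \<open>min (u\<^sup>p) (a\<^bsup>p-q\<^esup> u\<^sup>q)\<close>. If all of them have a small integral over \<open>|y|\<close>, then each level of
  \<open>y\<close> is paid for either by the \<open>L\<^sub>p\<close>-mass of \<open>x\<close> above that level or by the \<open>L\<^sub>q\<close>-mass of \<open>x\<close> below it. This
  gives two averaging operators, contractions on \<open>L\<^sub>p\<close> and \<open>L\<^sub>q\<close>, whose images of \<open>x\<close> add up to \<open>y\<close>, and the
  interpolation property bounds the norm of \<open>y\<close>.\<close>

subsection \<open>Orlicz functions adapted to the exponents\<close>

text \<open>Functions are discretised to powers of 2: only the masses m j of the levels 2^j matter,
  and \<open>step L m\<close> is one function with these masses. The functional becomes the finite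
  sum of M (2^j) * m j, linear in M and in m, and averaging the m is what a dilated disjoint sum
  does to distributions. Finitely many levels suffice for y because cutting off its large values
  keeps the norm almost unchanged; this is where maximality or minimality enters. Compactness is the
  obstacle that forces an unbounded majorant of x: M u is controlled by the integral only if some
  level above u carries positive mass. Such a majorant exists in E when indicators of short
  intervals have arbitrarily small norm. Otherwise q is infinite, and this case is settled apart.
  Constants: \<kappa> / 8 pays 2 for the upper comparison with \<open>level_weight\<close>, 2 for
  truncating the majorant and 2 for sharing a level between the two exponents. \<kappa> / 32 pays
  another 2 for replacing real weights by integer multiplicities and 2 for slack in strict
  inequalities.\<close>

text \<open>Young's inequality for s and c powr (r - 1) with exponents r and r / (r - 1). The
  supporting line at an interior point c also covers s = 0, so it yields convexity up to the
  endpoint as well as the Jensen inequality \<open>weighted_power_mean\<close>.\<close>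

lemma powr_ge_tangent:
  fixes r s c :: real
  assumes "1 \<le> r" "0 \<le> s" "0 < c"
  shows "c powr r + r * c powr (r - 1) * (s - c) \<le> s powr r"
proof (cases "r = 1")
  case True
  then show ?thesis using assms by simp
next
  case False
  then have r: "r > 1" using assms by simp
  have "s * c powr (r - 1) \<le> s powr r / r + (c powr (r - 1)) powr (r / (r - 1)) / (r / (r - 1))"
    using r assms by (intro Youngs_inequality) (auto simp: field_simps)
  also have "(c powr (r - 1)) powr (r / (r - 1)) = c powr r"
    using r by (simp add: powr_powr)
  finally have "r * (s * c powr (r - 1)) \<le> r * (s powr r / r + c powr r / (r / (r - 1)))"
    using r by (intro mult_left_mono) auto
  also have "\<dots> = s powr r + (r - 1) * c powr r" using r by (simp add: field_simps)
  finally have "r * s * c powr (r - 1) \<le> s powr r + (r - 1) * c powr r" by (simp add: algebra_simps)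
  moreover have "c powr (r - 1) * c = c powr r" using assms by (simp add: powr_diff)
  ultimately show ?thesis by (simp add: algebra_simps)
qed

lemma powr_convex_nonneg:
  assumes "1 \<le> r"
  shows "convex_on {0..} (\<lambda>x::real. x powr r)"
  unfolding convex_on_def
proof (intro conjI ballI allI impI)
  fix x y u v :: real
  assume a: "x \<in> {0..}" "y \<in> {0..}" "0 \<le> u" "0 \<le> v" "u + v = 1"
  define c where "c = u * x + v * y"
  have "c \<ge> 0" using a by (auto simp: c_def)
  then consider "c = 0" | "c > 0" by linarith
  then show "(u *\<^sub>R x + v *\<^sub>R y) powr r \<le> u * x powr r + v * y powr r"
  proof cases
    case 1
    then show ?thesis using a by (simp add: c_def)
  next
    case 2
    have "u * (c powr r + r * c powr (r - 1) * (x - c)) \<le> u * x powr r"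
      "v * (c powr r + r * c powr (r - 1) * (y - c)) \<le> v * y powr r"
      using a 2 assms by (intro mult_left_mono powr_ge_tangent; simp)+
    moreover have "u * (c powr r + r * c powr (r - 1) * (x - c)) + v * (c powr r + r * c powr (r - 1) * (y - c))
      = (u + v) * c powr r + r * c powr (r - 1) * (u * x + v * y - (u + v) * c)"
      by (simp add: algebra_simps)
    moreover have "\<dots> = c powr r" using a by (simp add: c_def)
    ultimately have "c powr r \<le> u * x powr r + v * y powr r" by linarith
    then show ?thesis by (simp add: c_def)
  qed
qed auto

text \<open>The function is the l_r norm of the vector (A powr (1 / r), t), so this is Minkowski's
  inequality. Both coordinates are divided by the right-hand side S; they become convex combinations
  with weights l and 1 - l, the shares of u * P and v * R in S.\<close>

lemma minkowski_convex:
  fixes r A :: real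
  assumes r: "1 \<le> r" and A: "0 < A"
  shows "convex_on {0..} (\<lambda>t. (A + t powr r) powr (1 / r))"
  unfolding convex_on_def
proof (intro conjI ballI allI impI)
  fix x y u v :: real
  assume a: "x \<in> {0..}" "y \<in> {0..}" "0 \<le> u" "0 \<le> v" "u + v = 1"
  define P where "P = (A + x powr r) powr (1 / r)"
  define R where "R = (A + y powr r) powr (1 / r)"
  define S where "S = u * P + v * R"
  define l where "l = u * P / S"
  have pos: "A + x powr r > 0" "A + y powr r > 0" using A by (auto intro: add_pos_nonneg)
  then have PR: "P > 0" "R > 0" by (simp_all add: P_def R_def)
  have S: "S > 0"
    using a PR unfolding S_def by (cases "u = 0") (auto intro: add_pos_nonneg)
  have l1: "1 - l = v * R / S" using S by (simp add: l_def S_def field_simps)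
  have l0: "0 \<le> l" "0 \<le> 1 - l" using a PR S unfolding l1 by (simp_all add: l_def)
  have Pr: "P powr r = A + x powr r" "R powr r = A + y powr r"
    using r pos by (simp_all add: P_def R_def powr_powr)
  have e1: "(u * x + v * y) / S = l * (x / P) + (1 - l) * (y / R)"
    unfolding l1 using PR S by (simp add: l_def field_simps)
  have e2: "A powr (1 / r) / S = l * (A powr (1 / r) / P) + (1 - l) * (A powr (1 / r) / R)"
    unfolding l1 using PR S a(5) by (simp add: l_def field_simps) (metis distrib_right mult_1)
  have c: "(l * s + (1 - l) * t) powr r \<le> l * s powr r + (1 - l) * t powr r" if "0 \<le> s" "0 \<le> t" for s t
    using powr_convex_nonneg[OF r] that l0 unfolding convex_on_def by auto
  have "((u * x + v * y) / S) powr r + (A powr (1 / r) / S) powr r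
      \<le> (l * (x / P) powr r + (1 - l) * (y / R) powr r)
        + (l * (A powr (1 / r) / P) powr r + (1 - l) * (A powr (1 / r) / R) powr r)"
    unfolding e1 e2 using a PR by (intro add_mono c) auto
  also have "\<dots> = l * ((x powr r + A) / P powr r) + (1 - l) * ((y powr r + A) / R powr r)"
    using a A PR r by (simp add: powr_divide powr_powr algebra_simps add_divide_distrib)
  also have "\<dots> = 1" using pos by (simp add: Pr add.commute)
  finally have "((u * x + v * y) powr r + A) / S powr r \<le> 1"
    using a A S r powr_divide[of "u * x + v * y" S r] powr_divide[of "A powr (1 / r)" S r]
    by (simp add: powr_powr add_divide_distrib[of _ A])
  then have "A + (u * x + v * y) powr r \<le> S powr r"
    using S by (simp add: field_simps)
  then have "(A + (u * x + v * y) powr r) powr (1 / r) \<le> (S powr r) powr (1 / r)"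
    using A r by (intro powr_mono2) auto
  also have "\<dots> = S" using S r by (simp add: powr_powr)
  finally show "(A + (u *\<^sub>R x + v *\<^sub>R y) powr r) powr (1 / r)
    \<le> u * (A + x powr r) powr (1 / r) + v * (A + y powr r) powr (1 / r)"
    by (simp add: S_def P_def R_def)
qed auto

lemma shifted_powr_concave:
  fixes A \<theta> :: real
  assumes "0 < A" "0 < \<theta>" "\<theta> \<le> 1"
  shows "convex_on {0..} (\<lambda>s. - ((A + s) powr \<theta>))"
proof (rule convex_on_realI[where f' = "\<lambda>s. - (\<theta> * (A + s) powr (\<theta> - 1))"])
  fix x :: real assume "x \<in> {0..}"
  then show "((\<lambda>s. - ((A + s) powr \<theta>)) has_real_derivative - (\<theta> * (A + x) powr (\<theta> - 1))) (at x)"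
    using assms by (auto intro!: derivative_eq_intros)
next
  fix x y :: real assume "x \<in> {0..}" "y \<in> {0..}" "x \<le> y"
  then show "- (\<theta> * (A + x) powr (\<theta> - 1)) \<le> - (\<theta> * (A + y) powr (\<theta> - 1))"
    using assms by (auto intro!: mult_left_mono powr_mono2')
qed auto

lemma convex_on_cong_fun:
  assumes "convex_on S f" "\<And>x. x \<in> S \<Longrightarrow> f x = g x"
  shows "convex_on S g"
proof -
  have "g (u *\<^sub>R x + v *\<^sub>R y) \<le> u * g x + v * g y"
    if "x \<in> S" "y \<in> S" "0 \<le> u" "0 \<le> v" "u + v = 1" for x y u v
  proof -
    have "u *\<^sub>R x + v *\<^sub>R y \<in> S"
      using convex_on_imp_convex[OF assms(1)] that by (auto simp: convex_def)
    then show ?thesis using assms that unfolding convex_on_def by metis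
  qed
  then show ?thesis using convex_on_imp_convex[OF assms(1)] by (simp add: convex_on_def)
qed

text \<open>Fixing the value 0 on the negative half-line, which no integral sees, makes M monotone
  on all of \<open>real\<close> and keeps every coordinate bounded in the compactness argument. The
  value 0 at 0 is what turns convexity and concavity into the two contraction inequalities.\<close>

definition orlicz_cone :: "real \<Rightarrow> ereal \<Rightarrow> (real \<Rightarrow> real) set" where
  "orlicz_cone p q = {M. increasing_fun M \<and> p_convex p M \<and> q_concave q M \<and> (\<forall>u\<le>0. M u = 0)}"

abbreviation modular :: "(real \<Rightarrow> real) \<Rightarrow> (real \<Rightarrow> real) \<Rightarrow> ennreal" where
  "modular M x \<equiv> \<integral>\<^sup>+ t. ennreal (M \<bar>x t\<bar>) \<partial>unit_int"

lemma orlicz_coneD: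
  assumes "M \<in> orlicz_cone p q"
  shows "increasing_fun M" "p_convex p M" "q_concave q M" "u \<le> 0 \<Longrightarrow> M u = 0"
    "0 \<le> M u" "u \<le> v \<Longrightarrow> M u \<le> M v"
proof -
  show *: "increasing_fun M" "p_convex p M" "q_concave q M" and z: "\<And>u. u \<le> 0 \<Longrightarrow> M u = 0"
    using assms by (auto simp: orlicz_cone_def)
  then show nn: "\<And>u. 0 \<le> M u" by (metis increasing_fun_def linear order_refl)
  show "u \<le> v \<Longrightarrow> M u \<le> M v"
    using *(1) z[of u] nn[of v] unfolding increasing_fun_def mono_on_def by (cases "u \<ge> 0") auto
qed

lemma orlicz_cone_scale:
  assumes "M \<in> orlicz_cone p q" "0 \<le> a"
  shows "(\<lambda>u. a * M u) \<in> orlicz_cone p q"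
proof -
  have "q_concave q (\<lambda>u. a * M u)"
    using convex_on_cmul[OF assms(2), of "{0..}" "\<lambda>t. - M (t powr (1 / real_of_ereal q))"]
      orlicz_coneD(3)[OF assms(1)] by (auto simp: q_concave_def)
  then show ?thesis
    using assms
    by (auto simp: orlicz_cone_def increasing_fun_def p_convex_def mono_on_def
       intro!: mult_left_mono convex_on_cmul)
qed

lemma orlicz_cone_add:
  assumes "M \<in> orlicz_cone p q" "M' \<in> orlicz_cone p q"
  shows "(\<lambda>u. M u + M' u) \<in> orlicz_cone p q"
proof -
  have "q_concave q (\<lambda>u. M u + M' u)"
  proof (cases "q = \<infinity>")
    case False
    then have "convex_on {0..} (\<lambda>t. - M (t powr (1 / real_of_ereal q)) + - M' (t powr (1 / real_of_ereal q)))"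
      using assms by (intro convex_on_add) (auto simp: orlicz_cone_def q_concave_def)
    then show ?thesis by (simp add: q_concave_def)
  qed (simp add: q_concave_def)
  then show ?thesis
    using assms
    by (auto simp: orlicz_cone_def increasing_fun_def p_convex_def mono_on_def
      intro!: add_mono convex_on_add)
qed

text \<open>Convexity of t \<mapsto> M (t powr (1 / p)) on the segment from 0 to u powr p; the
  endpoint 0 contributes nothing since M 0 = 0.\<close>

lemma p_convex_contract:
  assumes "M \<in> orlicz_cone p q" "1 \<le> p" "0 \<le> l" "l \<le> 1" "0 \<le> u"
  shows "M (l * u) \<le> l powr p * M u"
proof -
  have "M ((l powr p * u powr p + (1 - l powr p) * 0) powr (1 / p))
     \<le> l powr p * M ((u powr p) powr (1/p)) + (1 - l powr p) * M (0 powr (1/p))"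
  proof -
    have *: "\<And>x y u v. 0 \<le> x \<Longrightarrow> 0 \<le> y \<Longrightarrow> 0 \<le> u \<Longrightarrow> 0 \<le> v \<Longrightarrow> u + v = 1 \<Longrightarrow>
       M ((u * x + v * y) powr (1 / p)) \<le> u * M (x powr (1 / p)) + v * M (y powr (1 / p))"
      using orlicz_coneD(2)[OF assms(1)] unfolding p_convex_def convex_on_def by auto
    show ?thesis using powr_mono2[of p l 1] assms by (intro *) auto
  qed
  moreover have "l powr p * u powr p = (l * u) powr p" by (simp add: powr_mult)
  ultimately show ?thesis using assms orlicz_coneD(4)[OF assms(1), of 0] by (simp add: powr_powr)
qed

lemma q_concave_contract:
  assumes "M \<in> orlicz_cone p q" "q \<noteq> \<infinity>" "ereal 1 \<le> q" "0 \<le> l" "l \<le> 1" "0 \<le> u"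
  shows "l powr real_of_ereal q * M u \<le> M (l * u)"
proof -
  define r where "r = real_of_ereal q"
  have r: "r \<ge> 1" using assms by (cases q) (auto simp: r_def)
  have "- M ((l powr r * u powr r + (1 - l powr r) * 0) powr (1 / r))
     \<le> l powr r * - M ((u powr r) powr (1/r)) + (1 - l powr r) * - M (0 powr (1/r))"
  proof -
    have *: "\<And>x y u v. 0 \<le> x \<Longrightarrow> 0 \<le> y \<Longrightarrow> 0 \<le> u \<Longrightarrow> 0 \<le> v \<Longrightarrow> u + v = 1 \<Longrightarrow>
       - M ((u * x + v * y) powr (1 / r)) \<le> u * - M (x powr (1 / r)) + v * - M (y powr (1 / r))"
      using orlicz_coneD(3)[OF assms(1)] assms(2)
      unfolding q_concave_def r_def[symmetric] convex_on_def by auto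
    show ?thesis using powr_mono2[of r l 1] assms r by (intro *) auto
  qed
  moreover have "l powr r * u powr r = (l * u) powr r" by (simp add: powr_mult)
  ultimately show ?thesis using assms r orlicz_coneD(4)[OF assms(1), of 0]
    by (simp add: powr_powr r_def[symmetric])
qed

text \<open>For \<open>a = 2\<^sup>k\<close> and \<open>u = 2\<^sup>j\<close> this is \<open>min (u\<^sup>p) (a\<^bsup>p-q\<^esup> u\<^sup>q)\<close>.\<close>

definition level_weight :: "real \<Rightarrow> ereal \<Rightarrow> nat \<Rightarrow> nat \<Rightarrow> real" where
  "level_weight p q k j =
     (if k \<le> j then 2 powr (real j * p) else if q = \<infinity> then 0
      else 2 powr (real k * p) * 2 powr ((real j - real k) * real_of_ereal q))"

lemma level_weight_pos: "k \<le> j \<Longrightarrow> 0 < level_weight p q k j"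
  and level_weight_nonneg: "0 \<le> level_weight p q k j"
  by (auto simp: level_weight_def)

lemma orlicz_cone_inf:
  assumes p: "1 \<le> p" and a: "0 < a"
  shows "(\<lambda>u. max 0 (max 0 u powr p - a powr p)) \<in> orlicz_cone p \<infinity>"
proof -
  have e: "max 0 (max 0 (t powr (1 / p)) powr p - a powr p) = max 0 (t - a powr p)" if "t \<ge> 0" for t
    using that p by (simp add: powr_powr)
  have "convex_on {0..} (\<lambda>t::real. max 0 (t - a powr p))"
    unfolding convex_on_def
  proof (intro conjI ballI allI impI)
    fix x y u v :: real assume uv: "x \<in> {0..}" "y \<in> {0..}" "0 \<le> u" "0 \<le> v" "u + v = 1"
    have "u * (x - a powr p) \<le> u * max 0 (x - a powr p)" "0 \<le> u * max 0 (x - a powr p)"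
      "v * (y - a powr p) \<le> v * max 0 (y - a powr p)" "0 \<le> v * max 0 (y - a powr p)"
      using uv by (intro mult_left_mono mult_nonneg_nonneg; simp)+
    moreover have "u * a powr p + v * a powr p = a powr p" using uv by (metis distrib_right mult_1)
    ultimately show "max 0 (u *\<^sub>R x + v *\<^sub>R y - a powr p) \<le> u * max 0 (x - a powr p) + v * max 0 (y - a powr p)"
      by (simp add: algebra_simps)
  qed auto
  then have "p_convex p (\<lambda>u. max 0 (max 0 u powr p - a powr p))"
    unfolding p_convex_def by (rule convex_on_cong_fun) (simp only: e atLeast_iff)
  moreover have "mono_on {0..} (\<lambda>u. max 0 (max 0 u powr p - a powr p))"
    using p by (intro mono_onI max.mono diff_right_mono powr_mono2) auto
  ultimately show ?thesis
    using p by (simp add: orlicz_cone_def increasing_fun_def q_concave_def max_absorb1)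
qed

text \<open>Substituting t powr (1 / p) turns the first term into the norm of
  \<open>minkowski_convex\<close> with exponent q / p; substituting t powr (1 / q) turns it into the
  shifted power of \<open>shifted_powr_concave\<close>. The subtracted constant affects neither
  property and gives the value 0 at 0.\<close>

lemma orlicz_cone_fin:
  assumes p: "1 \<le> p" and q: "p < q" and a: "0 < A"
  shows "(\<lambda>u. (A + max 0 u powr q) powr (p / q) - A powr (p / q)) \<in> orlicz_cone p (ereal q)"
proof -
  have e: "(A + max 0 (t powr (1 / p)) powr q) powr (p / q) = (A + t powr (q / p)) powr (1 / (q / p))"
    if "t \<ge> 0" for t
    using that p by (simp add: powr_powr)
  have e': "(A + max 0 (t powr (1 / q)) powr q) powr (p / q) = (A + t) powr (p / q)"
    if "t \<ge> 0" for t
    using that p q by (simp add: powr_powr)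
  have c1: "convex_on {0..} (\<lambda>t. (A + t powr (q / p)) powr (1 / (q / p)) + - (A powr (p / q)))"
    using p q a by (intro convex_on_add minkowski_convex convex_on_const[THEN iffD2]) auto
  have c2: "convex_on {0..} (\<lambda>t. - ((A + t) powr (p / q)) + A powr (p / q))"
    using p q a by (intro convex_on_add shifted_powr_concave convex_on_const[THEN iffD2]) auto
  have "p_convex p (\<lambda>u. (A + max 0 u powr q) powr (p / q) - A powr (p / q))"
    unfolding p_convex_def by (rule convex_on_cong_fun[OF c1]) (subst e, auto)
  moreover have "q_concave (ereal q) (\<lambda>u. (A + max 0 u powr q) powr (p / q) - A powr (p / q))"
    unfolding q_concave_def real_of_ereal.simps
    by (rule disjI2, rule convex_on_cong_fun[OF c2]) (subst e', auto)
  moreover have "mono_on {0..} (\<lambda>u. (A + max 0 u powr q) powr (p / q) - A powr (p / q))"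
    using p q a by (intro mono_onI diff_right_mono powr_mono2 add_left_mono max.mono) auto
  moreover have "A powr (p / q) \<le> (A + t powr q) powr (p / q)" if "t \<ge> 0" for t
    using p q a by (intro powr_mono2) auto
  ultimately show ?thesis
    using p q by (simp add: orlicz_cone_def increasing_fun_def max_absorb1)
qed

text \<open>For finite q the lower bounds start from the value at 2^k and are spread upwards by
  p-convexity and downwards by q-concavity. One \<kappa> serves all k, so later constants do not
  depend on the level.\<close>

lemma level_function_exists:
  assumes p: "1 \<le> p" and q: "ereal p < q"
  shows "\<exists>\<kappa>>0. \<forall>k. \<exists>M\<in>orlicz_cone p q.
     \<forall>j. \<kappa> * level_weight p q k j \<le> M (2 ^ j) \<and> M (2 ^ j) \<le> 2 * level_weight p q k j"
proof (cases q)
  case (real r)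
  then have r: "p < r" using q by simp
  define \<theta> where "\<theta> = p / r"
  have th: "0 < \<theta>" "\<theta> < 1" using p r by (simp_all add: \<theta>_def)
  \<comment> \<open>This is M(a) / a powr p for the functions M below: at u = a the two terms under
    the power coincide, so M(a) = (2 * A) powr \<theta> - A powr \<theta>.\<close>
  define \<kappa> :: real where "\<kappa> = 2 powr \<theta> - 1"
  have k0: "\<kappa> > 0" using th powr_less_mono[of 0 \<theta> 2] by (simp add: \<kappa>_def)
  show ?thesis
  proof (intro exI[of _ \<kappa>] conjI k0 allI)
    fix k :: nat
    define a :: real where "a = 2 ^ k"
    define A where "A = a powr r"
    have a: "a > 0" "A > 0" by (simp_all add: a_def A_def)
    define M where "M = (\<lambda>u. (A + max 0 u powr r) powr (p / r) - A powr (p / r))"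
    have M: "M \<in> orlicz_cone p q" unfolding M_def real by (rule orlicz_cone_fin[OF p r a(2)])
    have Ath: "A powr \<theta> = a powr p" using p r a by (simp add: A_def powr_powr \<theta>_def)
    have Ma: "M a = \<kappa> * a powr p"
    proof -
      have "M a = (2 * A) powr \<theta> - A powr \<theta>" using a by (simp add: M_def A_def \<theta>_def)
      then show ?thesis using a by (simp add: powr_mult Ath \<kappa>_def algebra_simps)
    qed
    have "\<kappa> * level_weight p q k j \<le> M (2 ^ j) \<and> M (2 ^ j) \<le> 2 * level_weight p q k j" for j
    proof -
      define u :: real where "u = 2 ^ j"
      have u: "u > 0" by (simp add: u_def)
      have up: "u powr s = 2 powr (real j * s)" "a powr s = 2 powr (real k * s)" for s
        by (simp_all add: u_def a_def powr_powr flip: powr_realpow)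
      show ?thesis
      proof (cases "k \<le> j")
        case True
        then have au: "a \<le> u" by (simp add: a_def u_def)
        have w: "level_weight p q k j = u powr p" using True by (simp add: level_weight_def up)
        have "M (a / u * u) \<le> (a / u) powr p * M u"
          using M p au u a by (intro p_convex_contract) auto
        then have "\<kappa> * a powr p \<le> a powr p / u powr p * M u" using u a by (simp add: Ma powr_divide)
        then have "\<kappa> * u powr p \<le> M u" using u a by (simp add: field_simps)
        moreover have "M u \<le> 2 * u powr p"
        proof -
          have "A \<le> u powr r" using au a r p by (simp add: A_def powr_mono2)
          then have "M u \<le> (2 * u powr r) powr \<theta>"
            using a u th unfolding M_def \<theta>_def[symmetric]
            by (intro order_trans[OF diff_left_mono[OF powr_ge_zero]]) (auto intro!: powr_mono2)
          also have "\<dots> = 2 powr \<theta> * u powr p" using r p u by (simp add: powr_mult powr_powr \<theta>_def)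
          also have "\<dots> \<le> 2 * u powr p" using th powr_mono[of \<theta> 1 2] by (intro mult_right_mono) auto
          finally show ?thesis .
        qed
        ultimately show ?thesis unfolding w u_def by simp
      next
        case False
        then have ua: "u \<le> a" by (simp add: a_def u_def)
        have w: "level_weight p q k j = a powr p * (u powr r / a powr r)" using False
          by (simp add: level_weight_def up real left_diff_distrib powr_diff)
        have "(u / a) powr real_of_ereal q * M a \<le> M (u / a * a)"
          using M p r ua u a by (intro q_concave_contract) (auto simp: real)
        then have "\<kappa> * (a powr p * (u powr r / a powr r)) \<le> M u"
          using u a by (simp add: Ma powr_divide real mult_ac)
        moreover have "M u \<le> 2 * (a powr p * (u powr r / a powr r))"
        proof -
          define x where "x = u powr r / A"
          have x: "x \<ge> 0" using a by (simp add: x_def)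
          have "A + u powr r = A * (1 + x)" using a by (simp add: x_def field_simps)
          then have "(A + max 0 u powr r) powr \<theta> = a powr p * (1 + x) powr \<theta>"
            using a u x by (simp add: powr_mult Ath max_def)
          then have "M u = a powr p * ((1 + x) powr \<theta> - 1)"
            unfolding M_def \<theta>_def[symmetric] Ath by (simp add: algebra_simps)
          \<comment> \<open>Bernoulli's inequality (1 + x) powr \<theta> \<le> 1 + x, obtained from
            monotonicity in the exponent because 1 + x \<ge> 1.\<close>
          also have "\<dots> \<le> a powr p * (((1 + x) powr 1) - 1)"
            using x th by (intro mult_left_mono diff_right_mono powr_mono) auto
          also have "\<dots> = a powr p * x" using x by simp
          finally have "M u \<le> a powr p * x" .
          moreover have "0 \<le> a powr p * x" using x by simp
          ultimately have "M u \<le> 2 * (a powr p * x)" by linarith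
          then show ?thesis by (simp add: x_def A_def)
        qed
        ultimately show ?thesis unfolding w u_def by simp
      qed
    qed
    then show "\<exists>M\<in>orlicz_cone p q. \<forall>j. \<kappa> * level_weight p q k j \<le> M (2 ^ j) \<and> M (2 ^ j) \<le> 2 * level_weight p q k j"
      using M by blast
  qed
next
  case PInf
  show ?thesis
  proof (intro exI[of _ "1/2"] conjI allI)
    fix k :: nat
    \<comment> \<open>The cutoff sits one dyadic level below 2^k: M vanishes at 2^(k-1) and below,
      yet keeps at least half of u powr p at u = 2^k and above. Only powers of 2 are tested.\<close>
    define a :: real where "a = 2 powr (real k - 1)"
    have a: "a > 0" by (simp add: a_def)
    define M where "M = (\<lambda>u. max 0 (max 0 u powr p - a powr p))"
    have M: "M \<in> orlicz_cone p q" unfolding M_def PInf by (rule orlicz_cone_inf[OF p a])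
    have "1 / 2 * level_weight p q k j \<le> M (2 ^ j) \<and> M (2 ^ j) \<le> 2 * level_weight p q k j" for j
    proof -
      define u :: real where "u = 2 ^ j"
      have u: "u > 0" "u = 2 powr real j" by (simp_all add: u_def powr_realpow)
      show ?thesis
      proof (cases "k \<le> j")
        case True
        have w: "level_weight p q k j = u powr p" using True by (simp add: level_weight_def u powr_powr)
        have "a \<le> u / 2" using True by (simp add: a_def u(2) powr_diff)
        then have "a powr p \<le> (u / 2) powr p" using a p by (intro powr_mono2) auto
        also have "\<dots> = u powr p / 2 powr p" using u by (simp add: powr_divide)
        also have "\<dots> \<le> u powr p / 2" using p powr_mono[of 1 p 2] by (intro divide_left_mono) auto
        finally have "a powr p \<le> u powr p / 2" .
        moreover have "max 0 u = u" "0 \<le> a powr p" using u by simp_all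
        ultimately show ?thesis unfolding w u_def[symmetric] M_def by (simp only: max.absorb2) linarith
      next
        case False
        then have w: "level_weight p q k j = 0" by (simp add: level_weight_def PInf)
        have "u \<le> a" using False by (simp add: a_def u(2))
        then have "u powr p \<le> a powr p" using u p by (intro powr_mono2) auto
        then show ?thesis using u unfolding w u_def[symmetric] by (simp add: M_def)
      qed
    qed
    then show "\<exists>M\<in>orlicz_cone p q. \<forall>j. 1 / 2 * level_weight p q k j \<le> M (2 ^ j) \<and> M (2 ^ j) \<le> 2 * level_weight p q k j"
      using M by blast
  qed simp
qed (use q in auto)

subsection \<open>Weights, power means and a minimax principle\<close>

text \<open>Jensen's inequality for the probability measure with density W / H, by integrating the
  tangent of the r-th power at the mean c = I / H. A zero mean is split off because the tangent
  needs c > 0.\<close>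

lemma weighted_power_mean:
  fixes W f :: "'a \<Rightarrow> real"
  assumes r: "1 \<le> r" and W: "\<And>t. 0 \<le> W t" and iW: "integrable M W"
    and i1: "integrable M (\<lambda>t. W t * \<bar>f t\<bar>)" and ir: "integrable M (\<lambda>t. W t * \<bar>f t\<bar> powr r)"
    and H: "0 < (\<integral>t. W t \<partial>M)"
  shows "(\<integral>t. W t * \<bar>f t\<bar> \<partial>M) powr r
     \<le> (\<integral>t. W t \<partial>M) powr (r - 1) * (\<integral>t. W t * \<bar>f t\<bar> powr r \<partial>M)"
proof -
  define H where "H = (\<integral>t. W t \<partial>M)"
  define I where "I = (\<integral>t. W t * \<bar>f t\<bar> \<partial>M)"
  have I0: "I \<ge> 0" using W by (auto simp: I_def intro!: integral_nonneg)
  have H0: "H > 0" using H by (simp add: H_def)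
  have nn: "0 \<le> H powr (r - 1) * (\<integral>t. W t * \<bar>f t\<bar> powr r \<partial>M)"
    using W by (intro mult_nonneg_nonneg integral_nonneg) auto
  show ?thesis
  proof (cases "I = 0")
    case True
    then show ?thesis using nn by (simp add: I_def H_def)
  next
    case False
    define c where "c = I / H"
    have c: "c > 0" using False I0 H0 by (simp add: c_def)
    let ?k = "r * c powr (r - 1)"
    have "(\<integral>t. (c powr r - ?k * c) * W t + ?k * (W t * \<bar>f t\<bar>) \<partial>M) \<le> (\<integral>t. W t * \<bar>f t\<bar> powr r \<partial>M)"
    proof (rule integral_mono)
      fix t
      have "W t * (c powr r + ?k * (\<bar>f t\<bar> - c)) \<le> W t * \<bar>f t\<bar> powr r"
        using r c W by (intro mult_left_mono powr_ge_tangent) auto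
      then show "(c powr r - ?k * c) * W t + ?k * (W t * \<bar>f t\<bar>) \<le> W t * \<bar>f t\<bar> powr r"
        by (simp add: algebra_simps)
    qed (use iW i1 ir in auto)
    also have "(\<integral>t. (c powr r - ?k * c) * W t + ?k * (W t * \<bar>f t\<bar>) \<partial>M) = (c powr r - ?k * c) * H + ?k * I"
      using iW i1 by (simp add: H_def I_def)
    also have "\<dots> = c powr r * H" using H0 by (simp add: c_def algebra_simps)
    also have "\<dots> = I powr r / H powr (r - 1)"
      using I0 H0 by (simp add: c_def powr_divide powr_diff)
    finally show ?thesis using H0 unfolding H_def[symmetric] I_def[symmetric] by (simp add: field_simps)
  qed
qed

text \<open>A Hall-type supply and demand statement: g is the supply, h k the demand that must be
  met inside D k. As the D k increase, the weights chosen before step m live in D m and have used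
  exactly the sum of the earlier demands there, so the hypothesis leaves enough, and a constant
  fraction of the remainder meets h m.\<close>

lemma greedy_weights:
  fixes g :: "'a \<Rightarrow> real" and h :: "nat \<Rightarrow> real"
  assumes D: "\<And>k. D k \<in> sets M" "\<And>k. D k \<subseteq> D (Suc k)"
    and g: "integrable M g" "\<And>t. 0 \<le> g t" and h: "\<And>k. 0 \<le> h k"
    and le: "\<And>k. k < m \<Longrightarrow> (\<Sum>i\<le>k. h i) \<le> (\<integral>t. indicator (D k) t * g t \<partial>M)"
  shows "\<exists>w :: nat \<Rightarrow> 'a \<Rightarrow> real. (\<forall>k<m. w k \<in> borel_measurable M \<and> (\<forall>t. 0 \<le> w k t)
     \<and> (\<forall>t. t \<notin> D k \<longrightarrow> w k t = 0) \<and> (\<integral>t. w k t * g t \<partial>M) = h k) \<and> (\<forall>t. (\<Sum>k<m. w k t) \<le> 1)"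
  using le
proof (induction m)
  case 0
  then show ?case by auto
next
  case (Suc m)
  have "\<exists>w :: nat \<Rightarrow> 'a \<Rightarrow> real. (\<forall>k<m. w k \<in> borel_measurable M \<and> (\<forall>t. 0 \<le> w k t)
     \<and> (\<forall>t. t \<notin> D k \<longrightarrow> w k t = 0) \<and> (\<integral>t. w k t * g t \<partial>M) = h k) \<and> (\<forall>t. (\<Sum>k<m. w k t) \<le> 1)"
    by (rule Suc.IH) (use Suc.prems in simp)
  then obtain w :: "nat \<Rightarrow> 'a \<Rightarrow> real" where w: "\<And>k. k < m \<Longrightarrow> w k \<in> borel_measurable M"
    "\<And>k t. k < m \<Longrightarrow> 0 \<le> w k t" "\<And>k t. k < m \<Longrightarrow> t \<notin> D k \<Longrightarrow> w k t = 0"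
    "\<And>k. k < m \<Longrightarrow> (\<integral>t. w k t * g t \<partial>M) = h k" "\<And>t. (\<Sum>k<m. w k t) \<le> 1"
    by blast
  have [measurable]: "D m \<in> sets M" "g \<in> borel_measurable M" using D g by auto
  define W where "W t = (\<Sum>k<m. w k t)" for t
  have [measurable]: "W \<in> borel_measurable M"
    unfolding W_def using w(1) by (intro borel_measurable_sum) auto
  have W: "0 \<le> W t" "W t \<le> 1" for t using w by (auto simp: W_def intro: sum_nonneg)
  have Dm: "D k \<subseteq> D m" if "k < m" for k
    using lift_Suc_mono_le[of D k m] D(2) that by auto
  have w1: "w k t \<le> 1" if "k < m" for k t
    using w(2,5) that by (intro order_trans[OF member_le_sum[of k "{..<m}" "\<lambda>k. w k t"] w(5)]) auto
  have iw: "integrable M (\<lambda>t. w k t * g t)" if "k < m" for k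
    using w(1,2)[OF that] w1[OF that] g
    by (intro Bochner_Integration.integrable_bound[OF g(1)])
       (auto simp: abs_mult intro!: borel_measurable_times mult_left_le_one_le)
  define v where "v t = (1 - W t) * (indicator (D m) t * g t)" for t
  have v0: "0 \<le> v t" for t using W g by (simp add: v_def)
  have ii: "integrable M (\<lambda>t. indicator (D m) t * g t)"
    using g integrable_mult_indicator[of "D m" M g] by simp
  have WD: "W t * (indicator (D m) t * g t) = (\<Sum>k<m. w k t * g t)" for t
  proof (cases "t \<in> D m")
    case True then show ?thesis by (simp add: W_def sum_distrib_right)
  next
    case False
    then have "w k t = 0" if "k < m" for k using w(3)[OF that] Dm[OF that] by auto
    then show ?thesis using False by simp
  qed
  have iv: "(\<integral>t. v t \<partial>M) = (\<integral>t. indicator (D m) t * g t \<partial>M) - (\<Sum>k<m. h k)"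
  proof -
    have "(\<integral>t. v t \<partial>M) = (\<integral>t. indicator (D m) t * g t - (\<Sum>k<m. w k t * g t) \<partial>M)"
      by (rule Bochner_Integration.integral_cong) (auto simp: v_def left_diff_distrib WD)
    also have "\<dots> = (\<integral>t. indicator (D m) t * g t \<partial>M) - (\<integral>t. (\<Sum>k<m. w k t * g t) \<partial>M)"
      using iw by (intro Bochner_Integration.integral_diff ii) auto
    also have "(\<integral>t. (\<Sum>k<m. w k t * g t) \<partial>M) = (\<Sum>k<m. h k)"
      using iw w(4) by (subst Bochner_Integration.integral_sum) auto
    finally show ?thesis .
  qed
  define V where "V = (\<integral>t. v t \<partial>M)"
  have hV: "h m \<le> V"
    using Suc.prems[of m] iv by (simp add: V_def lessThan_Suc_atMost[symmetric])
  \<comment> \<open>If V = 0 then h m = 0 as well, and division by zero gives the correct fraction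
    0.\<close>
  define \<theta> where "\<theta> = h m / V"
  have th: "0 \<le> \<theta>" "\<theta> \<le> 1" "\<theta> * V = h m"
    using hV h[of m] by (auto simp: \<theta>_def divide_le_eq_1)
  define w' where "w' = w(m := (\<lambda>t. \<theta> * (1 - W t) * indicator (D m) t))"
  have "(\<integral>t. w' m t * g t \<partial>M) = h m"
  proof -
    have "(\<integral>t. w' m t * g t \<partial>M) = (\<integral>t. \<theta> * v t \<partial>M)"
      by (rule Bochner_Integration.integral_cong) (auto simp: w'_def v_def)
    then show ?thesis using th by (simp add: V_def)
  qed
  moreover have "(\<Sum>k<Suc m. w' k t) \<le> 1" for t
  proof -
    have "(\<Sum>k<Suc m. w' k t) = W t + \<theta> * (1 - W t) * indicator (D m) t"
      by (simp add: w'_def W_def)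
    also have "\<dots> \<le> W t + 1 * (1 - W t) * 1"
      using th W by (intro add_left_mono mult_mono) (auto simp: indicator_def)
    finally show ?thesis by simp
  qed
  moreover have "w' m \<in> borel_measurable M" by (simp add: w'_def)
  moreover have "0 \<le> w' m t" for t using th W by (simp add: w'_def)
  ultimately show ?case
    using w by (intro exI[of _ w']) (auto simp: less_Suc_eq w'_def)
qed

text \<open>The pairs lying below some (g x, h x) form a convex set by \<open>cv\<close>, and it
  misses the open positive quadrant. The coefficients of a separating functional, divided by their
  sum, are \<theta> and 1 - \<theta>. Assuming domination by a point of K instead of an actual
  convex combination avoids any vector space structure on K.\<close>

lemma two_function_minimax:
  fixes g h :: "'a \<Rightarrow> real"
  assumes ne: "K \<noteq> {}"
    and cv: "\<And>x y u. x \<in> K \<Longrightarrow> y \<in> K \<Longrightarrow> 0 \<le> u \<Longrightarrow> u \<le> 1 \<Longrightarrow>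
       \<exists>z\<in>K. u * g x + (1 - u) * g y \<le> g z \<and> u * h x + (1 - u) * h y \<le> h z"
    and none: "\<And>x. x \<in> K \<Longrightarrow> g x > 0 \<Longrightarrow> h x \<le> 0"
  shows "\<exists>\<theta>. 0 \<le> \<theta> \<and> \<theta> \<le> 1 \<and> (\<forall>x\<in>K. \<theta> * g x + (1 - \<theta>) * h x \<le> 0)"
proof -
  define S where "S = {(a, b). \<exists>x\<in>K. a \<le> g x \<and> b \<le> h x}"
  define T where "T = {(a::real, b::real). 0 < a \<and> 0 < b}"
  have "convex S"
  proof (rule convexI)
    fix X Y :: "real \<times> real" and u v :: real
    assume a: "X \<in> S" "Y \<in> S" "0 \<le> u" "0 \<le> v" "u + v = 1"
    obtain a b c d where XY: "X = (a, b)" "Y = (c, d)" by (metis surj_pair)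
    obtain x y where x: "x \<in> K" "a \<le> g x" "b \<le> h x" and y: "y \<in> K" "c \<le> g y" "d \<le> h y"
      using a XY by (auto simp: S_def)
    have v: "v = 1 - u" using a by simp
    obtain z where z: "z \<in> K" "u * g x + v * g y \<le> g z" "u * h x + v * h y \<le> h z"
      using cv[OF x(1) y(1), of u] a unfolding v by auto
    have "u * a + v * c \<le> u * g x + v * g y" "u * b + v * d \<le> u * h x + v * h y"
      using a x y by (auto intro!: add_mono mult_left_mono)
    then have "u * a + v * c \<le> g z" "u * b + v * d \<le> h z" using z by linarith+
    then show "u *\<^sub>R X + v *\<^sub>R Y \<in> S" using z(1) unfolding XY S_def by auto
  qed
  moreover have "convex T"
  proof (rule convexI)
    fix X Y :: "real \<times> real" and u v :: real
    assume a: "X \<in> T" "Y \<in> T" "0 \<le> u" "0 \<le> v" "u + v = 1"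
    then show "u *\<^sub>R X + v *\<^sub>R Y \<in> T"
      by (cases "u = 0") (auto simp: T_def intro!: add_pos_nonneg)
  qed
  moreover have "S \<noteq> {}" using ne by (auto simp: S_def)
  moreover have "(1, 1) \<in> T" by (simp add: T_def)
  then have "T \<noteq> {}" by blast
  moreover have "S \<inter> T = {}" using none by (force simp: S_def T_def)
  ultimately obtain ab c where "ab \<noteq> 0" and 1: "\<forall>x\<in>S. inner ab x \<le> c" and 2: "\<forall>x\<in>T. inner ab x \<ge> c"
    using separating_hyperplane_sets[of S T] by auto
  obtain a b where ab: "ab = (a, b)" by fastforce
  have nz: "a \<noteq> 0 \<or> b \<noteq> 0" using \<open>ab \<noteq> 0\<close> ab by (simp add: zero_prod_def)
  have S: "a * g x + b * h x \<le> c" if "x \<in> K" for x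
    using 1 that unfolding ab S_def by force
  have T: "c \<le> a * s + b * t" if "s > 0" "t > 0" for s t
    using 2 that unfolding ab T_def by force
  \<comment> \<open>The quadrant is unbounded in each direction, so a negative coefficient would
    push the functional below c.\<close>
  have a0: "a \<ge> 0"
  proof (rule ccontr)
    assume "\<not> a \<ge> 0"
    then have "c \<le> a * ((\<bar>c\<bar> + \<bar>b\<bar> + 1) / - a) + b * 1" by (intro T) (auto intro!: divide_pos_neg divide_neg_neg simp: zero_less_divide_iff divide_less_0_iff)
    also have "\<dots> = - (\<bar>c\<bar> + \<bar>b\<bar> + 1) + b" using \<open>\<not> a \<ge> 0\<close> by simp
    finally show False by linarith
  qed
  have b0: "b \<ge> 0"
  proof (rule ccontr)
    assume "\<not> b \<ge> 0"
    then have "c \<le> a * 1 + b * ((\<bar>c\<bar> + \<bar>a\<bar> + 1) / - b)" by (intro T) (auto intro!: divide_pos_neg divide_neg_neg simp: zero_less_divide_iff divide_less_0_iff)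
    also have "\<dots> = - (\<bar>c\<bar> + \<bar>a\<bar> + 1) + a" using \<open>\<not> b \<ge> 0\<close> by simp
    finally show False by linarith
  qed
  have ab0: "a + b > 0" using a0 b0 nz by linarith
  \<comment> \<open>The quadrant comes arbitrarily close to the origin, where the functional is
    0.\<close>
  have "c \<le> 0"
  proof (rule ccontr)
    assume c: "\<not> c \<le> 0"
    have "c \<le> a * (c / (2 * (a + b))) + b * (c / (2 * (a + b)))"
      using c ab0 by (intro T) auto
    also have "\<dots> = (a + b) * (c / (2 * (a + b)))" by (simp only: distrib_right)
    also have "\<dots> = c / 2" using ab0 by (simp del: distrib_left_numeral)
    finally show False using c by linarith
  qed
  have "(a / (a + b)) * g x + (1 - a / (a + b)) * h x \<le> 0" if "x \<in> K" for x
  proof -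
    have "1 - a / (a + b) = b / (a + b)" using ab0 by (simp add: diff_divide_eq_iff)
    then have "(a / (a + b)) * g x + (1 - a / (a + b)) * h x = (a * g x + b * h x) / (a + b)"
      by (simp add: add_divide_distrib)
    then show ?thesis using S[OF that] \<open>c \<le> 0\<close> ab0 by (simp add: divide_nonpos_pos)
  qed
  then show ?thesis using a0 b0 ab0 by (intro exI[of _ "a / (a + b)"]) auto
qed

text \<open>Induction on I, for all K at once: on the part K' of K where f j > 0 some other index
  must be nonpositive, so the induction hypothesis gives weights valid on K'. Their weighted sum and
  f j then satisfy the hypothesis of \<open>two_function_minimax\<close> on all of K. If K' is
  empty, j takes all the weight.\<close>

lemma finite_minimax:
  fixes f :: "'i \<Rightarrow> 'a \<Rightarrow> real"
  assumes "finite I" "K \<noteq> {}"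
    and "\<And>x y u. x \<in> K \<Longrightarrow> y \<in> K \<Longrightarrow> 0 \<le> u \<Longrightarrow> u \<le> 1 \<Longrightarrow>
       \<exists>z\<in>K. \<forall>i\<in>I. u * f i x + (1 - u) * f i y \<le> f i z"
    and "\<And>x. x \<in> K \<Longrightarrow> \<exists>i\<in>I. f i x \<le> 0"
  shows "\<exists>l. (\<forall>i\<in>I. 0 \<le> l i) \<and> sum l I = 1 \<and> (\<forall>x\<in>K. (\<Sum>i\<in>I. l i * f i x) \<le> 0)"
  using assms
proof (induction I arbitrary: K rule: finite_induct)
  case empty
  then show ?case by auto
next
  case (insert j I)
  define K' where "K' = {x \<in> K. f j x > 0}"
  show ?case
  proof (cases "K' = {}")
    case True
    have "(\<Sum>i\<in>insert j I. of_bool (i = j) * f i x) = f j x" for x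
    proof -
      have "(\<Sum>i\<in>I. of_bool (i = j) * f i x) = 0"
        using insert.hyps by (intro sum.neutral) auto
      then show ?thesis using insert.hyps by simp
    qed
    moreover have "(\<Sum>i\<in>insert j I. of_bool (i = j)) = (1::real)"
      using insert.hyps by (subst sum.insert) (auto intro!: sum.neutral)
    ultimately show ?thesis
      using True by (intro exI[of _ "\<lambda>i. of_bool (i = j)"]) (fastforce simp: K'_def)
  next
    case False
    have "\<exists>l. (\<forall>i\<in>I. 0 \<le> l i) \<and> sum l I = 1 \<and> (\<forall>x\<in>K'. (\<Sum>i\<in>I. l i * f i x) \<le> 0)"
    proof (rule insert.IH[OF False])
      fix x y u assume a: "x \<in> K'" "y \<in> K'" "0 \<le> (u::real)" "u \<le> 1"
      then obtain z where z: "z \<in> K" "\<forall>i\<in>insert j I. u * f i x + (1 - u) * f i y \<le> f i z"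
        using insert.prems(2)[of x y u] by (auto simp: K'_def)
      have "0 < u * f j x + (1 - u) * f j y"
        using a by (cases "u = 0") (auto simp: K'_def intro!: add_pos_nonneg)
      then show "\<exists>z\<in>K'. \<forall>i\<in>I. u * f i x + (1 - u) * f i y \<le> f i z"
        using z by (intro bexI[of _ z]) (auto simp: K'_def)
    next
      fix x assume "x \<in> K'"
      then show "\<exists>i\<in>I. f i x \<le> 0" using insert.prems(3)[of x] by (auto simp: K'_def)
    qed
    then obtain l where l: "\<And>i. i \<in> I \<Longrightarrow> 0 \<le> l i" "sum l I = 1" "\<And>x. x \<in> K' \<Longrightarrow> (\<Sum>i\<in>I. l i * f i x) \<le> 0"
      by blast
    have "\<exists>\<theta>. 0 \<le> \<theta> \<and> \<theta> \<le> 1 \<and> (\<forall>x\<in>K. \<theta> * (\<Sum>i\<in>I. l i * f i x) + (1 - \<theta>) * f j x \<le> 0)"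
    proof (rule two_function_minimax[OF insert.prems(1)])
      fix x y u assume a: "x \<in> K" "y \<in> K" "0 \<le> (u::real)" "u \<le> 1"
      then obtain z where z: "z \<in> K" "\<forall>i\<in>insert j I. u * f i x + (1 - u) * f i y \<le> f i z"
        using insert.prems(2)[of x y u] by auto
      have "u * (\<Sum>i\<in>I. l i * f i x) + (1 - u) * (\<Sum>i\<in>I. l i * f i y)
          = (\<Sum>i\<in>I. l i * (u * f i x + (1 - u) * f i y))"
        by (simp add: sum_distrib_left sum.distrib distrib_left mult.left_commute)
      also have "\<dots> \<le> (\<Sum>i\<in>I. l i * f i z)"
        using l z by (intro sum_mono mult_left_mono) auto
      finally show "\<exists>z\<in>K. u * (\<Sum>i\<in>I. l i * f i x) + (1 - u) * (\<Sum>i\<in>I. l i * f i y) \<le> (\<Sum>i\<in>I. l i * f i z)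
         \<and> u * f j x + (1 - u) * f j y \<le> f j z"
        using z by auto
    next
      fix x assume "x \<in> K" "0 < (\<Sum>i\<in>I. l i * f i x)"
      then show "f j x \<le> 0" using l(3)[of x] by (fastforce simp: K'_def)
    qed
    then obtain \<theta> where th: "0 \<le> \<theta>" "\<theta> \<le> 1"
      "\<And>x. x \<in> K \<Longrightarrow> \<theta> * (\<Sum>i\<in>I. l i * f i x) + (1 - \<theta>) * f j x \<le> 0" by blast
    let ?l = "\<lambda>i. if i = j then 1 - \<theta> else \<theta> * l i"
    have e: "(\<Sum>i\<in>I. ?l i * F i) = \<theta> * (\<Sum>i\<in>I. l i * F i)" for F
      using insert.hyps by (auto simp: sum_distrib_left mult.assoc intro!: sum.cong)
    show ?thesis
      using insert.hyps th l e[of "\<lambda>_. 1"] by (intro exI[of _ ?l]) (auto simp: e add.commute)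
  qed
qed

subsection \<open>Rearrangement invariant spaces\<close>

lemma finite_measure_unit_int [simp]: "finite_measure unit_int"
  by (rule finite_measure_lebesgue_on) auto

lemma measure_unit_int_subinterval:
  "0 \<le> a \<Longrightarrow> a \<le> b \<Longrightarrow> b \<le> 1 \<Longrightarrow> measure unit_int {a..b} = b - a"
  "0 \<le> a \<Longrightarrow> a \<le> b \<Longrightarrow> b \<le> 1 \<Longrightarrow> measure unit_int {a..<b} = b - a"
  by (subst measure_restrict_space; auto)+

lemma emeasure_unit_int_space: "emeasure unit_int {0..1} = 1"
  by (subst emeasure_restrict_space) auto

lemma unit_int_sets [simp]:
  "0 \<le> a \<Longrightarrow> b \<le> 1 \<Longrightarrow> {a..b} \<in> sets unit_int"
  "0 \<le> a \<Longrightarrow> b \<le> 1 \<Longrightarrow> {a..<b} \<in> sets unit_int"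
  by (auto simp: sets_restrict_space_iff)

lemma borel_measurable_unit_int: "f \<in> borel_measurable borel \<Longrightarrow> f \<in> borel_measurable unit_int"
  by (simp add: measurable_completion measurable_restrict_space1)

definition distr_fun :: "(real \<Rightarrow> real) \<Rightarrow> real \<Rightarrow> real" where
  "distr_fun x s = measure unit_int {u \<in> {0..1}. s < \<bar>x u\<bar>}"

lemma level_set_measurable:
  fixes x :: "real \<Rightarrow> real"
  assumes [measurable]: "x \<in> borel_measurable unit_int"
  shows "{u \<in> {0..1}. s < \<bar>x u\<bar>} \<in> sets unit_int"
proof -
  have "{u \<in> space unit_int. s < \<bar>x u\<bar>} \<in> sets unit_int" by measurable
  then show ?thesis by simp
qed

lemma distr_fun_antimono:
  assumes "x \<in> borel_measurable unit_int" "s \<le> t"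
  shows "distr_fun x t \<le> distr_fun x s"
  unfolding distr_fun_def
  using assms by (intro finite_measure.finite_measure_mono level_set_measurable) auto

lemma distr_fun_mono_AE:
  assumes "x \<in> borel_measurable unit_int" "y \<in> borel_measurable unit_int"
    "AE t in unit_int. \<bar>x t\<bar> \<le> \<bar>y t\<bar>"
  shows "distr_fun x s \<le> distr_fun y s"
  unfolding distr_fun_def
  using assms by (intro finite_measure.finite_measure_mono_AE level_set_measurable) auto

lemma distr_fun_tendsto_0:
  assumes x: "x \<in> borel_measurable unit_int"
  shows "(\<lambda>n. distr_fun x (real n)) \<longlonglongrightarrow> 0"
proof -
  have "(\<lambda>n. measure unit_int {u \<in> {0..1}. real n < \<bar>x u\<bar>})
     \<longlonglongrightarrow> measure unit_int (\<Inter>n. {u \<in> {0..1}. real n < \<bar>x u\<bar>})"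
    using level_set_measurable[OF x]
    by (intro finite_measure.finite_Lim_measure_decseq) (auto simp: decseq_def)
  moreover have "(\<Inter>n. {u \<in> {0..1}. real n < \<bar>x u\<bar>}) = {}"
  proof -
    have "\<exists>n. \<not> real n < \<bar>x u\<bar>" for u using real_arch_simple[of "\<bar>x u\<bar>"] by (auto simp: not_less)
    then show ?thesis by blast
  qed
  ultimately show ?thesis by (simp add: distr_fun_def)
qed

text \<open>A smaller distribution function enlarges the set whose infimum is the rearrangement. The
  set for y must be nonempty for this comparison of infima, which holds for t > 0 because the
  distribution function tends to 0.\<close>

lemma rearrangement_mono:
  assumes y: "y \<in> borel_measurable unit_int"
    and le: "\<And>s. 0 \<le> s \<Longrightarrow> distr_fun x s \<le> distr_fun y s" and t: "0 < t"
  shows "rearrangement x t \<le> rearrangement y t"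
proof -
  obtain n where "distr_fun y (real n) < t"
    using order_tendstoD(2)[OF distr_fun_tendsto_0[OF y] t] by (auto simp: eventually_sequentially)
  then have "{s. 0 \<le> s \<and> distr_fun y s \<le> t} \<noteq> {}" by (auto intro!: exI[of _ "real n"])
  then show ?thesis
    using le unfolding rearrangement_def distr_fun_def[symmetric]
    by (intro cInf_superset_mono) (auto intro!: bdd_belowI[of _ 0] order_trans[OF le])
qed

locale ri =
  fixes E :: "(real \<Rightarrow> real) set" and N :: "(real \<Rightarrow> real) \<Rightarrow> real"
  assumes ri_space: "ri_space E N"
begin

lemma bfs: "banach_function_space E N"
  using ri_space by (simp add: ri_space_def)

lemma measurable_E: "x \<in> E \<Longrightarrow> x \<in> borel_measurable unit_int"
  using bfs by (auto simp: banach_function_space_def)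

lemma zero_in_E: "(\<lambda>t. 0) \<in> E"
  using bfs by (simp add: banach_function_space_def)

lemma add_in_E: "x \<in> E \<Longrightarrow> y \<in> E \<Longrightarrow> (\<lambda>t. x t + y t) \<in> E"
  and norm_add: "x \<in> E \<Longrightarrow> y \<in> E \<Longrightarrow> N (\<lambda>t. x t + y t) \<le> N x + N y"
  using bfs by (auto simp: banach_function_space_def)

lemma scale_in_E: "x \<in> E \<Longrightarrow> (\<lambda>t. a * x t) \<in> E"
  and norm_scale: "x \<in> E \<Longrightarrow> N (\<lambda>t. a * x t) = \<bar>a\<bar> * N x"
  using bfs by (auto simp: banach_function_space_def)

lemma norm_nonneg: "x \<in> E \<Longrightarrow> 0 \<le> N x"
  and norm_eq_0_iff: "x \<in> E \<Longrightarrow> N x = 0 \<longleftrightarrow> (AE t in unit_int. x t = 0)"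
  using bfs by (auto simp: banach_function_space_def)

lemma complete_E:
  assumes "\<And>n. u n \<in> E" "\<And>e. e > 0 \<Longrightarrow> \<exists>K. \<forall>m\<ge>K. \<forall>n\<ge>K. N (\<lambda>t. u m t - u n t) < e"
  shows "\<exists>x\<in>E. (\<lambda>n::nat. N (\<lambda>t. u n t - x t)) \<longlonglongrightarrow> 0"
proof -
  have "\<And>u. (\<forall>n. u n \<in> E) \<and>
          (\<forall>e>0. \<exists>K. \<forall>m\<ge>K. \<forall>n\<ge>K. N (\<lambda>t. u m t - u n t) < e) \<longrightarrow>
          (\<exists>x\<in>E. (\<lambda>n::nat. N (\<lambda>t. u n t - x t)) \<longlonglongrightarrow> 0)"
    using bfs unfolding banach_function_space_def by blast
  then show ?thesis using assms by blast
qed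

lemma diff_in_E: "x \<in> E \<Longrightarrow> y \<in> E \<Longrightarrow> (\<lambda>t. x t - y t) \<in> E"
  using add_in_E[OF _ scale_in_E[of y "-1"], of x] by simp

lemma norm_zero: "N (\<lambda>t. 0) = 0"
  using norm_scale[OF zero_in_E, of 0] by simp

lemma sum_in_E: "(\<And>i. i \<in> I \<Longrightarrow> f i \<in> E) \<Longrightarrow> (\<lambda>t. \<Sum>i\<in>I. f i t) \<in> E"
  and norm_sum: "(\<And>i. i \<in> I \<Longrightarrow> f i \<in> E) \<Longrightarrow> N (\<lambda>t. \<Sum>i\<in>I. f i t) \<le> (\<Sum>i\<in>I. N (f i))"
proof -
  have "(\<forall>i\<in>I. f i \<in> E) \<longrightarrow> (\<lambda>t. \<Sum>i\<in>I. f i t) \<in> E \<and> N (\<lambda>t. \<Sum>i\<in>I. f i t) \<le> (\<Sum>i\<in>I. N (f i))"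
  proof (induction I rule: infinite_finite_induct)
    case (insert i I)
    then show ?case
      using add_in_E[of "f i" "\<lambda>t. \<Sum>i\<in>I. f i t"] norm_add[of "f i" "\<lambda>t. \<Sum>i\<in>I. f i t"]
      by fastforce
  qed (auto simp: zero_in_E norm_zero)
  then show "(\<And>i. i \<in> I \<Longrightarrow> f i \<in> E) \<Longrightarrow> (\<lambda>t. \<Sum>i\<in>I. f i t) \<in> E"
    "(\<And>i. i \<in> I \<Longrightarrow> f i \<in> E) \<Longrightarrow> N (\<lambda>t. \<Sum>i\<in>I. f i t) \<le> (\<Sum>i\<in>I. N (f i))" by auto
qed

text \<open>The form in which rearrangement invariance is used from here on: levels s instead of
  arguments t, so that infima no longer appear.\<close>

lemma dominated:
  assumes "y \<in> E" "x \<in> borel_measurable unit_int" "\<And>s. 0 \<le> s \<Longrightarrow> distr_fun x s \<le> distr_fun y s"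
  shows "x \<in> E" "N x \<le> N y"
proof -
  have "\<forall>t\<in>{0<..<1}. rearrangement x t \<le> rearrangement y t"
    using assms measurable_E by (intro ballI rearrangement_mono) auto
  then show "x \<in> E" "N x \<le> N y" using ri_space assms by (auto simp: ri_space_def)
qed

lemma dominated_AE:
  assumes "y \<in> E" "x \<in> borel_measurable unit_int" "AE t in unit_int. \<bar>x t\<bar> \<le> \<bar>y t\<bar>"
  shows "x \<in> E" "N x \<le> N y"
  using dominated[OF assms(1,2)] distr_fun_mono_AE[OF assms(2) measurable_E[OF assms(1)] assms(3)] by auto

lemma dominated_le:
  assumes "y \<in> E" "x \<in> borel_measurable unit_int" "\<And>t. t \<in> {0..1} \<Longrightarrow> \<bar>x t\<bar> \<le> \<bar>y t\<bar>"
  shows "x \<in> E" "N x \<le> N y"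
  using assms by (auto intro!: dominated_AE[of y x] AE_I2)

text \<open>A non-null x exceeds some e > 0 on a set of measure at least 1 / m. By rearrangement E
  then contains e times the indicator of every interval of length 1 / m, and m such intervals cover
  the unit interval.\<close>

lemma one_in_E:
  assumes x: "x \<in> E" "N x \<noteq> 0"
  shows "(\<lambda>_. 1) \<in> E"
proof -
  have "\<exists>n. distr_fun x (1 / real (Suc n)) > 0"
  proof (rule ccontr)
    assume *: "\<nexists>n. distr_fun x (1 / real (Suc n)) > 0"
    have "AE t in unit_int. \<forall>n. \<not> 1 / real (Suc n) < \<bar>x t\<bar>"
      unfolding AE_all_countable
    proof (intro allI)
      fix n
      have "measure unit_int {u \<in> {0..1}. 1 / real (Suc n) < \<bar>x u\<bar>} = 0"
        using * measure_nonneg[of unit_int "{u \<in> {0..1}. 1 / real (Suc n) < \<bar>x u\<bar>}"]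
        unfolding distr_fun_def by (meson not_less order_antisym)
      then have "{u \<in> {0..1}. 1 / real (Suc n) < \<bar>x u\<bar>} \<in> null_sets unit_int"
        using level_set_measurable[OF measurable_E[OF x(1)]]
        by (auto simp: null_sets_def finite_measure.emeasure_eq_measure)
      then show "AE t in unit_int. \<not> 1 / real (Suc n) < \<bar>x t\<bar>"
        by (rule AE_I') auto
    qed
    then have "AE t in unit_int. x t = 0"
    proof (rule AE_mp, intro AE_I2 impI)
      fix t assume "\<forall>n. \<not> 1 / real (Suc n) < \<bar>x t\<bar>"
      then show "x t = 0" using reals_Archimedean[of "\<bar>x t\<bar>"] by (auto simp: inverse_eq_divide)
    qed
    then show False using x norm_eq_0_iff by simp
  qed
  then obtain n where n: "distr_fun x (1 / real (Suc n)) > 0" by blast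
  define e where "e = 1 / real (Suc n)"
  have e: "e > 0" by (simp add: e_def)
  obtain m0 where m0: "inverse (real (Suc m0)) < distr_fun x e"
    using reals_Archimedean[OF n] by (auto simp: e_def)
  define m where "m = Suc m0"
  have m: "m > 0" "1 / real m \<le> distr_fun x e" using m0 by (auto simp: m_def inverse_eq_divide)
  define f where "f i = (indicator {real i / m .. (real i + 1) / m} :: real \<Rightarrow> real)" for i :: nat
  have "f i \<in> E" if "i < m" for i
  proof -
    have b: "0 \<le> real i / m" "(real i + 1) / m \<le> 1" "real i / m \<le> (real i + 1) / m"
      using that m by (auto simp: field_simps)
    have f: "f i \<in> borel_measurable unit_int" unfolding f_def using b by (intro borel_measurable_indicator) auto
    have "(\<lambda>t. e * f i t) \<in> E"
    proof (rule dominated[OF x(1)])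
      show "(\<lambda>t. e * f i t) \<in> borel_measurable unit_int" using f by simp
      fix s :: real assume s: "0 \<le> s"
      show "distr_fun (\<lambda>t. e * f i t) s \<le> distr_fun x s"
      proof (cases "s < e")
        case True
        have "{u \<in> {0..1}. s < \<bar>e * f i u\<bar>} = {real i / m .. (real i + 1) / m}"
          using True s b e by (auto simp: f_def indicator_def intro: order_trans[OF b(1)])
        then have "distr_fun (\<lambda>t. e * f i t) s = 1 / m"
          unfolding distr_fun_def using b m by (simp add: measure_unit_int_subinterval add_divide_distrib)
        also have "\<dots> \<le> distr_fun x e" by (rule m)
        also have "\<dots> \<le> distr_fun x s" using True measurable_E x by (intro distr_fun_antimono) auto
        finally show ?thesis .
      next
        case False
        then have "{u \<in> {0..1}. s < \<bar>e * f i u\<bar>} = {}"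
          using s e by (auto simp: f_def indicator_def)
        then show ?thesis unfolding distr_fun_def by (metis measure_empty measure_nonneg)
      qed
    qed
    from scale_in_E[OF this, of "1 / e"] show ?thesis using e by simp
  qed
  then have s: "(\<lambda>t. \<Sum>i<m. f i t) \<in> E" by (intro sum_in_E) auto
  show ?thesis
  proof (rule dominated_le(1)[OF s])
    fix t :: real assume t: "t \<in> {0..1}"
    have f0: "0 \<le> f i t" for i by (simp add: f_def)
    define i where "i = (if t = 1 then m - 1 else nat \<lfloor>t * m\<rfloor>)"
    have "i < m \<and> real i \<le> t * m \<and> t * m \<le> real i + 1"
    proof (cases "t = 1")
      case True then show ?thesis using m by (auto simp: i_def)
    next
      case False
      then have "t * m < m" "0 \<le> t * m" using t m by auto
      then show ?thesis using False unfolding i_def by (simp add: nat_less_iff floor_less_iff)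
    qed
    then have i: "i < m" "f i t = 1" using m by (auto simp: f_def field_simps indicator_def)
    have "f i t \<le> (\<Sum>i<m. f i t)" using i f0 by (intro member_le_sum) auto
    then show "\<bar>1\<bar> \<le> \<bar>\<Sum>i<m. f i t\<bar>" using i by linarith
  qed simp
qed

end

section \<open>Spaces containing the constants\<close>

locale ri_one = ri +
  assumes one_in: "(\<lambda>_. 1) \<in> E"
begin

lemma norm_one_pos: "0 < N (\<lambda>_. 1)"
proof -
  have "\<not> (AE t in unit_int. (1::real) = 0)"
    using emeasure_unit_int_space by (subst AE_iff_measurable[of "{0..1}"]) auto
  then show ?thesis using norm_nonneg[OF one_in] norm_eq_0_iff[OF one_in] by auto
qed

lemma bounded_in_E:
  assumes "x \<in> borel_measurable unit_int" "\<And>t. t \<in> {0..1} \<Longrightarrow> \<bar>x t\<bar> \<le> B"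
  shows "x \<in> E"
  by (rule dominated_le(1)[OF scale_in_E[OF one_in, of B]]) (use assms in fastforce)+

lemma initial_in_E: "(indicator {0..t} :: real \<Rightarrow> real) \<in> E"
  by (rule bounded_in_E[of _ 1]) (auto simp: borel_measurable_unit_int indicator_def)

text \<open>The sum of 2^j times the indicator of [0, \<tau> j] has terms of norm at most 2^-j, so
  it converges in E. If the limit x were bounded by b, then for 2^j > b + 1 and n > j the difference
  u n - x would exceed 1 on [0, \<tau> j], and the indicator of that interval would have norm 0.
  This needs norm convergence only, not pointwise convergence.\<close>

lemma unbounded_exists:
  assumes small: "\<And>e. e > 0 \<Longrightarrow> \<exists>t. 0 < t \<and> t \<le> 1 \<and> N (indicator {0..t}) < e"
  shows "\<exists>u\<in>E. \<forall>b. 0 < distr_fun u b"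
proof -
  have "\<forall>j. \<exists>t. 0 < t \<and> t \<le> 1 \<and> N (indicator {0..t}) < (1 / 4) ^ j" using small by simp
  then obtain \<tau> where \<tau>: "\<And>j::nat. 0 < \<tau> j \<and> \<tau> j \<le> 1 \<and> N (indicator {0..\<tau> j}) < (1 / 4) ^ j" by metis
  define u where "u n t = (\<Sum>j<n. 2 ^ j * indicator {0..\<tau> j} t :: real)" for n t
  have iE: "(\<lambda>t. 2 ^ j * indicator {0..\<tau> j} t) \<in> E" for j by (intro scale_in_E initial_in_E)
  have uE: "u n \<in> E" for n unfolding u_def by (intro sum_in_E iE)
  have bound: "N (\<lambda>t. u m t - u n t) \<le> 2 * (1 / 2) ^ n" if "n \<le> m" for m n
  proof -
    have "(\<lambda>t. u m t - u n t) = (\<lambda>t. \<Sum>j\<in>{n..<m}. 2 ^ j * indicator {0..\<tau> j} t)"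
    proof
      fix t show "u m t - u n t = (\<Sum>j\<in>{n..<m}. 2 ^ j * indicator {0..\<tau> j} t)"
        using that unfolding u_def lessThan_atLeast0 by (subst sum_diff_nat_ivl) auto
    qed
    then have "N (\<lambda>t. u m t - u n t) \<le> (\<Sum>j\<in>{n..<m}. N (\<lambda>t. 2 ^ j * indicator {0..\<tau> j} t))"
      by (simp only:) (rule norm_sum, rule iE)
    also have "\<dots> \<le> (\<Sum>j\<in>{n..<m}. (1 / 2) ^ j)"
    proof (rule sum_mono)
      fix j
      have "N (\<lambda>t. 2 ^ j * indicator {0..\<tau> j} t) = 2 ^ j * N (indicator {0..\<tau> j})"
        using norm_scale[OF initial_in_E, of "2^j"] by simp
      also have "\<dots> \<le> 2 ^ j * (1 / 4) ^ j" using \<tau>[of j] by (intro mult_left_mono) auto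
      also have "\<dots> = (1 / 2) ^ j" by (simp add: power_divide power_mult_distrib[symmetric] flip: power_mult_distrib)
         (simp add: power_mult_distrib[symmetric] field_simps)
      finally show "N (\<lambda>t. 2 ^ j * indicator {0..\<tau> j} t) \<le> (1 / 2) ^ j" .
    qed
    also have "\<dots> \<le> 2 * (1 / 2) ^ n"
    proof -
      have "(\<Sum>j\<in>{n..<m}. (1 / 2 :: real) ^ j) = 2 * (1 / 2) ^ n - 2 * (1 / 2) ^ m"
        using that
      proof (induction m rule: dec_induct)
        case (step k)
        then show ?case by simp
      qed simp
      then show ?thesis by simp
    qed
    finally show ?thesis .
  qed
  have "\<exists>x\<in>E. (\<lambda>n::nat. N (\<lambda>t. u n t - x t)) \<longlonglongrightarrow> 0"
  proof (rule complete_E[OF uE])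
    fix e :: real assume e: "e > 0"
    obtain K where K: "(1 / 2 :: real) ^ K < e / 2" using real_arch_pow_inv[of "e / 2" "1/2"] e by auto
    have "N (\<lambda>t. u m t - u n t) < e" if "K \<le> m" "K \<le> n" for m n
    proof -
      have s: "N (\<lambda>t. u m t - u n t) = N (\<lambda>t. u n t - u m t)"
        using norm_scale[OF diff_in_E[OF uE uE], of "-1" n m] by simp
      have "(1 / 2 :: real) ^ n \<le> (1 / 2) ^ K" "(1 / 2 :: real) ^ m \<le> (1 / 2) ^ K"
        using that by (auto intro!: power_decreasing)
      moreover have "N (\<lambda>t. u m t - u n t) \<le> 2 * (1 / 2) ^ n \<or> N (\<lambda>t. u m t - u n t) \<le> 2 * (1 / 2) ^ m"
        using bound[of n m] bound[of m n] s by (metis nat_le_linear)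
      ultimately show ?thesis using K by linarith
    qed
    then show "\<exists>K. \<forall>m\<ge>K. \<forall>n\<ge>K. N (\<lambda>t. u m t - u n t) < e" by blast
  qed
  then obtain x where x: "x \<in> E" "(\<lambda>n::nat. N (\<lambda>t. u n t - x t)) \<longlonglongrightarrow> 0" by blast
  have "0 < distr_fun x b" for b
  proof (rule ccontr)
    assume "\<not> 0 < distr_fun x b"
    then have "measure unit_int {u \<in> {0..1}. b < \<bar>x u\<bar>} = 0"
      using measure_nonneg[of unit_int] unfolding distr_fun_def by (meson not_less order_antisym)
    then have "{u \<in> {0..1}. b < \<bar>x u\<bar>} \<in> null_sets unit_int"
      using level_set_measurable[OF measurable_E[OF x(1)]]
      by (auto simp: null_sets_def finite_measure.emeasure_eq_measure)
    then have ae: "AE t in unit_int. \<not> b < \<bar>x t\<bar>" by (rule AE_I') auto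
    obtain j where j: "b + 1 < 2 ^ j" using real_arch_pow[of 2 "b + 1"] by auto
    have le: "N (indicator {0..\<tau> j}) \<le> N (\<lambda>t. u n t - x t)" if n: "j < n" for n
    proof (rule dominated_AE(2)[OF diff_in_E[OF uE x(1)]])
      show "AE t in unit_int. \<bar>indicat_real {0..\<tau> j} t\<bar> \<le> \<bar>u n t - x t\<bar>"
        using ae
      proof (rule AE_mp, intro AE_I2 impI)
        fix t assume t: "\<not> b < \<bar>x t\<bar>"
        show "\<bar>indicat_real {0..\<tau> j} t\<bar> \<le> \<bar>u n t - x t\<bar>"
        proof (cases "t \<in> {0..\<tau> j}")
          case True
          have "2 ^ j * indicator {0..\<tau> j} t \<le> u n t"
            unfolding u_def using n by (intro member_le_sum) auto
          then show ?thesis using True t j by simp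
        qed auto
      qed
    qed (use initial_in_E measurable_E in auto)
    have "N (indicator {0..\<tau> j}) \<le> 0"
      using x(2) le by (intro LIMSEQ_le_const[OF x(2)]) (auto intro!: exI[of _ "Suc j"])
    then have "N (indicator {0..\<tau> j}) = 0" using norm_nonneg[OF initial_in_E, of "\<tau> j"] by simp
    then have "AE t in unit_int. indicat_real {0..\<tau> j} t = 0" using norm_eq_0_iff[OF initial_in_E] by simp
    then have "emeasure unit_int {0..\<tau> j} = 0"
      using \<tau>[of j] by (subst (asm) AE_iff_measurable[of "{0..\<tau> j}"]) (auto simp: indicator_def)
    then show False using \<tau>[of j] measure_unit_int_subinterval(1)[of 0 "\<tau> j"] by (simp add: measure_def)
  qed
  then show ?thesis using x by blast
qed

end

section \<open>The Fatou property of maximal and minimal spaces\<close>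

locale ri_fatou = ri +
  assumes max_min: "maximal_space E N \<or> minimal_space E N"
begin

lemma norm_second_associate: "x \<in> E \<Longrightarrow> ennreal (N x) = second_associate_norm E N x"
  using max_min measurable_E[of x] unfolding maximal_space_def minimal_space_def ext_norm_def by force

text \<open>On E the norm equals the second associate norm, a supremum of integrals against fixed
  functions g; each such integral is the supremum of those of the truncations by monotone
  convergence.\<close>

lemma norm_truncation_bound:
  assumes y: "y \<in> E" and B: "\<And>n::nat. N (\<lambda>t. if \<bar>y t\<bar> < 2 ^ n then y t else 0) \<le> B"
  shows "N y \<le> B"
proof -
  have [measurable]: "y \<in> borel_measurable unit_int" using y by (rule measurable_E)
  define Y where "Y n t = (if \<bar>y t\<bar> < 2 ^ n then y t else 0)" for n :: nat and t
  have Ym[measurable]: "Y n \<in> borel_measurable unit_int" for n unfolding Y_def by measurable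
  have YE: "Y n \<in> E" for n by (rule dominated_le(1)[OF y]) (auto simp: Y_def[abs_def])
  have B0: "0 \<le> B" using B[of 0] norm_nonneg[OF YE[of 0]] by (simp add: Y_def[abs_def])
  have "second_associate_norm E N y \<le> ennreal B"
    unfolding associate_norm_def[of "associate_norm (ext_norm E N)"]
  proof (rule SUP_least)
    fix g assume g: "g \<in> {x \<in> borel_measurable unit_int. associate_norm (ext_norm E N) x \<le> 1}"
    then have [measurable]: "g \<in> borel_measurable unit_int" by simp
    have "(\<integral>\<^sup>+ t. ennreal \<bar>g t * y t\<bar> \<partial>unit_int) = (\<integral>\<^sup>+ t. (SUP n. ennreal \<bar>g t * Y n t\<bar>) \<partial>unit_int)"
    proof (rule nn_integral_cong)
      fix t
      obtain n where "\<bar>y t\<bar> < 2 ^ n" using real_arch_pow[of 2 "\<bar>y t\<bar>"] by auto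
      then show "ennreal \<bar>g t * y t\<bar> = (SUP n. ennreal \<bar>g t * Y n t\<bar>)"
        by (intro antisym SUP_least SUP_upper2[of n]) (auto simp: Y_def)
    qed
    also have "\<dots> = (SUP n. \<integral>\<^sup>+ t. ennreal \<bar>g t * Y n t\<bar> \<partial>unit_int)"
    proof (rule nn_integral_monotone_convergence_SUP)
      have "\<bar>Y n t\<bar> \<le> \<bar>Y m t\<bar>" if "n \<le> m" for n m t
        using less_le_trans[OF _ power_increasing[OF that, of "2::real"], of "\<bar>y t\<bar>"] by (simp add: Y_def)
      then show "incseq (\<lambda>n t. ennreal \<bar>g t * Y n t\<bar>)"
        by (auto simp: incseq_def le_fun_def abs_mult intro!: mult_left_mono)
    qed measurable
    also have "\<dots> \<le> ennreal B"
    proof (rule SUP_least)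
      fix n
      have "(\<integral>\<^sup>+ t. ennreal \<bar>g t * Y n t\<bar> \<partial>unit_int) \<le> second_associate_norm E N (Y n)"
        unfolding associate_norm_def[of "associate_norm (ext_norm E N)"] by (rule SUP_upper[OF g])
      also have "\<dots> = ennreal (N (Y n))" using norm_second_associate[OF YE] by simp
      also have "\<dots> \<le> ennreal B" using B[of n] by (intro ennreal_leI) (simp add: Y_def[abs_def])
      finally show "(\<integral>\<^sup>+ t. ennreal \<bar>g t * Y n t\<bar> \<partial>unit_int) \<le> ennreal B" .
    qed
    finally show "(\<integral>\<^sup>+ t. ennreal \<bar>g t * y t\<bar> \<partial>unit_int) \<le> ennreal B" .
  qed
  then have "ennreal (N y) \<le> ennreal B" using norm_second_associate[OF y] by simp
  then show ?thesis using B0 by simp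
qed

end

subsection \<open>Transport operators\<close>

lemma integrable_bounded_unit_int:
  fixes f :: "real \<Rightarrow> real"
  assumes "f \<in> borel_measurable unit_int" "\<And>t. t \<in> {0..1} \<Longrightarrow> \<bar>f t\<bar> \<le> B"
  shows "integrable unit_int f"
proof (rule Bochner_Integration.integrable_bound[of _ "\<lambda>_. B"])
  show "integrable unit_int (\<lambda>_. B)"
    by (rule finite_measure.integrable_const) simp
qed (use assms in \<open>auto intro!: AE_I2 order_trans[OF assms(2)]\<close>)

lemma integrable_times_bounded:
  fixes f g :: "real \<Rightarrow> real"
  assumes f: "integrable unit_int f" and "g \<in> borel_measurable unit_int" "\<And>t. t \<in> {0..1} \<Longrightarrow> \<bar>g t\<bar> \<le> B"
  shows "integrable unit_int (\<lambda>t. g t * f t)"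
proof (rule Bochner_Integration.integrable_bound[of _ "\<lambda>t. B * f t"])
  show "AE t in unit_int. norm (g t * f t) \<le> norm (B * f t)"
    using assms by (auto simp: abs_mult intro!: AE_I2 mult_right_mono order_trans[OF assms(3)])
qed (use assms in auto)

lemma L_space_finite_iff:
  "x \<in> L_space (ereal p) \<longleftrightarrow> x \<in> borel_measurable unit_int \<and> integrable unit_int (\<lambda>t. \<bar>x t\<bar> powr p)"
  by (simp add: L_space_def)

lemma L_space_integrable:
  assumes "1 \<le> p" "x \<in> L_space (ereal p)"
  shows "integrable unit_int x"
proof (rule Bochner_Integration.integrable_bound[of _ "\<lambda>t. 1 + \<bar>x t\<bar> powr p"])
  show "integrable unit_int (\<lambda>t. 1 + \<bar>x t\<bar> powr p)"
    using assms(2) by (auto simp: L_space_finite_iff intro!: Bochner_Integration.integrable_add finite_measure.integrable_const)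
  show "AE t in unit_int. norm (x t) \<le> norm (1 + \<bar>x t\<bar> powr p)"
  proof (intro AE_I2)
    fix t
    show "norm (x t) \<le> norm (1 + \<bar>x t\<bar> powr p)"
    proof (cases "\<bar>x t\<bar> \<le> 1")
      case False
      then have "\<bar>x t\<bar> powr 1 \<le> \<bar>x t\<bar> powr p" using assms by (intro powr_mono) auto
      then show ?thesis using False by simp
    qed (auto intro: order_trans)
  qed
qed (use assms in \<open>auto simp: L_space_finite_iff\<close>)

lemma esssup_abs_nonneg:
  assumes "x \<in> borel_measurable unit_int"
  shows "0 \<le> esssup unit_int (\<lambda>t. ereal \<bar>x t\<bar>)"
proof -
  have "esssup unit_int (\<lambda>t. 0::ereal) \<le> esssup unit_int (\<lambda>t. ereal \<bar>x t\<bar>)"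
    by (rule esssup_mono) auto
  then show ?thesis using emeasure_unit_int_space by (simp add: esssup_const)
qed

lemma L_space_inf_AE:
  assumes "x \<in> L_space \<infinity>"
  shows "AE t in unit_int. \<bar>x t\<bar> \<le> L_norm \<infinity> x" "0 \<le> L_norm \<infinity> x"
proof -
  have "x \<in> borel_measurable unit_int" and fin: "esssup unit_int (\<lambda>t. ereal \<bar>x t\<bar>) < \<infinity>"
    using assms by (auto simp: L_space_def)
  then have nn: "0 \<le> esssup unit_int (\<lambda>t. ereal \<bar>x t\<bar>)" by (intro esssup_abs_nonneg)
  then have e: "esssup unit_int (\<lambda>t. ereal \<bar>x t\<bar>) = ereal (L_norm \<infinity> x)"
    using fin by (cases "esssup unit_int (\<lambda>t. ereal \<bar>x t\<bar>)") (auto simp: L_norm_def)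
  show "0 \<le> L_norm \<infinity> x" using nn e by simp
  show "AE t in unit_int. \<bar>x t\<bar> \<le> L_norm \<infinity> x"
    using esssup_AE[where M = unit_int and f = "\<lambda>t. ereal \<bar>x t\<bar>"] unfolding e by simp
qed

lemma L_space_infI:
  assumes x: "x \<in> borel_measurable unit_int" and "\<And>t. t \<in> {0..1} \<Longrightarrow> \<bar>x t\<bar> \<le> S"
  shows "x \<in> L_space \<infinity>" "L_norm \<infinity> x \<le> S"
proof -
  have le: "esssup unit_int (\<lambda>t. ereal \<bar>x t\<bar>) \<le> ereal S"
    using assms by (intro esssup_I) (auto intro!: AE_I2)
  then show "x \<in> L_space \<infinity>" using x by (auto simp: L_space_def)
  show "L_norm \<infinity> x \<le> S"
    using le esssup_abs_nonneg[OF x] by (cases "esssup unit_int (\<lambda>t. ereal \<bar>x t\<bar>)") (auto simp: L_norm_def)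
qed

lemma bounded_in_L_space:
  assumes x: "x \<in> borel_measurable unit_int" and B: "\<And>t. t \<in> {0..1} \<Longrightarrow> \<bar>x t\<bar> \<le> B" and r: "1 \<le> r"
  shows "x \<in> L_space r"
proof (cases r)
  case (real s)
  have "integrable unit_int (\<lambda>t. \<bar>x t\<bar> powr s)"
    using x B r real by (intro integrable_bounded_unit_int[of _ "B powr s"]) (auto intro!: powr_mono2)
  then show ?thesis using x by (simp add: real L_space_finite_iff)
next
  case PInf
  then show ?thesis using L_space_infI(1)[OF x B] by simp
qed (use r in auto)

lemma L_norm_finite_mono:
  assumes "0 < r" "(\<integral>t. \<bar>x t\<bar> powr r \<partial>unit_int) \<le> (\<integral>t. \<bar>y t\<bar> powr r \<partial>unit_int)"
  shows "L_norm (ereal r) x \<le> L_norm (ereal r) y"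
  using assms by (auto simp: L_norm_def intro!: powr_mono2 integral_nonneg)

text \<open>At most one summand is nonzero at t, so any map fixing 0 passes through the sum. It
  serves for powers, absolute values, truncations, indicators of level sets and Orlicz
  functions.\<close>

lemma disjoint_sum_indicator:
  fixes \<phi> :: "real \<Rightarrow> real"
  assumes d: "disjoint_family_on B I" and I: "finite I" and "\<phi> 0 = 0"
  shows "\<phi> (\<Sum>k\<in>I. indicator (B k) t * a k) = (\<Sum>k\<in>I. indicator (B k) t * \<phi> (a k))"
proof (cases "\<exists>k\<in>I. t \<in> B k")
  case True
  then obtain k where k: "k \<in> I" "t \<in> B k" by blast
  have n: "t \<notin> B j" if "j \<in> I" "j \<noteq> k" for j
    using d that k by (auto simp: disjoint_family_on_def)
  have "(\<Sum>j\<in>I. indicator (B j) t * c j) = (c k :: real)" for c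
  proof -
    have "(\<Sum>j\<in>I. indicator (B j) t * c j) = (\<Sum>j\<in>{k}. indicator (B j) t * c j)"
      using k n I by (intro sum.mono_neutral_right) auto
    then show ?thesis using k by simp
  qed
  then show ?thesis by simp
next
  case False
  then have "(\<Sum>j\<in>I. indicator (B j) t * c j) = (0 :: real)" for c
    by (intro sum.neutral) auto
  then show ?thesis using assms by simp
qed

locale interp = ri_one +
  fixes p :: real and q :: ereal and cI :: real
  assumes p1: "1 \<le> p" and pq: "ereal p < q" and cI: "0 < cI"
    and interp: "\<And>T x. (\<And>x. x \<in> L_space (ereal p) \<inter> L_space q \<Longrightarrow> T x \<in> L_space (ereal p) \<inter> L_space q) \<Longrightarrow>
        (\<And>x y. x \<in> L_space (ereal p) \<inter> L_space q \<Longrightarrow> y \<in> L_space (ereal p) \<inter> L_space q \<Longrightarrow>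
           AE t in unit_int. T (\<lambda>s. x s + y s) t = T x t + T y t) \<Longrightarrow>
        (\<And>x a. x \<in> L_space (ereal p) \<inter> L_space q \<Longrightarrow> AE t in unit_int. T (\<lambda>s. a * x s) t = a * T x t) \<Longrightarrow>
        (\<And>x. x \<in> L_space (ereal p) \<inter> L_space q \<Longrightarrow> L_norm (ereal p) (T x) \<le> L_norm (ereal p) x) \<Longrightarrow>
        (\<And>x. x \<in> L_space (ereal p) \<inter> L_space q \<Longrightarrow> L_norm q (T x) \<le> L_norm q x) \<Longrightarrow>
        x \<in> E \<inter> L_space (ereal p) \<inter> L_space q \<Longrightarrow> T x \<in> E \<and> N (T x) \<le> cI * N x"
begin

lemma q1: "1 \<le> q" using p1 pq by (metis ereal_less_eq(3) less_imp_le one_ereal_def order_trans)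

text \<open>The operator behind this lemma maps \<open>f\<close> to
  \<open>\<Sum>k. b k * (\<integral> (f / x) d\<nu>\<^sub>k) * 1\<^bsub>B k\<^esub>\<close> with the probability measures \<open>\<nu>\<^sub>k\<close> of density
  proportional to \<open>w k * x powr \<rho>\<close>. It maps \<open>x\<close> to \<open>\<Sum>k. b k * 1\<^bsub>B k\<^esub>\<close>, and Jensen's
  inequality makes it a contraction on both Lebesgue spaces.\<close>

lemma transport:
  fixes x :: "real \<Rightarrow> real" and b :: "nat \<Rightarrow> real" and w :: "nat \<Rightarrow> real \<Rightarrow> real"
  assumes x[measurable]: "x \<in> borel_measurable unit_int" and x1: "\<And>t. 1 \<le> x t" and xB: "\<And>t. x t \<le> M"
    and b: "\<And>k. k < m \<Longrightarrow> 0 < b k" and B: "\<And>k. k < m \<Longrightarrow> B k \<in> sets unit_int"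
    and disj: "disjoint_family_on B {..<m}"
    and w: "\<And>k. k < m \<Longrightarrow> w k \<in> borel_measurable unit_int" "\<And>k t. k < m \<Longrightarrow> 0 \<le> w k t"
      "\<And>t. (\<Sum>k<m. w k t) \<le> 1"
    and H: "\<And>k. k < m \<Longrightarrow> (\<integral>t. w k t * x t powr \<rho> \<partial>unit_int) = b k powr \<rho> * measure unit_int (B k)"
    and side: "(\<rho> = p \<and> (\<forall>k<m. \<forall>t. w k t \<noteq> 0 \<longrightarrow> b k \<le> x t)) \<or> (ereal \<rho> = q \<and> (\<forall>k<m. \<forall>t. w k t \<noteq> 0 \<longrightarrow> x t \<le> b k))"
  shows "N (\<lambda>t. \<Sum>k<m. indicator (B k) t * b k) \<le> cI * N x"
proof -
  define c where "c f k = (\<integral>t. w k t * x t powr (\<rho> - 1) * f t \<partial>unit_int) / (b k powr \<rho> * measure unit_int (B k))" for f k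
  define T where "T f t = (\<Sum>k<m. indicator (B k) t * (b k * c f k))" for f t
  have xp: "0 < x t" for t using x1[of t] by linarith
  have w1: "w k t \<le> 1" if "k < m" for k t
    using w that by (intro order_trans[OF member_le_sum[of k "{..<m}" "\<lambda>k. w k t"] w(3)]) auto
  have powx: "x t powr s \<le> M powr \<bar>s\<bar>" for t s
    using x1[of t] xB[of t] by (intro order_trans[OF powr_mono[of s "\<bar>s\<bar>" "x t"] powr_mono2]) auto
  have gm: "(\<lambda>t. w k t * x t powr s) \<in> borel_measurable unit_int" if "k < m" for k s
    using w(1)[OF that] by measurable
  have gb: "\<bar>w k t * x t powr s\<bar> \<le> M powr \<bar>s\<bar>" if "k < m" for k s t
    using w(2)[OF that, of t] w1[OF that, of t] powx[of t s] mult_mono[of "w k t" 1 "x t powr s" "M powr \<bar>s\<bar>"]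
    by (simp add: abs_mult)
  have gi: "integrable unit_int (\<lambda>t. w k t * x t powr s * f t)" if "k < m" "integrable unit_int f" for k s f
    by (rule integrable_times_bounded[OF that(2) gm gb]) (use that in auto)
  have Tm: "T f \<in> borel_measurable unit_int" for f
    unfolding T_def using B by (intro borel_measurable_sum borel_measurable_times borel_measurable_indicator) auto
  have Tbound: "\<bar>T f t\<bar> \<le> (\<Sum>k<m. \<bar>b k * c f k\<bar>)" for f t
    unfolding T_def by (rule order_trans[OF sum_abs]) (auto intro!: sum_mono simp: indicator_def)
  have TL: "T f \<in> L_space (ereal p) \<inter> L_space q" for f
    using p1 q1 by (auto intro!: bounded_in_L_space[OF Tm Tbound])
  \<comment> \<open>This is why one operator contracts both spaces. For r = \<rho> the factor is 1;
    for the other exponent it is at most 1 because \<open>side\<close> puts x above b k when \<rho>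
    is the smaller exponent and below b k when it is the larger one.\<close>
  have side': "b k powr (r - \<rho>) * x t powr (\<rho> - r) \<le> 1"
    if "k < m" "w k t \<noteq> 0" "ereal r = ereal p \<or> ereal r = q" for k t r
  proof -
    have bk: "0 < b k" using b that by simp
    have "b k powr (r - \<rho>) \<le> x t powr (r - \<rho>)"
      using side
    proof
      assume a: "\<rho> = p \<and> (\<forall>k<m. \<forall>t. w k t \<noteq> 0 \<longrightarrow> b k \<le> x t)"
      then have "\<rho> \<le> r" using that(3) pq by (cases q) auto
      then show ?thesis using a that bk by (intro powr_mono2) auto
    next
      assume a: "ereal \<rho> = q \<and> (\<forall>k<m. \<forall>t. w k t \<noteq> 0 \<longrightarrow> x t \<le> b k)"
      then have "r \<le> \<rho>" using that(3) pq by auto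
      then show ?thesis using a that bk xp[of t] by (intro powr_mono2') auto
    qed
    then have "b k powr (r - \<rho>) * x t powr (\<rho> - r) \<le> x t powr (r - \<rho>) * x t powr (\<rho> - r)"
      by (intro mult_right_mono) auto
    also have "\<dots> = 1" using xp[of t] by (simp add: powr_add[symmetric])
    finally show ?thesis .
  qed
  have powerbound: "(\<integral>t. \<bar>T f t\<bar> powr r \<partial>unit_int) \<le> (\<integral>t. \<bar>f t\<bar> powr r \<partial>unit_int)"
    if r: "ereal r = ereal p \<or> ereal r = q" and f: "integrable unit_int f" "integrable unit_int (\<lambda>t. \<bar>f t\<bar> powr r)" for r f
  proof -
    have r1: "1 \<le> r" using r p1 q1 by auto
    have [measurable]: "f \<in> borel_measurable unit_int" using f by auto
    \<comment> \<open>Jensen's inequality for the k-th probability measure. By H the total mass h of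
      W equals b k powr \<rho> times the measure of B k, so after cancellation exactly the factor of
      \<open>side'\<close> remains.\<close>
    have piece: "measure unit_int (B k) * \<bar>b k * c f k\<bar> powr r \<le> (\<integral>t. w k t * \<bar>f t\<bar> powr r \<partial>unit_int)" if k: "k < m" for k
    proof (cases "measure unit_int (B k) = 0")
      case True
      then show ?thesis using w(2)[OF k] by (auto intro!: integral_nonneg)
    next
      case False
      then have Bk: "measure unit_int (B k) > 0" using measure_nonneg[of unit_int "B k"] by linarith
      define W where "W t = w k t * x t powr \<rho>" for t
      define h where "h = (\<integral>t. W t \<partial>unit_int)"
      have h: "h = b k powr \<rho> * measure unit_int (B k)" using H[OF k] by (simp add: h_def W_def)
      have bk: "b k > 0" using b k by simp
      have h0: "h > 0" using h bk Bk by simp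
      have e1: "W t * \<bar>f t / x t\<bar> = w k t * x t powr (\<rho> - 1) * \<bar>f t\<bar>" for t
        using xp[of t] by (simp add: W_def powr_diff)
      have er: "W t * \<bar>f t / x t\<bar> powr r = w k t * x t powr (\<rho> - r) * \<bar>f t\<bar> powr r" for t
        using xp[of t] by (simp add: W_def powr_diff powr_divide)
      define I where "I = (\<integral>t. W t * \<bar>f t / x t\<bar> \<partial>unit_int)"
      have iW: "integrable unit_int W"
        unfolding W_def using gm[OF k] gb[OF k] by (rule integrable_bounded_unit_int)
      have Jensen: "I powr r \<le> h powr (r - 1) * (\<integral>t. W t * \<bar>f t / x t\<bar> powr r \<partial>unit_int)"
        unfolding I_def h_def
      proof (rule weighted_power_mean[OF r1 _ iW])
        show "0 \<le> W t" for t using w(2)[OF k] by (simp add: W_def)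
        show "integrable unit_int (\<lambda>t. W t * \<bar>f t / x t\<bar>)" unfolding e1 using f by (intro gi[OF k]) auto
        show "integrable unit_int (\<lambda>t. W t * \<bar>f t / x t\<bar> powr r)" unfolding er using f by (intro gi[OF k]) auto
        show "0 < (\<integral>t. W t \<partial>unit_int)" using h0 by (simp add: h_def)
      qed
      have I0: "0 \<le> I" using w(2)[OF k] by (auto simp: I_def W_def intro!: integral_nonneg)
      have "\<bar>c f k\<bar> \<le> I / h"
      proof -
        have "\<bar>(\<integral>t. w k t * x t powr (\<rho> - 1) * f t \<partial>unit_int)\<bar> \<le> (\<integral>t. \<bar>w k t * x t powr (\<rho> - 1) * f t\<bar> \<partial>unit_int)"
          by (rule integral_abs_bound)
        also have "\<dots> = I" unfolding I_def e1
          using w(2)[OF k] by (intro Bochner_Integration.integral_cong) (auto simp: abs_mult)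
        finally show ?thesis using h0 by (simp add: c_def h[symmetric] divide_right_mono)
      qed
      then have "\<bar>b k * c f k\<bar> powr r \<le> (b k * (I / h)) powr r"
        using bk r1 mult_left_mono[of "\<bar>c f k\<bar>" "I / h" "b k"] by (intro powr_mono2) (auto simp: abs_mult)
      also have "\<dots> = b k powr r * (I powr r / h powr r)"
        using bk I0 h0 by (simp add: powr_mult powr_divide)
      also have "\<dots> \<le> b k powr r * ((h powr (r - 1) * (\<integral>t. W t * \<bar>f t / x t\<bar> powr r \<partial>unit_int)) / h powr r)"
        using Jensen by (intro mult_left_mono divide_right_mono) auto
      also have "\<dots> = b k powr r / h * (\<integral>t. W t * \<bar>f t / x t\<bar> powr r \<partial>unit_int)"
        using h0 by (simp add: powr_diff)
      finally have "measure unit_int (B k) * \<bar>b k * c f k\<bar> powr r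
          \<le> measure unit_int (B k) * (b k powr r / h * (\<integral>t. W t * \<bar>f t / x t\<bar> powr r \<partial>unit_int))"
        using Bk by (intro mult_left_mono) auto
      also have "\<dots> = b k powr (r - \<rho>) * (\<integral>t. W t * \<bar>f t / x t\<bar> powr r \<partial>unit_int)"
        using Bk bk by (simp add: h powr_diff)
      also have "\<dots> = (\<integral>t. b k powr (r - \<rho>) * (w k t * x t powr (\<rho> - r) * \<bar>f t\<bar> powr r) \<partial>unit_int)"
        unfolding er by simp
      also have "\<dots> \<le> (\<integral>t. w k t * \<bar>f t\<bar> powr r \<partial>unit_int)"
      proof (rule integral_mono)
        show "integrable unit_int (\<lambda>t. b k powr (r - \<rho>) * (w k t * x t powr (\<rho> - r) * \<bar>f t\<bar> powr r))"
          using gi[OF k f(2)] by simp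
        show "integrable unit_int (\<lambda>t. w k t * \<bar>f t\<bar> powr r)"
          using gi[OF k f(2), of 0] xp by (simp add: less_imp_neq[symmetric])
        fix t
        show "b k powr (r - \<rho>) * (w k t * x t powr (\<rho> - r) * \<bar>f t\<bar> powr r) \<le> w k t * \<bar>f t\<bar> powr r"
        proof (cases "w k t = 0")
          case False
          have "(b k powr (r - \<rho>) * x t powr (\<rho> - r)) * (w k t * \<bar>f t\<bar> powr r) \<le> 1 * (w k t * \<bar>f t\<bar> powr r)"
            using w(2)[OF k] by (intro mult_right_mono side'[OF k False r]) auto
          then show ?thesis by (simp add: mult_ac)
        qed simp
      qed
      finally show ?thesis .
    qed
    have iw: "integrable unit_int (\<lambda>t. w k t * \<bar>f t\<bar> powr r)" if "k < m" for k
      using gi[OF that f(2), of 0] xp by (simp add: less_imp_neq[symmetric])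
    have "(\<integral>t. \<bar>T f t\<bar> powr r \<partial>unit_int) = (\<integral>t. (\<Sum>k<m. indicator (B k) t * \<bar>b k * c f k\<bar> powr r) \<partial>unit_int)"
      unfolding T_def
      by (rule Bochner_Integration.integral_cong[OF refl], rule disjoint_sum_indicator[OF disj finite_lessThan, where \<phi> = "\<lambda>s. \<bar>s\<bar> powr r"]) simp
    also have "\<dots> = (\<Sum>k<m. measure unit_int (B k) * \<bar>b k * c f k\<bar> powr r)"
    proof (subst Bochner_Integration.integral_sum)
      fix k assume "k \<in> {..<m}"
      then show "integrable unit_int (\<lambda>t. indicator (B k) t * \<bar>b k * c f k\<bar> powr r)"
        using B by (intro integrable_bounded_unit_int[of _ "\<bar>b k * c f k\<bar> powr r"])
          (auto simp: indicator_def)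
    next
      show "(\<Sum>k<m. \<integral>t. indicator (B k) t * \<bar>b k * c f k\<bar> powr r \<partial>unit_int) = (\<Sum>k<m. measure unit_int (B k) * \<bar>b k * c f k\<bar> powr r)"
        using B sets.sets_into_space[of _ unit_int] by (intro sum.cong refl) (auto simp: Int_absorb2 simp del: space_lebesgue_on)
    qed
    also have "\<dots> \<le> (\<Sum>k<m. \<integral>t. w k t * \<bar>f t\<bar> powr r \<partial>unit_int)" using piece by (intro sum_mono) auto
    also have "\<dots> = (\<integral>t. (\<Sum>k<m. w k t * \<bar>f t\<bar> powr r) \<partial>unit_int)"
      using iw by (subst Bochner_Integration.integral_sum) auto
    also have "\<dots> \<le> (\<integral>t. \<bar>f t\<bar> powr r \<partial>unit_int)"
    proof (rule integral_mono[OF _ f(2)])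
      show "integrable unit_int (\<lambda>t. \<Sum>k<m. w k t * \<bar>f t\<bar> powr r)"
        using iw by (intro Bochner_Integration.integrable_sum) auto
      show "(\<Sum>k<m. w k t * \<bar>f t\<bar> powr r) \<le> \<bar>f t\<bar> powr r" for t
        using mult_right_mono[OF w(3)[of t], of "\<bar>f t\<bar> powr r"] by (simp add: sum_distrib_right)
    qed
    finally show ?thesis .
  qed
  \<comment> \<open>A real \<rho> cannot equal q here, so \<open>side\<close> gives b k \<le> x t
    wherever w k is nonzero, and there b k * f / x is bounded by the supremum norm of f.\<close>
  have supbound: "\<bar>T f t\<bar> \<le> L_norm \<infinity> f" if q: "q = \<infinity>" and f: "f \<in> L_space (ereal p)" "f \<in> L_space \<infinity>" for f t
  proof -
    define S where "S = L_norm \<infinity> f"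
    have S: "0 \<le> S" "AE t in unit_int. \<bar>f t\<bar> \<le> S" using L_space_inf_AE[OF f(2)] by (auto simp: S_def)
    have fi: "integrable unit_int f" using L_space_integrable[OF p1 f(1)] .
    have sd: "\<rho> = p" "\<And>k t. k < m \<Longrightarrow> w k t \<noteq> 0 \<Longrightarrow> b k \<le> x t" using side q by auto
    have bc: "\<bar>b k * c f k\<bar> \<le> S" if k: "k < m" for k
    proof (cases "measure unit_int (B k) = 0")
      case True then show ?thesis using S by (simp add: c_def)
    next
      case False
      then have Bk: "measure unit_int (B k) > 0" using measure_nonneg[of unit_int "B k"] by linarith
      have bk: "b k > 0" using b k by simp
      define h where "h = b k powr \<rho> * measure unit_int (B k)"
      have h0: "h > 0" using bk Bk by (simp add: h_def)
      have "b k * \<bar>\<integral>t. w k t * x t powr (\<rho> - 1) * f t \<partial>unit_int\<bar> \<le> b k * (\<integral>t. \<bar>w k t * x t powr (\<rho> - 1) * f t\<bar> \<partial>unit_int)"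
        using bk by (intro mult_left_mono integral_abs_bound) auto
      also have "\<dots> = (\<integral>t. b k * \<bar>w k t * x t powr (\<rho> - 1) * f t\<bar> \<partial>unit_int)" by simp
      also have "\<dots> \<le> (\<integral>t. S * (w k t * x t powr \<rho>) \<partial>unit_int)"
      proof (rule integral_mono_AE)
        show "integrable unit_int (\<lambda>t. b k * \<bar>w k t * x t powr (\<rho> - 1) * f t\<bar>)" using gi[OF k fi] by auto
        show "integrable unit_int (\<lambda>t. S * (w k t * x t powr \<rho>))"
          using integrable_bounded_unit_int[OF gm gb] k by auto
        show "AE t in unit_int. b k * \<bar>w k t * x t powr (\<rho> - 1) * f t\<bar> \<le> S * (w k t * x t powr \<rho>)"
          using S(2)
        proof (rule AE_mp, intro AE_I2 impI)
          fix t assume ft: "\<bar>f t\<bar> \<le> S"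
          show "b k * \<bar>w k t * x t powr (\<rho> - 1) * f t\<bar> \<le> S * (w k t * x t powr \<rho>)"
          proof (cases "w k t = 0")
            case False
            have "b k * \<bar>w k t * x t powr (\<rho> - 1) * f t\<bar> = w k t * ((b k * x t powr (\<rho> - 1)) * \<bar>f t\<bar>)"
              using w(2)[OF k, of t] by (simp add: abs_mult)
            also have "\<dots> \<le> w k t * ((x t * x t powr (\<rho> - 1)) * S)"
              using w(2)[OF k, of t] xp[of t] ft sd(2)[OF k False]
              by (intro mult_left_mono mult_mono mult_right_mono) auto
            also have "\<dots> = S * (w k t * x t powr \<rho>)" using xp[of t] by (simp add: powr_diff)
            finally show ?thesis .
          qed simp
        qed
      qed
      also have "\<dots> = S * h" using H[OF k] by (simp add: h_def)
      finally show ?thesis using h0 bk by (simp add: c_def h_def[symmetric] abs_mult field_simps)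
    qed
    have "\<bar>T f t\<bar> = (\<Sum>k<m. indicator (B k) t * \<bar>b k * c f k\<bar>)"
      unfolding T_def by (rule disjoint_sum_indicator[OF disj finite_lessThan, where \<phi> = abs]) simp
    also have "\<dots> \<le> (\<Sum>k<m. indicator (B k) t * S)"
      using bc by (intro sum_mono mult_left_mono) auto
    \<comment> \<open>That at most one indicator is nonzero is expressed by pulling min S through
      the disjoint sum.\<close>
    also have "\<dots> = min S (\<Sum>k<m. indicator (B k) t * S)"
      using S(1) by (subst disjoint_sum_indicator[OF disj finite_lessThan, where \<phi> = "min S"]) auto
    also have "\<dots> \<le> S" by simp
    finally show ?thesis by (simp add: S_def)
  qed
  have xL: "x \<in> E \<inter> L_space (ereal p) \<inter> L_space q"
  proof -
    have xb: "\<bar>x t\<bar> \<le> M" for t using xB[of t] xp[of t] by simp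
    then show ?thesis using p1 q1 by (auto intro!: bounded_in_L_space[OF x xb] bounded_in_E[OF x xb])
  qed
  have "T x \<in> E \<and> N (T x) \<le> cI * N x"
  proof (rule interp[OF _ _ _ _ _ xL])
    fix f g assume fg: "f \<in> L_space (ereal p) \<inter> L_space q" "g \<in> L_space (ereal p) \<inter> L_space q"
    have i: "integrable unit_int f" "integrable unit_int g" using fg L_space_integrable[OF p1] by auto
    have "c (\<lambda>s. f s + g s) k = c f k + c g k" if "k < m" for k
      using gi[OF that i(1)] gi[OF that i(2)] by (simp add: c_def distrib_left add_divide_distrib)
    then have "T (\<lambda>s. f s + g s) t = T f t + T g t" for t
      by (simp add: T_def distrib_left sum.distrib)
    then show "AE t in unit_int. T (\<lambda>s. f s + g s) t = T f t + T g t" by simp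
  next
    fix f a
    have "c (\<lambda>s. a * f s) k = a * c f k" for k
    proof -
      have "(\<integral>t. w k t * x t powr (\<rho> - 1) * (a * f t) \<partial>unit_int) = (\<integral>t. a * (w k t * x t powr (\<rho> - 1) * f t) \<partial>unit_int)"
        by (rule Bochner_Integration.integral_cong) (auto simp: mult_ac)
      then show ?thesis by (simp add: c_def)
    qed
    then have "T (\<lambda>s. a * f s) t = a * T f t" for t
      by (simp add: T_def sum_distrib_left mult_ac)
    then show "AE t in unit_int. T (\<lambda>s. a * f s) t = a * T f t" by simp
  next
    fix f assume f: "f \<in> L_space (ereal p) \<inter> L_space q"
    have i: "integrable unit_int f" using f L_space_integrable[OF p1] by auto
    show "L_norm (ereal p) (T f) \<le> L_norm (ereal p) f"
      using p1 f i by (intro L_norm_finite_mono powerbound) (auto simp: L_space_finite_iff)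
    show "L_norm q (T f) \<le> L_norm q f"
    proof (cases "q = \<infinity>")
      case True
      then show ?thesis using f L_space_infI(2)[OF Tm supbound[OF True]] by simp
    next
      case False
      then obtain r where r: "q = ereal r" using q1 by (cases q) auto
      show ?thesis
        unfolding r using q1 f i r by (intro L_norm_finite_mono powerbound) (auto simp: L_space_finite_iff)
    qed
  qed (rule TL)
  moreover have "N (\<lambda>t. \<Sum>k<m. indicator (B k) t * b k) \<le> N (T x)"
  proof (rule dominated_AE(2))
    show "T x \<in> E" using calculation by simp
    show "(\<lambda>t. \<Sum>k<m. indicator (B k) t * b k) \<in> borel_measurable unit_int"
      using B by (intro borel_measurable_sum borel_measurable_times borel_measurable_indicator) auto
    \<comment> \<open>If B k is null, the denominator of c x k is 0 and c x k is 0 rather than 1. So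
      T x agrees with the step function only off the null blocks.\<close>
    have "AE t in unit_int. \<forall>k\<in>{k. k < m \<and> measure unit_int (B k) = 0}. t \<notin> B k"
    proof (subst AE_finite_all)
      show "\<forall>k\<in>{k. k < m \<and> measure unit_int (B k) = 0}. AE t in unit_int. t \<notin> B k"
        using B by (auto intro!: AE_not_in simp: null_sets_def finite_measure.emeasure_eq_measure)
    qed simp
    then show "AE t in unit_int. \<bar>\<Sum>k<m. indicator (B k) t * b k\<bar> \<le> \<bar>T x t\<bar>"
    proof (rule AE_mp, intro AE_I2 impI)
      fix t assume t: "\<forall>k\<in>{k. k < m \<and> measure unit_int (B k) = 0}. t \<notin> B k"
      have "indicator (B k) t * b k = indicator (B k) t * (b k * c x k)" if k: "k < m" for k
      proof (cases "t \<in> B k")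
        case True
        then have "measure unit_int (B k) \<noteq> 0" using t k by auto
        moreover have "(\<integral>t. w k t * x t powr (\<rho> - 1) * x t \<partial>unit_int) = (\<integral>t. w k t * x t powr \<rho> \<partial>unit_int)"
          using xp by (intro Bochner_Integration.integral_cong) (auto simp: powr_diff less_imp_neq[symmetric] abs_of_pos)
        ultimately have "c x k = 1" using H[OF k] b[OF k] by (simp add: c_def)
        then show ?thesis by simp
      qed simp
      then have "(\<Sum>k<m. indicator (B k) t * b k) = T x t" unfolding T_def by (intro sum.cong) auto
      then show "\<bar>\<Sum>k<m. indicator (B k) t * b k\<bar> \<le> \<bar>T x t\<bar>" by simp
    qed
  qed
  ultimately show ?thesis by linarith
qed

end

subsection \<open>Dyadic step functions\<close>

lemma measure_unit_int_eq_lborel: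
  assumes "V \<in> sets borel" "V \<subseteq> {0..1}"
  shows "measure unit_int V = measure lborel V"
  using assms by (subst measure_restrict_space) auto

lemma measure_lborel_affine_preimage:
  fixes c d :: real
  assumes U: "U \<in> sets borel" and c: "c > 0"
  shows "measure lborel {t. c * t + d \<in> U} = measure lborel U / c"
proof -
  have "(\<lambda>t. c * t + d) -` U \<inter> space lborel \<in> sets lborel"
    using U by (intro measurable_sets) auto
  then have V: "{t. c * t + d \<in> U} \<in> sets lborel" by (simp add: vimage_def)
  have "emeasure lborel U = (\<integral>\<^sup>+t. indicator U t \<partial>lborel)" using U by simp
  also have "\<dots> = ennreal \<bar>c\<bar> * (\<integral>\<^sup>+t. indicator U (d + c * t) \<partial>lborel)"
    using U c by (intro nn_integral_real_affine) auto
  also have "(\<integral>\<^sup>+t. indicator U (d + c * t) \<partial>lborel) = (\<integral>\<^sup>+t. indicator {t. c * t + d \<in> U} t \<partial>lborel)"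
    by (intro nn_integral_cong) (auto simp: indicator_def add.commute)
  also have "\<dots> = emeasure lborel {t. c * t + d \<in> U}" using V by simp
  finally have "measure lborel U = c * measure lborel {t. c * t + d \<in> U}"
    using c by (simp add: measure_def enn2real_mult)
  then show ?thesis using c by simp
qed

lemma distr_fun_disjoint_sum:
  assumes d: "disjoint_family_on B I" and I: "finite I" and s: "0 \<le> s"
    and V: "\<And>k. k \<in> I \<Longrightarrow> {t \<in> B k. s < \<bar>a k t\<bar>} \<in> sets unit_int"
  shows "distr_fun (\<lambda>t. \<Sum>k\<in>I. indicator (B k) t * a k t) s = (\<Sum>k\<in>I. measure unit_int {t \<in> B k. s < \<bar>a k t\<bar>})"
proof -
  have e: "indicator {u \<in> {0..1}. s < \<bar>\<Sum>k\<in>I. indicator (B k) u * a k u\<bar>} t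
      = (\<Sum>k\<in>I. indicator {t \<in> B k. s < \<bar>a k t\<bar>} t :: real)" if "t \<in> {0..1}" for t
  proof -
    have "indicator {u \<in> {0..1}. s < \<bar>\<Sum>k\<in>I. indicator (B k) u * a k u\<bar>} t
       = (of_bool (s < \<bar>\<Sum>k\<in>I. indicator (B k) t * a k t\<bar>) :: real)"
      using that by (simp add: indicator_def)
    also have "\<dots> = (\<Sum>k\<in>I. indicator (B k) t * of_bool (s < \<bar>a k t\<bar>))"
      using s by (intro disjoint_sum_indicator[OF d I, where \<phi> = "\<lambda>v. of_bool (s < \<bar>v\<bar>)"]) auto
    also have "\<dots> = (\<Sum>k\<in>I. indicator {t \<in> B k. s < \<bar>a k t\<bar>} t)"
      by (intro sum.cong) (auto simp: indicator_def)
    finally show ?thesis .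
  qed
  have "{u \<in> {0..1}. s < \<bar>\<Sum>k\<in>I. indicator (B k) u * a k u\<bar>} = (\<Union>k\<in>I. {t \<in> B k. s < \<bar>a k t\<bar>})"
  proof (intro set_eqI)
    fix t
    have B: "t \<in> {0..1}" if U: "t \<in> (\<Union>k\<in>I. {t \<in> B k. s < \<bar>a k t\<bar>})"
    proof -
      obtain k where k: "k \<in> I" "t \<in> {t \<in> B k. s < \<bar>a k t\<bar>}" using U by auto
      then show ?thesis using sets.sets_into_space[OF V[OF k(1)]] by auto
    qed
    show "t \<in> {u \<in> {0..1}. s < \<bar>\<Sum>k\<in>I. indicator (B k) u * a k u\<bar>} \<longleftrightarrow> t \<in> (\<Union>k\<in>I. {t \<in> B k. s < \<bar>a k t\<bar>})"
    proof (cases "t \<in> {0..1}")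
      case True
      have "t \<in> {u \<in> {0..1}. s < \<bar>\<Sum>k\<in>I. indicator (B k) u * a k u\<bar>} \<longleftrightarrow>
         indicator {u \<in> {0..1}. s < \<bar>\<Sum>k\<in>I. indicator (B k) u * a k u\<bar>} t \<noteq> (0::real)"
        by (auto simp: indicator_def)
      also have "\<dots> \<longleftrightarrow> (\<exists>k\<in>I. t \<in> {t \<in> B k. s < \<bar>a k t\<bar>})"
        unfolding e[OF True] using I by (subst sum_nonneg_eq_0_iff) (auto simp: indicator_def)
      finally show ?thesis by blast
    qed (use B in auto)
  qed
  moreover have "measure unit_int (\<Union>k\<in>I. {t \<in> B k. s < \<bar>a k t\<bar>}) = (\<Sum>k\<in>I. measure unit_int {t \<in> B k. s < \<bar>a k t\<bar>})"
    using d V I by (intro finite_measure.finite_measure_finite_Union) (auto simp: disjoint_family_on_def)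
  ultimately show ?thesis by (simp add: distr_fun_def)
qed

text \<open>The number m j is the measure of the set where a function takes the value 2^j; the mass
  missing from 1 belongs to the value 0.\<close>

definition substochastic :: "nat \<Rightarrow> (nat \<Rightarrow> real) \<Rightarrow> bool" where
  "substochastic L m \<longleftrightarrow> (\<forall>j. 0 \<le> m j) \<and> (\<Sum>j<L. m j) \<le> 1"

text \<open>Half-open intervals make a block of mass 0 empty, so appending zero masses does not
  change the step function at any point (\<open>step_extend\<close>).\<close>

definition block :: "(nat \<Rightarrow> real) \<Rightarrow> nat \<Rightarrow> real set" where
  "block m j = {(\<Sum>i<j. m i)..<(\<Sum>i<Suc j. m i)}"

definition step :: "nat \<Rightarrow> (nat \<Rightarrow> real) \<Rightarrow> real \<Rightarrow> real" where
  "step L m t = (\<Sum>j<L. indicator (block m j) t * 2 ^ j)"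

lemma block_subset:
  assumes "substochastic L m" "j < L"
  shows "block m j \<subseteq> {0..1}" "block m j \<in> sets unit_int" "measure unit_int (block m j) = m j"
proof -
  have m: "\<And>j. 0 \<le> m j" "(\<Sum>j<L. m j) \<le> 1" using assms by (auto simp: substochastic_def)
  have le: "0 \<le> (\<Sum>i<j. m i)" "(\<Sum>i<Suc j. m i) \<le> 1"
    using m assms(2) sum_mono2[of "{..<L}" "{..<Suc j}" m] by (auto intro!: sum_nonneg)
  then show "block m j \<subseteq> {0..1}" "block m j \<in> sets unit_int" by (auto simp: block_def)
  show "measure unit_int (block m j) = m j"
    unfolding block_def using le m(1)[of j] by (subst measure_unit_int_subinterval) auto
qed

lemma block_disjoint:
  assumes "substochastic L m"
  shows "disjoint_family_on (block m) I"
proof -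
  have m: "\<And>j. 0 \<le> m j" using assms by (auto simp: substochastic_def)
  have "block m i \<inter> block m j = {}" if "i < j" for i j
  proof -
    have "(\<Sum>k<Suc i. m k) \<le> (\<Sum>k<j. m k)" using m that by (intro sum_mono2) auto
    then show ?thesis by (auto simp: block_def)
  qed
  then show ?thesis unfolding disjoint_family_on_def by (metis Int_commute nat_neq_iff)
qed

lemma step_borel [measurable]: "step L m \<in> borel_measurable borel"
  unfolding step_def block_def by measurable

lemma step_bounded: "\<bar>step L m t\<bar> \<le> (\<Sum>j<L. 2 ^ j)"
  unfolding step_def by (rule order_trans[OF sum_abs], rule sum_mono) (simp add: indicator_def)

lemma distr_fun_step:
  assumes m: "substochastic L m" and s: "0 \<le> s"
  shows "distr_fun (step L m) s = (\<Sum>j<L. of_bool (s < 2 ^ j) * m j)"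
proof -
  have b: "{t \<in> block m j. s < \<bar>2 ^ j :: real\<bar>} = (if s < 2 ^ j then block m j else {})" for j
    by auto
  have "distr_fun (step L m) s = (\<Sum>j<L. measure unit_int {t \<in> block m j. s < \<bar>2 ^ j :: real\<bar>})"
    unfolding step_def[abs_def]
    using block_subset[OF m] block_disjoint[OF m] s by (intro distr_fun_disjoint_sum) (auto simp: b)
  also have "\<dots> = (\<Sum>j<L. of_bool (s < 2 ^ j) * m j)"
    using block_subset[OF m] by (intro sum.cong refl) (auto simp: b)
  finally show ?thesis .
qed

lemma substochastic_average:
  fixes n :: nat
  assumes n: "1 \<le> n" and m: "\<And>k. k \<in> {1..n} \<Longrightarrow> substochastic L (m k)"
  shows "substochastic L (\<lambda>j. (\<Sum>k=1..n. m k j) / n)"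
proof -
  define z where "z j = (\<Sum>k=1..n. m k j) / n" for j
  have "(\<Sum>j<L. z j) = (\<Sum>k=1..n. \<Sum>j<L. m k j) / n"
    unfolding z_def sum_divide_distrib[symmetric] by (subst sum.swap) simp
  also have "\<dots> \<le> (\<Sum>k=1..n. 1 :: real) / n"
    using m by (intro divide_right_mono sum_mono) (auto simp: substochastic_def)
  finally have "(\<Sum>j<L. z j) \<le> 1" using n by simp
  moreover have "0 \<le> z j" for j
    unfolding z_def using m by (intro divide_nonneg_nonneg sum_nonneg) (auto simp: substochastic_def)
  ultimately show ?thesis unfolding substochastic_def by (simp add: z_def)
qed

text \<open>Squeezing x k into an interval of length 1 / n divides the measure of its level sets by
  n. The open pieces do not see x k at 0 and 1, hence an inequality, in the direction that
  \<open>average_norm\<close> needs. Borel measurability allows affine preimages to be measured by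
  \<open>lborel\<close>.\<close>

lemma distr_fun_dilated_le:
  assumes n: "1 \<le> n" and x: "\<And>k. k \<in> {1..n} \<Longrightarrow> x k \<in> borel_measurable borel" and s: "0 \<le> s"
  shows "distr_fun (dilated_disjoint_sum n x) s \<le> (\<Sum>k=1..n. distr_fun (x k) s) / n"
proof -
  define A where "A k = {(real k - 1) / real n <..< real k / real n}" for k
  have A01: "A k \<subseteq> {0..1}" if "k \<in> {1..n}" for k
  proof -
    have "0 \<le> (real k - 1) / n" "real k / n \<le> 1" using that n by auto
    then show ?thesis by (auto simp: A_def)
  qed
  have "A i \<inter> A j = {}" if "i < j" for i j
  proof -
    have "real i / n \<le> (real j - 1) / n" using that by (intro divide_right_mono) auto
    then show ?thesis by (auto simp: A_def)
  qed
  then have disj: "disjoint_family_on A {1..n}"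
    unfolding disjoint_family_on_def by (metis Int_commute nat_neq_iff)
  define U where "U k = {u \<in> {0<..<1}. s < \<bar>x k u\<bar>}" for k
  have U: "U k \<in> sets borel" if "k \<in> {1..n}" for k
  proof -
    note [measurable] = x[OF that]
    show ?thesis unfolding U_def by measurable
  qed
  have VU: "{t \<in> A k. s < \<bar>\<bar>x k (real n * t - real k + 1)\<bar>\<bar>} = {t. real n * t + (1 - real k) \<in> U k}" for k
    using n by (auto simp: A_def U_def field_simps)
  have V: "{t \<in> A k. s < \<bar>\<bar>x k (real n * t - real k + 1)\<bar>\<bar>} \<in> sets borel" if "k \<in> {1..n}" for k
  proof -
    note [measurable] = U[OF that]
    show ?thesis unfolding VU by measurable
  qed
  have Vu: "{t \<in> A k. s < \<bar>\<bar>x k (real n * t - real k + 1)\<bar>\<bar>} \<in> sets unit_int" if "k \<in> {1..n}" for k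
    using V[OF that] A01[OF that] by (auto simp: sets_restrict_space_iff)
  have "distr_fun (dilated_disjoint_sum n x) s
      = (\<Sum>k=1..n. measure unit_int {t \<in> A k. s < \<bar>\<bar>x k (real n * t - real k + 1)\<bar>\<bar>})"
    unfolding dilated_disjoint_sum_def[abs_def] A_def[symmetric]
    using Vu s by (intro distr_fun_disjoint_sum[OF disj]) auto
  also have "\<dots> \<le> (\<Sum>k=1..n. distr_fun (x k) s / n)"
  proof (rule sum_mono)
    fix k assume k: "k \<in> {1..n}"
    have "measure unit_int {t \<in> A k. s < \<bar>\<bar>x k (real n * t - real k + 1)\<bar>\<bar>}
       = measure lborel {t \<in> A k. s < \<bar>\<bar>x k (real n * t - real k + 1)\<bar>\<bar>}"
      using V[OF k] A01[OF k] by (intro measure_unit_int_eq_lborel) auto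
    also have "\<dots> = measure lborel (U k) / n"
      unfolding VU using n by (intro measure_lborel_affine_preimage U[OF k]) auto
    also have "measure lborel (U k) = measure unit_int (U k)"
      using U[OF k] by (intro measure_unit_int_eq_lborel[symmetric]) (auto simp: U_def)
    also have "\<dots> \<le> distr_fun (x k) s"
      unfolding distr_fun_def
      using level_set_measurable[OF borel_measurable_unit_int[OF x[OF k]]]
      by (intro finite_measure.finite_measure_mono) (auto simp: U_def)
    finally show "measure unit_int {t \<in> A k. s < \<bar>\<bar>x k (real n * t - real k + 1)\<bar>\<bar>} \<le> distr_fun (x k) s / n"
      by (simp add: divide_right_mono)
  qed
  finally show ?thesis by (simp add: sum_divide_distrib)
qed

lemma dilated_disjoint_sum_borel:
  assumes "\<And>k. k \<in> {1..n} \<Longrightarrow> x k \<in> borel_measurable borel"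
  shows "dilated_disjoint_sum n x \<in> borel_measurable borel"
  unfolding dilated_disjoint_sum_def[abs_def]
  by (intro borel_measurable_sum borel_measurable_times borel_measurable_abs measurable_compose[OF _ assms]) auto

section \<open>D*-convexity and averages of level masses\<close>

locale ri_dstar = ri_one +
  fixes cD :: real
  assumes cD: "0 < cD"
    and dstar: "\<And>n x. 1 \<le> n \<Longrightarrow> (\<And>k. k \<in> {1..n} \<Longrightarrow> x k \<in> E) \<Longrightarrow>
        inverse cD * (INF k\<in>{1..n}. N (x k)) \<le> N (dilated_disjoint_sum n x)"
begin

lemma step_in_E: "step L m \<in> E"
  by (intro bounded_in_E[where B = "\<Sum>j<L. 2 ^ j"] borel_measurable_unit_int step_borel step_bounded)

text \<open>The distribution function of a step function is linear in its masses, so that of the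
  averaged masses dominates the one of the dilated disjoint sum. The strict bound survives because
  the infimum is over a finite set and hence attained.\<close>

lemma average_norm:
  fixes n :: nat
  assumes n: "1 \<le> n" and m: "\<And>k. k \<in> {1..n} \<Longrightarrow> substochastic L (m k)"
    and big: "\<And>k. k \<in> {1..n} \<Longrightarrow> A < N (step L (m k))"
  shows "A / cD < N (step L (\<lambda>j. (\<Sum>k=1..n. m k j) / n))"
proof -
  define z where "z j = (\<Sum>k=1..n. m k j) / n" for j
  have z: "substochastic L z" unfolding z_def by (rule substochastic_average[OF n m])
  let ?C = "dilated_disjoint_sum n (\<lambda>k. step L (m k))"
  have ne: "{1..n} \<noteq> {}" using n by auto
  have "A < (INF k\<in>{1..n}. N (step L (m k)))"
    using big ne by (subst cInf_eq_Min) auto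
  then have "A / cD < inverse cD * (INF k\<in>{1..n}. N (step L (m k)))"
    using cD by (simp add: field_simps)
  also have "\<dots> \<le> N ?C" using dstar[OF n, of "\<lambda>k. step L (m k)"] step_in_E by simp
  also have "N ?C \<le> N (step L z)"
  proof (rule dominated(2)[OF step_in_E])
    show "?C \<in> borel_measurable unit_int"
      by (intro borel_measurable_unit_int dilated_disjoint_sum_borel step_borel)
    fix s :: real assume s: "0 \<le> s"
    have "distr_fun ?C s \<le> (\<Sum>k=1..n. distr_fun (step L (m k)) s) / n"
      using n s by (intro distr_fun_dilated_le step_borel)
    also have "\<dots> = (\<Sum>k=1..n. \<Sum>j<L. of_bool (s < 2 ^ j) * m k j) / n"
      using m s by (intro arg_cong2[where f = "(/)"] sum.cong refl distr_fun_step) auto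
    also have "\<dots> = (\<Sum>j<L. of_bool (s < 2 ^ j) * z j)"
      unfolding z_def by (subst sum.swap) (simp only: sum_divide_distrib sum_distrib_left times_divide_eq_right)
    also have "\<dots> = distr_fun (step L z) s" using z s by (simp add: distr_fun_step)
    finally show "distr_fun ?C s \<le> distr_fun (step L z) s" .
  qed
  finally show ?thesis by (simp add: z_def[abs_def])
qed

end

section \<open>Consequences of interpolation\<close>

context interp
begin

text \<open>The values at or above b, with b powr p half the p-th power integral S of a truncation,
  carry at least S / 2. Transporting S / 2 of this mass onto the constant b over the whole interval
  bounds b by a multiple of N x, hence S by C independently of the truncation.\<close>

lemma integrable_powr_E:
  assumes x: "x \<in> E" and x1: "\<And>t. 1 \<le> x t"
  shows "integrable unit_int (\<lambda>t. x t powr p)"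
proof -
  have [measurable]: "x \<in> borel_measurable unit_int" using x by (rule measurable_E)
  define C where "C = 2 * (cI * N x / N (\<lambda>_. 1)) powr p"
  define y where "y n t = min (x t) (real (Suc n))" for n t
  have ym[measurable]: "y n \<in> borel_measurable unit_int" for n unfolding y_def by measurable
  have yb: "1 \<le> y n t" "y n t \<le> real (Suc n)" for n t using x1[of t] by (auto simp: y_def)
  have ypi: "integrable unit_int (\<lambda>t. y n t powr p)" for n
  proof (rule integrable_bounded_unit_int[of _ "real (Suc n) powr p"])
    show "\<bar>y n t powr p\<bar> \<le> real (Suc n) powr p" for t
      using yb[of n t] p1 powr_mono2[of p "y n t" "real (Suc n)"] by simp
  qed measurable
  have bound: "(\<integral>t. y n t powr p \<partial>unit_int) \<le> C" for n
  proof -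
    define S where "S = (\<integral>t. y n t powr p \<partial>unit_int)"
    have "(\<integral>t. 1 \<partial>unit_int) \<le> S" unfolding S_def
      using yb p1 by (intro integral_mono ypi finite_measure.integrable_const ge_one_powr_ge_zero) auto
    then have S1: "1 \<le> S" using measure_unit_int_subinterval(1)[of 0 1] by simp
    define b where "b = (S / 2) powr (1 / p)"
    have bp: "b powr p = S / 2" "0 < b" using S1 p1 by (auto simp: b_def powr_powr)
    define D where "D t = (of_bool (b \<le> y n t) :: real)" for t
    have Dm[measurable]: "D \<in> borel_measurable unit_int" unfolding D_def by measurable
    have iD: "integrable unit_int (\<lambda>t. D t * y n t powr p)"
      by (rule integrable_times_bounded[OF ypi Dm, of 1]) (simp add: D_def)
    define G where "G = (\<integral>t. D t * y n t powr p \<partial>unit_int)"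
    have "S \<le> (\<integral>t. D t * y n t powr p + b powr p \<partial>unit_int)"
      unfolding S_def
    proof (rule integral_mono[OF ypi])
      show "integrable unit_int (\<lambda>t. D t * y n t powr p + b powr p)"
        by (intro Bochner_Integration.integrable_add iD finite_measure.integrable_const) simp
      fix t show "y n t powr p \<le> D t * y n t powr p + b powr p"
        using yb[of n t] p1 by (cases "b \<le> y n t") (auto simp: D_def intro!: powr_mono2)
    qed
    also have "\<dots> = G + (\<integral>t. b powr p \<partial>unit_int)"
      unfolding G_def by (intro Bochner_Integration.integral_add iD finite_measure.integrable_const) simp
    finally have G: "S / 2 \<le> G" using bp measure_unit_int_subinterval(1)[of 0 1] by simp
    \<comment> \<open>The mass G of the values at or above b may exceed S / 2;
      \<open>transport\<close> asks for exactly b powr p = S / 2, so it is scaled down.\<close>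
    define \<theta> where "\<theta> = (S / 2) / G"
    have th: "0 \<le> \<theta>" "\<theta> \<le> 1" "\<theta> * G = S / 2" using G S1 by (auto simp: \<theta>_def)
    have "N (\<lambda>t. \<Sum>k<1::nat. indicator {0..1} t * b) \<le> cI * N (y n)"
    proof (rule transport[where \<rho> = p and M = "real (Suc n)" and w = "\<lambda>_ t. \<theta> * D t"])
      show "(\<integral>t. \<theta> * D t * y n t powr p \<partial>unit_int) = b powr p * measure unit_int {0..1}" if "k < 1" for k :: nat
      proof -
        have "(\<integral>t. \<theta> * D t * y n t powr p \<partial>unit_int) = \<theta> * G" unfolding G_def by (simp add: mult.assoc)
        then show ?thesis using th bp measure_unit_int_subinterval(1)[of 0 1] by simp
      qed
    qed (use yb bp th in \<open>auto simp: D_def disjoint_family_on_def mult_le_one\<close>)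
    also have "(\<lambda>t. \<Sum>k<1::nat. indicator {0..1} t * b) = (\<lambda>t. b * indicator {0..1} t)"
      by (simp add: mult.commute)
    also have "N \<dots> = b * N (indicator {0..1})" using norm_scale[OF initial_in_E] bp by simp
    finally have "b * N (indicator {0..1}) \<le> cI * N (y n)" .
    moreover have "N (\<lambda>_. 1) \<le> N (indicator {0..1})"
      by (rule dominated_le(2)[OF initial_in_E]) auto
    moreover have "N (y n) \<le> N x"
      using x1 yb by (intro dominated_le(2)[OF x]) (auto simp: y_def abs_of_nonneg order_trans[OF zero_le_one])
    ultimately have "b * N (\<lambda>_. 1) \<le> cI * N x"
      using bp cI by (meson mult_left_mono less_imp_le order_trans)
    then have "b \<le> cI * N x / N (\<lambda>_. 1)" using norm_one_pos by (simp add: field_simps)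
    then have "b powr p \<le> (cI * N x / N (\<lambda>_. 1)) powr p" using bp p1 by (intro powr_mono2) auto
    then show ?thesis unfolding bp S_def[symmetric] C_def by simp
  qed
  have C0: "0 \<le> C" by (simp add: C_def)
  have "(\<integral>\<^sup>+t. ennreal (x t powr p) \<partial>unit_int) = (\<integral>\<^sup>+t. (SUP n. ennreal (y n t powr p)) \<partial>unit_int)"
  proof (rule nn_integral_cong)
    fix t
    obtain n where "x t \<le> real n" using real_arch_simple by blast
    then have n: "y n t = x t" by (auto simp: y_def)
    show "ennreal (x t powr p) = (SUP n. ennreal (y n t powr p))"
    proof (rule antisym)
      show "ennreal (x t powr p) \<le> (SUP n. ennreal (y n t powr p))"
        using n by (intro SUP_upper2[of n]) auto
      show "(SUP n. ennreal (y n t powr p)) \<le> ennreal (x t powr p)"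
        using order_trans[OF zero_le_one x1[of t]] p1 order_trans[OF zero_le_one yb(1)]
        by (intro SUP_least ennreal_leI powr_mono2) (auto simp: y_def)
    qed
  qed
  also have "\<dots> = (SUP n. \<integral>\<^sup>+t. ennreal (y n t powr p) \<partial>unit_int)"
  proof (rule nn_integral_monotone_convergence_SUP)
    show "incseq (\<lambda>n t. ennreal (y n t powr p))"
      unfolding incseq_def le_fun_def
    proof (intro allI impI ennreal_leI powr_mono2)
      fix m n :: nat and t assume "m \<le> n" then show "y m t \<le> y n t" by (auto simp: y_def)
    qed (use p1 order_trans[OF zero_le_one yb(1)] in auto)
  qed measurable
  also have "\<dots> \<le> ennreal C"
    using bound ypi by (intro SUP_least) (simp add: nn_integral_eq_integral C0)
  finally have "(\<integral>\<^sup>+t. ennreal (x t powr p) \<partial>unit_int) < \<infinity>" by (simp add: le_less_trans)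
  then show ?thesis by (intro integrableI_nonneg) auto
qed

text \<open>\<open>transport\<close> with the finite exponent r = q concentrates the constant 1 on
  [0, t] with height b = t powr (-1 / r) \<ge> 1. So the indicator of [0, t] has norm at most c * t
  powr (1 / r), and t is chosen to make this at most e / 2.\<close>

lemma initial_norm_small:
  assumes q: "q \<noteq> \<infinity>" and e: "e > 0"
  shows "\<exists>t. 0 < t \<and> t \<le> 1 \<and> N (indicator {0..t}) < e"
proof -
  obtain r where r: "q = ereal r" "1 \<le> r" using q q1 by (cases q) auto
  define c where "c = cI * N (\<lambda>_. 1)"
  have c: "c > 0" using cI norm_one_pos by (simp add: c_def)
  define t where "t = min 1 ((e / (2 * c)) powr r)"
  have t: "0 < t" "t \<le> 1" using e c by (auto simp: t_def)
  define b where "b = t powr (- 1 / r)"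
  have b: "b > 0" using t by (simp add: b_def)
  have b1: "1 \<le> b"
    using t r powr_mono2'[of "-1 / r" t 1] by (simp add: b_def)
  have "N (\<lambda>s. \<Sum>k<1::nat. indicator {0..t} s * b) \<le> cI * N (\<lambda>_. 1)"
  proof (rule transport[where \<rho> = r and M = 1 and w = "\<lambda>_ _. 1"])
    show "(\<integral>s. 1 * 1 powr r \<partial>unit_int) = b powr r * measure unit_int {0..t}" if "k < 1" for k :: nat
    proof -
      have "b powr r = t powr (- 1)" using r by (simp add: b_def powr_powr)
      then show ?thesis
        using t measure_unit_int_subinterval(1)[of 0 t] measure_unit_int_subinterval(1)[of 0 1]
        by (simp add: powr_minus)
    qed
  qed (use b b1 t r in \<open>auto simp: disjoint_family_on_def\<close>)
  also have "(\<lambda>s. \<Sum>k<1::nat. indicator {0..t} s * b) = (\<lambda>s. b * indicator {0..t} s)"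
    by (simp add: mult.commute)
  also have "N \<dots> = b * N (indicator {0..t})" using norm_scale[OF initial_in_E] b by simp
  finally have "b * N (indicator {0..t}) \<le> c" by (simp add: c_def)
  then have "N (indicator {0..t}) \<le> c / b" using b by (simp add: field_simps)
  also have "\<dots> = c * t powr (1 / r)" by (simp add: b_def powr_minus field_simps)
  also have "\<dots> \<le> c * ((e / (2 * c)) powr r) powr (1 / r)"
    using c t r by (intro mult_left_mono powr_mono2) (auto simp: t_def)
  also have "\<dots> = e / 2" using c e r by (simp add: powr_powr)
  finally show ?thesis using e t by (intro exI[of _ t]) auto
qed

text \<open>A level k belongs to P if the part of X = 2^J at or above 2^k gives at least half of the
  weight integral. The factor 1 / 2 in \<open>hyp\<close> then bounds the masses z by the L_p mass
  of X above 2^k alone, and for k outside P by the L_q mass at or below 2^k.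
  \<open>greedy_weights\<close> turns these bounds into weights, and \<open>transport\<close> treats
  the blocks in P and the others separately, whence the factor 2.\<close>

lemma step_norm_bound:
  assumes J: "J \<in> measurable unit_int (count_space UNIV)" and Jn: "\<And>t. J t \<le> n"
    and z: "substochastic L z"
    and hyp: "\<And>k. k < L \<Longrightarrow> (\<Sum>j<L. level_weight p q k j * z j) \<le> 1 / 2 * (\<integral>t. level_weight p q k (J t) \<partial>unit_int)"
  shows "N (step L z) \<le> 2 * cI * N (\<lambda>t. 2 ^ J t)"
proof -
  define X :: "real \<Rightarrow> real" where "X t = 2 ^ J t" for t
  define r where "r = real_of_ereal q"
  have z0: "0 \<le> z j" for j using z by (auto simp: substochastic_def)
  have fm: "(\<lambda>t. f (J t)) \<in> borel_measurable unit_int" for f :: "nat \<Rightarrow> real"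
    using J by (rule measurable_compose) simp
  have Xm: "X \<in> borel_measurable unit_int" unfolding X_def by (rule fm)
  have X1: "1 \<le> X t" and Xn: "X t \<le> 2 ^ n" for t using Jn[of t] by (auto simp: X_def)
  have Xp: "X t powr s = 2 powr (real (J t) * s)" for t s
    by (simp add: X_def powr_powr flip: powr_realpow)
  have fi: "integrable unit_int (\<lambda>t. f (J t))" for f :: "nat \<Rightarrow> real"
  proof (rule integrable_bounded_unit_int[OF fm])
    show "\<bar>f (J t)\<bar> \<le> Max ((\<lambda>j. \<bar>f j\<bar>) ` {..n})" for t using Jn by (intro Max_ge) auto
  qed
  have Xpi: "integrable unit_int (\<lambda>t. X t powr s)" for s unfolding Xp by (rule fi)
  define D where "D k = {t \<in> {0..1}. k \<le> J t}" for k
  define D' where "D' k = {t \<in> {0..1}. J t \<le> k}" for k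
  have Dm: "D k \<in> sets unit_int" "D' k \<in> sets unit_int" for k
  proof -
    have "{t \<in> space unit_int. k \<le> J t} \<in> sets unit_int" "{t \<in> space unit_int. J t \<le> k} \<in> sets unit_int"
      using J by measurable
    then show "D k \<in> sets unit_int" "D' k \<in> sets unit_int" by (simp_all add: D_def D'_def)
  qed
  have IX: "(\<integral>t. indicator (D k) t * X t powr s \<partial>unit_int) = (\<integral>t. of_bool (k \<le> J t) * 2 powr (real (J t) * s) \<partial>unit_int)" for k s
    by (rule Bochner_Integration.integral_cong) (auto simp: D_def Xp)
  have IX': "(\<integral>t. indicator (D' k) t * X t powr s \<partial>unit_int) = (\<integral>t. of_bool (J t \<le> k) * 2 powr (real (J t) * s) \<partial>unit_int)" for k s
    by (rule Bochner_Integration.integral_cong) (auto simp: D'_def Xp)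
  define P where "P = {k. 1 / 2 * (\<integral>t. level_weight p q k (J t) \<partial>unit_int) \<le> (\<integral>t. indicator (D k) t * X t powr p \<partial>unit_int)}"
  define zP where "zP j = (if j \<in> P then z j else 0)" for j
  define zQ where "zQ j = (if j \<in> P then 0 else z j)" for j
  have zPQ: "0 \<le> zP j" "0 \<le> zQ j" "zP j \<le> z j" "zQ j \<le> z j" for j using z0 by (auto simp: zP_def zQ_def)
  \<comment> \<open>Downward induction extends the bound from levels in P to all levels: outside P
    the mass zP k is 0, and the bound for Suc k is inherited because D k contains D (Suc k).\<close>
  have claimP: "(\<Sum>j\<in>{k..<L}. 2 powr (real j * p) * zP j) \<le> (\<integral>t. indicator (D k) t * X t powr p \<partial>unit_int)"
    if "k \<le> L" for k
    using that
  proof (induction rule: inc_induct)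
    case base
    then show ?case by (auto intro!: integral_nonneg)
  next
    case (step k)
    show ?case
    proof (cases "k \<in> P")
      case True
      have "(\<Sum>j\<in>{k..<L}. 2 powr (real j * p) * zP j) \<le> (\<Sum>j\<in>{k..<L}. level_weight p q k j * z j)"
        using zPQ by (intro sum_mono mult_mono) (auto simp: level_weight_def z0)
      also have "\<dots> \<le> (\<Sum>j<L. level_weight p q k j * z j)"
        using z0 by (intro sum_mono2 mult_nonneg_nonneg level_weight_nonneg) auto
      also have "\<dots> \<le> 1 / 2 * (\<integral>t. level_weight p q k (J t) \<partial>unit_int)" using step hyp by simp
      also have "\<dots> \<le> (\<integral>t. indicator (D k) t * X t powr p \<partial>unit_int)" using True by (simp add: P_def)
      finally show ?thesis .
    next
      case False
      have "(\<Sum>j\<in>{k..<L}. 2 powr (real j * p) * zP j) = (\<Sum>j\<in>{Suc k..<L}. 2 powr (real j * p) * zP j)"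
        using step False by (subst sum.atLeast_Suc_lessThan) (auto simp: zP_def)
      also have "\<dots> \<le> (\<integral>t. indicator (D (Suc k)) t * X t powr p \<partial>unit_int)" by (rule step.IH)
      also have "\<dots> \<le> (\<integral>t. indicator (D k) t * X t powr p \<partial>unit_int)"
        unfolding IX by (intro integral_mono fi mult_right_mono) auto
      finally show ?thesis .
    qed
  qed
  have stepP: "N (\<lambda>t. \<Sum>k<L. indicator (if k \<in> P then block z k else {}) t * 2 ^ k) \<le> cI * N X"
  proof -
    have "\<exists>w :: nat \<Rightarrow> real \<Rightarrow> real. (\<forall>k<L. w k \<in> borel_measurable unit_int \<and> (\<forall>t. 0 \<le> w k t)
        \<and> (\<forall>t. t \<notin> D (L - 1 - k) \<longrightarrow> w k t = 0)
        \<and> (\<integral>t. w k t * X t powr p \<partial>unit_int) = 2 powr (real (L - 1 - k) * p) * zP (L - 1 - k))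
        \<and> (\<forall>t. (\<Sum>k<L. w k t) \<le> 1)"
    \<comment> \<open>The sets D k decrease in k while \<open>greedy_weights\<close> wants
      increasing ones, so the levels are served from the top, with L - 1 - k in place of k.\<close>
    proof (rule greedy_weights)
      show "D (L - 1 - k) \<in> sets unit_int" "D (L - 1 - k) \<subseteq> D (L - 1 - Suc k)" for k
        using Dm by (auto simp: D_def)
      show "integrable unit_int (\<lambda>t. X t powr p)" by (rule Xpi)
      fix k assume k: "k < L"
      have "(\<Sum>i\<le>k. 2 powr (real (L - 1 - i) * p) * zP (L - 1 - i)) = (\<Sum>j\<in>{L - 1 - k..<L}. 2 powr (real j * p) * zP j)"
        using k by (intro sum.reindex_bij_witness[where i = "\<lambda>j. L - 1 - j" and j = "\<lambda>j. L - 1 - j"]) auto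
      also have "\<dots> \<le> (\<integral>t. indicator (D (L - 1 - k)) t * X t powr p \<partial>unit_int)"
        by (rule claimP) simp
      finally show "(\<Sum>i\<le>k. 2 powr (real (L - 1 - i) * p) * zP (L - 1 - i)) \<le> (\<integral>t. indicator (D (L - 1 - k)) t * X t powr p \<partial>unit_int)" .
    qed (use zPQ in auto)
    then obtain w :: "nat \<Rightarrow> real \<Rightarrow> real" where w: "\<And>k. k < L \<Longrightarrow> w k \<in> borel_measurable unit_int"
      "\<And>k t. k < L \<Longrightarrow> 0 \<le> w k t" "\<And>k t. k < L \<Longrightarrow> t \<notin> D (L - 1 - k) \<Longrightarrow> w k t = 0"
      "\<And>k. k < L \<Longrightarrow> (\<integral>t. w k t * X t powr p \<partial>unit_int) = 2 powr (real (L - 1 - k) * p) * zP (L - 1 - k)"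
      "\<And>t. (\<Sum>k<L. w k t) \<le> 1" by blast
    show ?thesis
    proof (rule transport[where \<rho> = p and M = "2 ^ n" and w = "\<lambda>k. w (L - 1 - k)"])
      show "(if k \<in> P then block z k else {}) \<in> sets unit_int" if "k < L" for k
        using block_subset[OF z that] by auto
      show "disjoint_family_on (\<lambda>k. if k \<in> P then block z k else {}) {..<L}"
        using block_disjoint[OF z, of "{..<L}"] by (auto simp: disjoint_family_on_def)
      show "(\<Sum>k<L. w (L - 1 - k) t) \<le> 1" for t
        using w(5)[of t] sum.nat_diff_reindex[of "\<lambda>k. w k t" L] by simp
      show "(\<integral>t. w (L - 1 - k) t * X t powr p \<partial>unit_int) = (2 ^ k) powr p * measure unit_int (if k \<in> P then block z k else {})"
        if "k < L" for k
        using w(4)[of "L - 1 - k"] that block_subset(3)[OF z that]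
        by (auto simp: zP_def powr_powr simp flip: powr_realpow)
      have "2 ^ k \<le> X t" if "k < L" "w (L - 1 - k) t \<noteq> 0" for k t
        using w(3)[of "L - 1 - k" t] that by (auto simp: D_def X_def)
      then show "p = p \<and> (\<forall>k<L. \<forall>t. w (L - 1 - k) t \<noteq> 0 \<longrightarrow> 2 ^ k \<le> X t)
         \<or> ereal p = q \<and> (\<forall>k<L. \<forall>t. w (L - 1 - k) t \<noteq> 0 \<longrightarrow> X t \<le> 2 ^ k)" by blast
    qed (use w Xm X1 Xn in auto)
  qed
  have stepQ: "N (\<lambda>t. \<Sum>k<L. indicator (if k \<in> P then {} else block z k) t * 2 ^ k) \<le> cI * N X"
  proof (cases "q = \<infinity>")
    case True
    \<comment> \<open>For q = \<infinity> the weight vanishes below level k, so the part above is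
      the whole integral and nothing is left for the second operator.\<close>
    have "k \<in> P" for k
    proof -
      have "(\<integral>t. level_weight p q k (J t) \<partial>unit_int) = (\<integral>t. indicator (D k) t * X t powr p \<partial>unit_int)"
        unfolding IX by (intro Bochner_Integration.integral_cong) (auto simp: level_weight_def True)
      moreover have "0 \<le> (\<integral>t. indicator (D k) t * X t powr p \<partial>unit_int)" by (auto intro!: integral_nonneg)
      ultimately show ?thesis by (simp add: P_def)
    qed
    moreover have "0 \<le> cI * N X"
      using cI Xm X1 Xn by (intro mult_nonneg_nonneg norm_nonneg bounded_in_E[of _ "2 ^ n"])
        (auto simp: abs_of_nonneg order_trans[OF zero_le_one])
    ultimately show ?thesis by (simp add: norm_zero)
  next
    case False
    then have qr: "q = ereal r" using q1 by (cases q) (auto simp: r_def)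
    have claimQ: "(\<Sum>j\<le>k. 2 powr (real j * r) * zQ j) \<le> (\<integral>t. indicator (D' k) t * X t powr r \<partial>unit_int)"
      if "k < L" for k
      using that
    proof (induction k)
      case 0
      show ?case
      proof (cases "0 \<in> P")
        case True
        then show ?thesis by (auto simp: zQ_def intro!: integral_nonneg)
      next
        case False
        \<comment> \<open>Nothing lies below level 0, so the part above is the whole integral and 0
          cannot be outside P.\<close>
        have "(\<integral>t. level_weight p q 0 (J t) \<partial>unit_int) = (\<integral>t. indicator (D 0) t * X t powr p \<partial>unit_int)"
          unfolding IX by (intro Bochner_Integration.integral_cong) (auto simp: level_weight_def)
        moreover have "0 \<le> (\<integral>t. indicator (D 0) t * X t powr p \<partial>unit_int)" by (auto intro!: integral_nonneg)
        ultimately show ?thesis using False by (simp add: P_def)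
      qed
    next
      case (Suc k0)
      define k where "k = Suc k0"
      have k: "k < L" using Suc by (simp add: k_def)
      show ?case
      proof (cases "k \<in> P")
        case True
        have "(\<Sum>j\<le>k. 2 powr (real j * r) * zQ j) = (\<Sum>j\<le>k0. 2 powr (real j * r) * zQ j)"
          using True by (simp add: k_def zQ_def)
        also have "\<dots> \<le> (\<integral>t. indicator (D' k0) t * X t powr r \<partial>unit_int)" using Suc by simp
        also have "\<dots> \<le> (\<integral>t. indicator (D' k) t * X t powr r \<partial>unit_int)"
          unfolding IX' by (intro integral_mono fi mult_right_mono) (auto simp: k_def)
        finally show ?thesis by (simp add: k_def)
      next
        case False
        \<comment> \<open>The factor (2^k) powr (p - r): up to and including level k the weight is a
          times the r-th power.\<close>
        define a where "a = 2 powr (real k * p) * 2 powr (- (real k * r))"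
        have a: "a > 0" by (simp add: a_def)
        have lw: "level_weight p q k j = a * 2 powr (real j * r)" if "j \<le> k" for j
          using that qr by (auto simp: level_weight_def a_def left_diff_distrib powr_diff powr_minus field_simps)
        have "a * (\<Sum>j\<le>k. 2 powr (real j * r) * zQ j) = (\<Sum>j\<le>k. level_weight p q k j * zQ j)"
          by (simp add: sum_distrib_left lw mult.assoc)
        also have "\<dots> \<le> (\<Sum>j\<le>k. level_weight p q k j * z j)"
          using zPQ by (intro sum_mono mult_left_mono level_weight_nonneg)
        also have "\<dots> \<le> (\<Sum>j<L. level_weight p q k j * z j)"
          using z0 k by (intro sum_mono2 mult_nonneg_nonneg level_weight_nonneg) auto
        also have "\<dots> \<le> 1 / 2 * (\<integral>t. level_weight p q k (J t) \<partial>unit_int)" using hyp k by simp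
        \<comment> \<open>Outside P the part above level k is less than half of the integral, so the
          half is at most what remains after subtracting it.\<close>
        also have "\<dots> \<le> (\<integral>t. level_weight p q k (J t) \<partial>unit_int) - (\<integral>t. indicator (D k) t * X t powr p \<partial>unit_int)"
          using False by (simp add: P_def)
        also have "\<dots> = (\<integral>t. level_weight p q k (J t) - of_bool (k \<le> J t) * 2 powr (real (J t) * p) \<partial>unit_int)"
          unfolding IX by (intro Bochner_Integration.integral_diff[symmetric] fi)
        also have "\<dots> \<le> (\<integral>t. a * (of_bool (J t \<le> k) * 2 powr (real (J t) * r)) \<partial>unit_int)"
        proof (intro integral_mono fi)
          fix t show "level_weight p q k (J t) - of_bool (k \<le> J t) * 2 powr (real (J t) * p)
            \<le> a * (of_bool (J t \<le> k) * 2 powr (real (J t) * r))"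
          proof (cases "k \<le> J t")
            case True
            then show ?thesis using a by (simp add: level_weight_def)
          next
            case False
            then show ?thesis by (simp add: lw)
          qed
        qed
        also have "\<dots> = a * (\<integral>t. indicator (D' k) t * X t powr r \<partial>unit_int)" by (simp add: IX')
        finally show ?thesis using a by (simp add: k_def)
      qed
    qed
    have "\<exists>w :: nat \<Rightarrow> real \<Rightarrow> real. (\<forall>k<L. w k \<in> borel_measurable unit_int \<and> (\<forall>t. 0 \<le> w k t)
        \<and> (\<forall>t. t \<notin> D' k \<longrightarrow> w k t = 0)
        \<and> (\<integral>t. w k t * X t powr r \<partial>unit_int) = 2 powr (real k * r) * zQ k)
        \<and> (\<forall>t. (\<Sum>k<L. w k t) \<le> 1)"
      by (rule greedy_weights) (use Dm zPQ Xpi claimQ in \<open>auto simp: D'_def\<close>)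
    then obtain w :: "nat \<Rightarrow> real \<Rightarrow> real" where w: "\<And>k. k < L \<Longrightarrow> w k \<in> borel_measurable unit_int"
      "\<And>k t. k < L \<Longrightarrow> 0 \<le> w k t" "\<And>k t. k < L \<Longrightarrow> t \<notin> D' k \<Longrightarrow> w k t = 0"
      "\<And>k. k < L \<Longrightarrow> (\<integral>t. w k t * X t powr r \<partial>unit_int) = 2 powr (real k * r) * zQ k"
      "\<And>t. (\<Sum>k<L. w k t) \<le> 1" by blast
    show ?thesis
    proof (rule transport[where \<rho> = r and M = "2 ^ n" and w = w])
      show "(if k \<in> P then {} else block z k) \<in> sets unit_int" if "k < L" for k
        using block_subset[OF z that] by auto
      show "disjoint_family_on (\<lambda>k. if k \<in> P then {} else block z k) {..<L}"
        using block_disjoint[OF z, of "{..<L}"] by (auto simp: disjoint_family_on_def)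
      show "(\<integral>t. w k t * X t powr r \<partial>unit_int) = (2 ^ k) powr r * measure unit_int (if k \<in> P then {} else block z k)"
        if "k < L" for k
        using w(4)[of k] that block_subset(3)[OF z that]
        by (auto simp: zQ_def powr_powr simp flip: powr_realpow)
      have "X t \<le> 2 ^ k" if "k < L" "w k t \<noteq> 0" for k t
        using w(3)[of k t] that by (auto simp: D'_def X_def)
      then show "r = p \<and> (\<forall>k<L. \<forall>t. w k t \<noteq> 0 \<longrightarrow> 2 ^ k \<le> X t)
         \<or> ereal r = q \<and> (\<forall>k<L. \<forall>t. w k t \<noteq> 0 \<longrightarrow> X t \<le> 2 ^ k)" using qr by blast
    qed (use w Xm X1 Xn in auto)
  qed
  define yP where "yP t = (\<Sum>k<L. indicator (if k \<in> P then block z k else {}) t * 2 ^ k :: real)" for t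
  define yQ where "yQ t = (\<Sum>k<L. indicator (if k \<in> P then {} else block z k) t * 2 ^ k :: real)" for t
  have inE: "(\<lambda>t. \<Sum>k<L. indicator (B k) t * 2 ^ k :: real) \<in> E" if "\<And>k. k < L \<Longrightarrow> B k \<in> sets unit_int" for B :: "nat \<Rightarrow> real set"
  proof (rule bounded_in_E[where B = "\<Sum>j<L. 2 ^ j"])
    show "(\<lambda>t. \<Sum>k<L. indicator (B k) t * 2 ^ k :: real) \<in> borel_measurable unit_int"
      using that by (intro borel_measurable_sum borel_measurable_times borel_measurable_indicator) auto
    show "\<bar>\<Sum>k<L. indicator (B k) t * 2 ^ k\<bar> \<le> (\<Sum>j<L. 2 ^ j :: real)" for t
      by (rule order_trans[OF sum_abs], rule sum_mono) (simp add: indicator_def)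
  qed
  have "step L z = (\<lambda>t. yP t + yQ t)"
    unfolding step_def yP_def yQ_def sum.distrib[symmetric] by (intro ext sum.cong) auto
  moreover have "yP \<in> E"
    unfolding yP_def[abs_def] by (rule inE) (use block_subset(2)[OF z] in auto)
  moreover have "yQ \<in> E"
    unfolding yQ_def[abs_def] by (rule inE) (use block_subset(2)[OF z] in auto)
  ultimately have "N (step L z) \<le> N yP + N yQ" using norm_add by simp
  also have "\<dots> \<le> cI * N X + cI * N X"
    using stepP stepQ unfolding yP_def[abs_def] yQ_def[abs_def] by (intro add_mono)
  finally show ?thesis by (simp add: X_def[abs_def])
qed

end

subsection \<open>Compactness of the set of majorants\<close>

lemma step_extend:
  assumes "L \<le> L'" "\<And>j. L \<le> j \<Longrightarrow> m j = 0"
  shows "step L' m = step L m"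
proof
  fix t
  have "block m j = {}" if "L \<le> j" for j using assms(2)[OF that] by (simp add: block_def)
  then show "step L' m t = step L m t"
    unfolding step_def using assms(1) by (intro sum.mono_neutral_right) auto
qed

text \<open>Each condition is an inequality or equation between finitely many values of M, guarded
  by premises free of M, so closedness for pointwise convergence can be read off.\<close>

lemma orlicz_cone_iff:
  "M \<in> orlicz_cone p q \<longleftrightarrow> (\<forall>t. t \<ge> 0 \<longrightarrow> 0 \<le> M t) \<and> (\<forall>s t. s \<ge> 0 \<and> s \<le> t \<longrightarrow> M s \<le> M t)
     \<and> (\<forall>x y u v. 0 \<le> x \<and> 0 \<le> y \<and> 0 \<le> u \<and> 0 \<le> v \<and> u + v = 1 \<longrightarrow>
        M ((u * x + v * y) powr (1 / p)) \<le> u * M (x powr (1 / p)) + v * M (y powr (1 / p)))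
     \<and> (\<forall>x y u v. q \<noteq> \<infinity> \<and> 0 \<le> x \<and> 0 \<le> y \<and> 0 \<le> u \<and> 0 \<le> v \<and> u + v = 1 \<longrightarrow>
        - M ((u * x + v * y) powr (1 / real_of_ereal q))
          \<le> u * - M (x powr (1 / real_of_ereal q)) + v * - M (y powr (1 / real_of_ereal q)))
     \<and> (\<forall>u. u \<le> 0 \<longrightarrow> M u = 0)"
proof -
  have inc: "increasing_fun M \<longleftrightarrow> (\<forall>t. t \<ge> 0 \<longrightarrow> 0 \<le> M t) \<and> (\<forall>s t. s \<ge> 0 \<and> s \<le> t \<longrightarrow> M s \<le> M t)"
    by (auto simp: increasing_fun_def mono_on_def)
  have cv: "convex_on {0..} f \<longleftrightarrow> (\<forall>x y u v. 0 \<le> x \<and> 0 \<le> y \<and> 0 \<le> u \<and> 0 \<le> v \<and> u + v = 1 \<longrightarrow>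
       f (u * x + v * y) \<le> u * f x + v * f y)" for f :: "real \<Rightarrow> real"
    unfolding convex_on_def by (simp add: Ball_def) blast
  show ?thesis
    unfolding orlicz_cone_def mem_Collect_eq p_convex_def q_concave_def inc cv by (cases "q = \<infinity>") simp_all
qed

lemma closed_orlicz_cone: "closed (orlicz_cone p q)"
proof -
  have "closed {M. M \<in> orlicz_cone p q}"
    unfolding orlicz_cone_iff
    by (intro closed_Collect_conj closed_Collect_all closed_Collect_imp open_Collect_const
      closed_Collect_le closed_Collect_eq continuous_on_add continuous_on_mult continuous_on_const
      continuous_on_minus continuous_on_product_coordinates)
  then show ?thesis by simp
qed

text \<open>Tychonoff's theorem: K is a closed subset of a product of compact intervals. The bound b
  may depend on u but not on M.\<close>

lemma compact_pointwise_bounded: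
  fixes K :: "(real \<Rightarrow> real) set"
  assumes "closed K" "\<And>M u. M \<in> K \<Longrightarrow> M u \<in> {0..b u}"
  shows "compact K"
proof -
  have "compactin (product_topology (\<lambda>_. euclidean) UNIV) (PiE UNIV (\<lambda>u. {0..b u :: real}))"
    by (subst compactin_PiE) auto
  then have "compact (PiE UNIV (\<lambda>u. {0..b u}))"
    by (simp add: euclidean_product_topology)
  moreover have "K = K \<inter> PiE UNIV (\<lambda>u. {0..b u})" using assms(2) by auto
  ultimately show ?thesis using assms(1) by (metis Int_commute compact_Int_closed)
qed

section \<open>Dyadic majorants of x and dyadic minorants of y\<close>

locale orlicz_setting = interp E N p q cI + ri_fatou E N + ri_dstar E N cD for E N p q cI cD
begin

text \<open>Take s = 1 + |x| + |u| / N u and round it up to a power of 2. The summand 1 keeps the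
  logarithm nonnegative, so J is a natural number; u supplies positive mass at every height. The
  norm bound involves only N of the constant 1, so it is uniform over the unit ball.\<close>

lemma dominating_dyadic:
  assumes u: "u \<in> E" "\<And>b. 0 < distr_fun u b" and x: "x \<in> E" "N x \<le> 1"
  shows "\<exists>J. J \<in> measurable unit_int (count_space UNIV) \<and> (\<forall>t. \<bar>x t\<bar> \<le> 2 ^ J t) \<and> (\<lambda>t. 2 ^ J t) \<in> E
     \<and> N (\<lambda>t. 2 ^ J t) \<le> 2 * (N (\<lambda>_. 1) + 2) \<and> (\<forall>j. 0 < measure unit_int {t \<in> {0..1}. j \<le> J t})"
proof -
  have [measurable]: "u \<in> borel_measurable unit_int" "x \<in> borel_measurable unit_int"
    using u x measurable_E by auto
  have Nu: "N u > 0"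
  proof (rule ccontr)
    assume "\<not> N u > 0"
    then have "N u = 0" using norm_nonneg[OF u(1)] by simp
    then have "AE t in unit_int. u t = 0" using norm_eq_0_iff u by simp
    then have "distr_fun u 0 \<le> distr_fun (\<lambda>_. 0) 0" by (intro distr_fun_mono_AE) auto
    then show False using u(2)[of 0] by (simp add: distr_fun_def)
  qed
  define s where "s t = 1 + (\<bar>x t\<bar> + \<bar>1 / N u * u t\<bar>)" for t
  have [measurable]: "s \<in> borel_measurable unit_int" unfolding s_def by measurable
  have aE: "(\<lambda>t. \<bar>x t\<bar>) \<in> E" "N (\<lambda>t. \<bar>x t\<bar>) \<le> 1"
    using dominated_le[OF x(1), of "\<lambda>t. \<bar>x t\<bar>"] x(2) by auto
  have bE: "(\<lambda>t. \<bar>1 / N u * u t\<bar>) \<in> E" "N (\<lambda>t. \<bar>1 / N u * u t\<bar>) \<le> 1"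
    using dominated_le[OF scale_in_E[OF u(1), of "1 / N u"], of "\<lambda>t. \<bar>1 / N u * u t\<bar>"]
      norm_scale[OF u(1), of "1 / N u"] Nu by auto
  have sE: "s \<in> E" "N s \<le> N (\<lambda>_. 1) + 2"
    using add_in_E[OF one_in add_in_E[OF aE(1) bE(1)]] norm_add[OF one_in add_in_E[OF aE(1) bE(1)]]
      norm_add[OF aE(1) bE(1)] aE(2) bE(2) by (auto simp: s_def[abs_def])
  have s1: "1 \<le> s t" for t by (simp add: s_def)
  define J where "J t = nat \<lceil>log 2 (s t)\<rceil>" for t
  have Jm: "J \<in> measurable unit_int (count_space UNIV)" unfolding J_def by measurable
  have pJ: "(2::real) ^ J t = 2 powr real_of_int \<lceil>log 2 (s t)\<rceil>" for t
  proof -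
    have "0 \<le> log 2 (s t)" using s1[of t] by (simp add: zero_le_log_cancel_iff)
    then have "0 \<le> \<lceil>log 2 (s t)\<rceil>" by linarith
    then have "real (J t) = real_of_int \<lceil>log 2 (s t)\<rceil>" by (simp add: J_def)
    then show ?thesis by (metis powr_realpow zero_less_numeral)
  qed
  have ps: "2 powr log 2 (s t) = s t" for t using s1[of t] by simp
  have J1: "s t \<le> 2 ^ J t" for t
  proof -
    have "s t = 2 powr log 2 (s t)" by (rule ps[symmetric])
    also have "\<dots> \<le> 2 powr real_of_int \<lceil>log 2 (s t)\<rceil>" by (intro powr_mono) auto
    finally show ?thesis by (simp add: pJ)
  qed
  have J2: "2 ^ J t \<le> 2 * s t" for t
  proof -
    have "2 ^ J t \<le> 2 powr (1 + log 2 (s t))" unfolding pJ by (intro powr_mono) linarith+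
    also have "\<dots> = 2 * s t" unfolding powr_add ps by simp
    finally show ?thesis .
  qed
  have XE: "(\<lambda>t. 2 ^ J t) \<in> E" "N (\<lambda>t. 2 ^ J t) \<le> N (\<lambda>t. 2 * s t)"
  proof -
    have m: "(\<lambda>t. 2 ^ J t :: real) \<in> borel_measurable unit_int" by (rule measurable_compose[OF Jm]) simp
    have le: "\<bar>2 ^ J t\<bar> \<le> \<bar>2 * s t\<bar>" for t using J2[of t] by simp
    show "(\<lambda>t. 2 ^ J t) \<in> E" "N (\<lambda>t. 2 ^ J t) \<le> N (\<lambda>t. 2 * s t)"
      using dominated_le[OF scale_in_E[OF sE(1), of 2] m] le by auto
  qed
  have "N (\<lambda>t. 2 ^ J t) \<le> 2 * (N (\<lambda>_. 1) + 2)"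
    using XE(2) norm_scale[OF sE(1), of 2] sE(2) by simp
  moreover have "\<bar>x t\<bar> \<le> 2 ^ J t" for t
    using J1[of t] abs_ge_zero[of "1 / N u * u t"] unfolding s_def by linarith
  moreover have "0 < measure unit_int {t \<in> {0..1}. j \<le> J t}" for j
  proof -
    have "0 < distr_fun u (N u * 2 ^ j)" by (rule u(2))
    also have "\<dots> \<le> measure unit_int {t \<in> {0..1}. j \<le> J t}"
      unfolding distr_fun_def
    proof (intro finite_measure.finite_measure_mono)
      have "{t \<in> space unit_int. j \<le> J t} \<in> sets unit_int" using Jm by measurable
      then show "{t \<in> {0..1}. j \<le> J t} \<in> sets unit_int" by simp
      show "{v \<in> {0..1}. N u * 2 ^ j < \<bar>u v\<bar>} \<subseteq> {t \<in> {0..1}. j \<le> J t}"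
      proof safe
        fix t assume "N u * 2 ^ j < \<bar>u t\<bar>"
        then have "2 ^ j < \<bar>1 / N u * u t\<bar>" using Nu by (simp add: abs_mult field_simps)
        also have "\<dots> \<le> s t" by (simp add: s_def)
        also have "\<dots> \<le> 2 ^ J t" by (rule J1)
        finally have "j < J t" by (simp add: power_strict_increasing_iff)
        then show "j \<le> J t" by simp
      qed
    qed simp
    finally show ?thesis .
  qed
  ultimately show ?thesis using Jm XE(1) by (intro exI[of _ J]) blast
qed

text \<open>Cut y off at a height 2^L that keeps the norm above B, and round values in [2^j,
  2^(j+1)) down to 2^j. Rounding costs a factor 2 and values below 1 cost N of the constant 1, which
  explains (B - N 1) / 2. Monotonicity of M gives the last claim.\<close>

lemma dyadic_minorant:
  assumes y: "y \<in> E" and big: "B < N y"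
  shows "\<exists>L m. substochastic L m \<and> (\<forall>j\<ge>L. m j = 0) \<and> (B - N (\<lambda>_. 1)) / 2 < N (step L m)
     \<and> (\<forall>M\<in>orlicz_cone p q. ennreal (\<Sum>j<L. M (2 ^ j) * m j) \<le> modular M y)"
proof -
  have ym[measurable]: "y \<in> borel_measurable unit_int" using y by (rule measurable_E)
  obtain L :: nat where L: "B < N (\<lambda>t. if \<bar>y t\<bar> < 2 ^ L then y t else 0)"
    using norm_truncation_bound[OF y, of B] big by (meson not_less)
  define S where "S j = {t \<in> {0..1}. 2 ^ j \<le> \<bar>y t\<bar> \<and> \<bar>y t\<bar> < 2 ^ Suc j}" for j :: nat
  have S: "S j \<in> sets unit_int" for j
  proof -
    have "{t \<in> space unit_int. 2 ^ j \<le> \<bar>y t\<bar> \<and> \<bar>y t\<bar> < 2 ^ Suc j} \<in> sets unit_int" by measurable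
    then show ?thesis by (simp add: S_def)
  qed
  have disj: "disjoint_family_on S I" for I
  proof -
    have "S i \<inter> S j = {}" if "i < j" for i j
    proof -
      have "(2::real) ^ Suc i \<le> 2 ^ j" using that by (intro power_increasing) auto
      then show ?thesis by (auto simp: S_def)
    qed
    then show ?thesis unfolding disjoint_family_on_def by (metis Int_commute nat_neq_iff)
  qed
  define m where "m j = (if j < L then measure unit_int (S j) else 0)" for j
  have sub: "substochastic L m"
  proof -
    have "(\<Sum>j<L. m j) = measure unit_int (\<Union>j<L. S j)"
      using S disj by (subst finite_measure.finite_measure_finite_Union) (auto simp: m_def)
    also have "\<dots> \<le> measure unit_int (space unit_int)" by (intro finite_measure.bounded_measure) simp
    finally show ?thesis using measure_unit_int_subinterval(1)[of 0 1] by (auto simp: substochastic_def m_def)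
  qed
  define y' where "y' t = (\<Sum>j<L. indicator (S j) t * 2 ^ j :: real)" for t
  have y'm: "y' \<in> borel_measurable unit_int"
    unfolding y'_def using S by (intro borel_measurable_sum borel_measurable_times borel_measurable_indicator) auto
  have d: "distr_fun y' s = distr_fun (step L m) s" if "0 \<le> s" for s
  proof -
    have b: "{t \<in> S j. s < \<bar>2 ^ j :: real\<bar>} = (if s < 2 ^ j then S j else {})" for j by auto
    have "distr_fun y' s = (\<Sum>j<L. measure unit_int {t \<in> S j. s < \<bar>2 ^ j :: real\<bar>})"
      unfolding y'_def[abs_def] using S that by (intro distr_fun_disjoint_sum[OF disj]) (auto simp: b)
    also have "\<dots> = (\<Sum>j<L. of_bool (s < 2 ^ j) * m j)"
      by (intro sum.cong refl) (auto simp: b m_def)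
    finally show ?thesis using distr_fun_step[OF sub that] by simp
  qed
  have y'E: "y' \<in> E" "N y' \<le> N (step L m)"
    using dominated[OF step_in_E y'm, of L m] d by auto
  have ptw: "\<bar>if \<bar>y t\<bar> < 2 ^ L then y t else 0\<bar> \<le> \<bar>1 + 2 * y' t\<bar>" if t: "t \<in> {0..1}" for t
  proof -
    have y'0: "0 \<le> y' t" by (auto simp: y'_def intro!: sum_nonneg)
    show ?thesis
    proof (cases "1 \<le> \<bar>y t\<bar> \<and> \<bar>y t\<bar> < 2 ^ L")
      case True
      define j where "j = (LEAST i. \<bar>y t\<bar> < 2 ^ Suc i)"
      obtain l where l: "L = Suc l" using True by (cases L) auto
      have j1: "\<bar>y t\<bar> < 2 ^ Suc j" unfolding j_def by (rule LeastI[of _ l]) (use True l in auto)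
      have jl: "j \<le> l" unfolding j_def by (rule Least_le) (use True l in auto)
      have j2: "2 ^ j \<le> \<bar>y t\<bar>"
      proof (cases j)
        case (Suc i)
        then have "\<not> \<bar>y t\<bar> < 2 ^ Suc i" using not_less_Least[of i "\<lambda>i. \<bar>y t\<bar> < 2 ^ Suc i"] by (simp add: j_def)
        then show ?thesis using Suc by simp
      qed (use True in simp)
      have "indicator (S j) t * 2 ^ j \<le> y' t"
        unfolding y'_def using jl l by (intro member_le_sum) auto
      moreover have "t \<in> S j" using t j1 j2 by (simp add: S_def)
      ultimately show ?thesis using j1 True by simp
    qed (use y'0 in auto)
  qed
  have "N (\<lambda>t. if \<bar>y t\<bar> < 2 ^ L then y t else 0) \<le> N (\<lambda>t. 1 + 2 * y' t)"
    by (rule dominated_le(2)[OF add_in_E[OF one_in scale_in_E[OF y'E(1)]] _ ptw]) measurable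
  also have "\<dots> \<le> N (\<lambda>_. 1) + 2 * N y'"
    using norm_add[OF one_in scale_in_E[OF y'E(1), of 2]] norm_scale[OF y'E(1), of 2] by simp
  finally have N: "(B - N (\<lambda>_. 1)) / 2 < N (step L m)" using L y'E(2) by simp
  have int: "ennreal (\<Sum>j<L. M (2 ^ j) * m j) \<le> modular M y"
    if M: "M \<in> orlicz_cone p q" for M
  proof -
    note M0 = orlicz_coneD(5)[OF M]
    have "ennreal (\<Sum>j<L. M (2 ^ j) * m j) = (\<Sum>j<L. ennreal (M (2 ^ j)) * emeasure unit_int (S j))"
      using M0 by (subst sum_ennreal[symmetric])
        (auto simp: m_def ennreal_mult finite_measure.emeasure_eq_measure intro!: sum.cong)
    also have "\<dots> = (\<Sum>j<L. \<integral>\<^sup>+t. ennreal (M (2 ^ j)) * indicator (S j) t \<partial>unit_int)"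
      using S by (intro sum.cong refl nn_integral_cmult_indicator[symmetric]) auto
    also have "\<dots> = (\<integral>\<^sup>+t. (\<Sum>j<L. ennreal (M (2 ^ j)) * indicator (S j) t) \<partial>unit_int)"
      using S by (intro nn_integral_sum[symmetric]) auto
    also have "\<dots> \<le> modular M y"
    proof (rule nn_integral_mono)
      fix t
      have "(\<Sum>j<L. ennreal (M (2 ^ j)) * indicator (S j) t) = ennreal (\<Sum>j<L. indicator (S j) t * M (2 ^ j))"
        using M0 by (subst sum_ennreal[symmetric]) (auto simp: indicator_def intro!: sum.cong)
      also have "(\<Sum>j<L. indicator (S j) t * M (2 ^ j)) = M (\<Sum>j<L. indicator (S j) t * 2 ^ j)"
        using orlicz_coneD(4)[OF M, of 0]
        by (intro disjoint_sum_indicator[OF disj, symmetric]) auto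
      also have "ennreal (M (\<Sum>j<L. indicator (S j) t * 2 ^ j)) \<le> ennreal (M \<bar>y t\<bar>)"
      proof (rule ennreal_leI)
        show "M (\<Sum>j<L. indicator (S j) t * 2 ^ j) \<le> M \<bar>y t\<bar>"
      proof (rule orlicz_coneD(6)[OF M])
        \<comment> \<open>On S j the value 2^j is at most |y t|, so truncating the disjoint sum at
          |y t| leaves it unchanged.\<close>
        have "(\<Sum>j<L. indicator (S j) t * (2 ^ j :: real)) = min \<bar>y t\<bar> (\<Sum>j<L. indicator (S j) t * 2 ^ j)"
        proof -
          have "min \<bar>y t\<bar> (\<Sum>j<L. indicator (S j) t * 2 ^ j) = (\<Sum>j<L. indicator (S j) t * min \<bar>y t\<bar> (2 ^ j))"
            by (rule disjoint_sum_indicator[OF disj, where \<phi> = "min \<bar>y t\<bar>"]) auto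
          also have "\<dots> = (\<Sum>j<L. indicator (S j) t * 2 ^ j)"
            by (intro sum.cong refl) (auto simp: indicator_def S_def)
          finally show ?thesis by simp
        qed
        then show "(\<Sum>j<L. indicator (S j) t * (2 ^ j :: real)) \<le> \<bar>y t\<bar>" by linarith
      qed
      qed
      finally show "(\<Sum>j<L. ennreal (M (2 ^ j)) * indicator (S j) t) \<le> ennreal (M \<bar>y t\<bar>)" .
    qed
    finally show ?thesis .
  qed
  show ?thesis using sub N int by (intro exI[of _ L] exI[of _ m]) (auto simp: m_def)
qed

end

context orlicz_setting
begin

text \<open>The compact set K of the minimax argument, with \<open>\<nu>\<close> as the distribution
  of J. The bound on the integral is stated through partial sums, each continuous for pointwise
  convergence, so that the set is closed.\<close>

definition majorants :: "(nat \<Rightarrow> real) \<Rightarrow> (real \<Rightarrow> real) set" where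
  "majorants \<nu> = {M \<in> orlicz_cone p q. \<forall>L. (\<Sum>j<L. M (2 ^ j) * \<nu> j) \<le> 1}"

lemma majorants_convex:
  assumes "M \<in> majorants \<nu>" "M' \<in> majorants \<nu>" "0 \<le> a" "a \<le> 1"
  shows "(\<lambda>u. a * M u + (1 - a) * M' u) \<in> majorants \<nu>"
proof -
  have "(\<Sum>j<L. (a * M (2 ^ j) + (1 - a) * M' (2 ^ j)) * \<nu> j) \<le> 1" for L
  proof -
    have "(\<Sum>j<L. (a * M (2 ^ j) + (1 - a) * M' (2 ^ j)) * \<nu> j)
       = a * (\<Sum>j<L. M (2 ^ j) * \<nu> j) + (1 - a) * (\<Sum>j<L. M' (2 ^ j) * \<nu> j)"
      by (simp add: sum_distrib_left sum.distrib[symmetric] distrib_right mult.assoc)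
    also have "\<dots> \<le> a * 1 + (1 - a) * 1"
      using assms by (intro add_mono mult_left_mono) (auto simp: majorants_def)
    finally show ?thesis by simp
  qed
  then show ?thesis
    using assms by (auto simp: majorants_def intro!: orlicz_cone_add orlicz_cone_scale)
qed

lemma zero_majorant: "(\<lambda>_. 0) \<in> majorants \<nu>"
proof -
  obtain M where "M \<in> orlicz_cone p q" using level_function_exists[OF p1 pq] by blast
  then have "(\<lambda>u. 0 * M u) \<in> orlicz_cone p q" by (rule orlicz_cone_scale) simp
  then show ?thesis by (simp add: majorants_def)
qed

text \<open>Every u lies below some 2^i with \<nu> i > 0, and a single term of the sum gives M u
  \<le> M (2^i) \<le> 1 / \<nu> i. The choice of i depends on u alone, as the product of intervals
  requires.\<close>

lemma majorants_compact:
  assumes nu: "\<And>j. 0 \<le> \<nu> j" and inf: "\<And>j. \<exists>i\<ge>j. 0 < \<nu> i"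
  shows "compact (majorants \<nu>)"
proof (rule compact_pointwise_bounded)
  have "closed {M :: real \<Rightarrow> real. \<forall>L. (\<Sum>j<L. M (2 ^ j) * \<nu> j) \<le> 1}"
    by (intro closed_Collect_all closed_Collect_le continuous_on_sum continuous_on_mult
        continuous_on_const continuous_on_product_coordinates)
  moreover have "majorants \<nu> = orlicz_cone p q \<inter> {M. \<forall>L. (\<Sum>j<L. M (2 ^ j) * \<nu> j) \<le> 1}"
    by (auto simp: majorants_def)
  ultimately show "closed (majorants \<nu>)" by (simp add: closed_Int closed_orlicz_cone)
  fix M :: "real \<Rightarrow> real" and u :: real assume M: "M \<in> majorants \<nu>"
  have cone: "M \<in> orlicz_cone p q" using M by (simp add: majorants_def)
  define i where "i = (SOME i. u \<le> 2 ^ i \<and> 0 < \<nu> i)"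
  have "\<exists>i. u \<le> 2 ^ i \<and> 0 < \<nu> i"
  proof -
    obtain j where j: "u < 2 ^ j" using real_arch_pow[of 2 u] by auto
    obtain i where i: "j \<le> i" "0 < \<nu> i" using inf by blast
    have "u \<le> 2 ^ i" using j i power_increasing[of j i "2::real"] by linarith
    then show ?thesis using i by blast
  qed
  then have i: "u \<le> 2 ^ i" "0 < \<nu> i" unfolding i_def by (metis (mono_tags, lifting) someI)+
  have "M (2 ^ i) * \<nu> i \<le> (\<Sum>j<Suc i. M (2 ^ j) * \<nu> j)"
    using nu orlicz_coneD(5)[OF cone] by (intro member_le_sum) auto
  also have "\<dots> \<le> 1" using M unfolding majorants_def by blast
  finally have "M (2 ^ i) \<le> 1 / \<nu> i" using i by (simp add: field_simps)
  then have "M u \<le> 1 / \<nu> i" using orlicz_coneD(6)[OF cone i(1)] by linarith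
  then show "M u \<in> {0..1 / \<nu> (SOME i. u \<le> 2 ^ i \<and> 0 < \<nu> i)}"
    using orlicz_coneD(5)[OF cone] by (simp add: i_def)
qed

end

section \<open>The minimax argument for a fixed dyadic majorant\<close>

locale dyadic_majorant = orlicz_setting E N p q cI cD for E N p q cI cD +
  fixes J :: "real \<Rightarrow> nat" and C \<kappa> :: real
  assumes J: "J \<in> measurable unit_int (count_space UNIV)" and JE: "(\<lambda>t. 2 ^ J t) \<in> E"
    and JC: "N (\<lambda>t. 2 ^ J t) \<le> C" and Junb: "\<And>j. 0 < measure unit_int {t \<in> {0..1}. j \<le> J t}"
    and \<kappa>: "0 < \<kappa>" and level_function: "\<And>k. \<exists>M\<in>orlicz_cone p q.
     \<forall>j. \<kappa> * level_weight p q k j \<le> M (2 ^ j) \<and> M (2 ^ j) \<le> 2 * level_weight p q k j"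
begin

definition \<nu> :: "nat \<Rightarrow> real" where "\<nu> j = measure unit_int {t \<in> {0..1}. J t = j}"

lemma J_sets: "{t \<in> {0..1}. J t = j} \<in> sets unit_int" "{t \<in> {0..1}. j \<le> J t} \<in> sets unit_int"
proof -
  have "{t \<in> space unit_int. J t = j} \<in> sets unit_int" "{t \<in> space unit_int. j \<le> J t} \<in> sets unit_int"
    using J by measurable
  then show "{t \<in> {0..1}. J t = j} \<in> sets unit_int" "{t \<in> {0..1}. j \<le> J t} \<in> sets unit_int" by simp_all
qed

lemma J_compose: "(\<lambda>t. f (J t)) \<in> borel_measurable unit_int" for f :: "nat \<Rightarrow> real"
  using J by (rule measurable_compose) simp

lemma \<nu>_nonneg: "0 \<le> \<nu> j" by (simp add: \<nu>_def)

lemma \<nu>_unbounded: "\<exists>i\<ge>j. 0 < \<nu> i"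
proof (rule ccontr)
  assume "\<not> (\<exists>i\<ge>j. 0 < \<nu> i)"
  then have 0: "\<nu> i = 0" if "j \<le> i" for i using \<nu>_nonneg[of i] that by (meson not_less order_antisym)
  have "(\<Union>i\<in>{j..}. {t \<in> {0..1}. J t = i}) \<in> null_sets unit_int"
    using 0 J_sets by (intro null_sets_UN') (auto simp: null_sets_def finite_measure.emeasure_eq_measure \<nu>_def)
  moreover have "(\<Union>i\<in>{j..}. {t \<in> {0..1}. J t = i}) = {t \<in> {0..1}. j \<le> J t}" by auto
  ultimately have "measure unit_int {t \<in> {0..1}. j \<le> J t} = 0"
    by (auto simp: null_sets_def measure_def)
  then show False using Junb[of j] by simp
qed

lemma sum_\<nu>_le_integral:
  assumes f: "\<And>j. 0 \<le> f j" "integrable unit_int (\<lambda>t. f (J t))"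
  shows "(\<Sum>j<L. f j * \<nu> j) \<le> (\<integral>t. f (J t) \<partial>unit_int)"
proof -
  have "(\<Sum>j<L. f j * \<nu> j) = (\<Sum>j<L. \<integral>t. f j * indicator {t \<in> {0..1}. J t = j} t \<partial>unit_int)"
  proof (rule sum.cong[OF refl])
    fix j
    have "{t \<in> {0..1}. J t = j} \<inter> {0..1} = {t \<in> {0..1}. J t = j}" by auto
    then show "f j * \<nu> j = (\<integral>t. f j * indicator {t \<in> {0..1}. J t = j} t \<partial>unit_int)"
      using J_sets(1)[of j] by (simp add: \<nu>_def)
  qed
  also have "\<dots> = (\<integral>t. (\<Sum>j<L. f j * indicator {t \<in> {0..1}. J t = j} t) \<partial>unit_int)"
    using J_sets(1)
    by (intro Bochner_Integration.integral_sum[symmetric] integrable_mult_right integrable_real_indicator)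
      (auto simp: finite_measure.emeasure_eq_measure)
  also have "\<dots> \<le> (\<integral>t. f (J t) \<partial>unit_int)"
  proof (rule integral_mono[OF _ f(2)])
    show "integrable unit_int (\<lambda>t. \<Sum>j<L. f j * indicator {t \<in> {0..1}. J t = j} t)"
      using J_sets(1)
      by (intro Bochner_Integration.integrable_sum integrable_mult_right integrable_real_indicator)
        (auto simp: finite_measure.emeasure_eq_measure)
    fix t
    have "(\<Sum>j<L. f j * indicator {t \<in> {0..1}. J t = j} t) \<le> (\<Sum>j<L. if J t = j then f j else 0)"
      using f(1) by (intro sum_mono) (auto simp: indicator_def)
    also have "\<dots> \<le> f (J t)" using f(1) by (simp add: sum.delta')
    finally show "(\<Sum>j<L. f j * indicator {t \<in> {0..1}. J t = j} t) \<le> f (J t)" .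
  qed
  finally show ?thesis .
qed

text \<open>With j = J t the right-hand side is integrable by \<open>integrable_powr_E\<close>; it
  is the dominating function for every weight integral below.\<close>

lemma level_weight_bound: "level_weight p q k j \<le> 2 powr (real k * p) + (2 ^ j) powr p"
proof (cases "k \<le> j \<or> q = \<infinity>")
  case True
  then show ?thesis by (auto simp: level_weight_def powr_powr simp flip: powr_realpow)
next
  case False
  have "2 powr ((real j - real k) * real_of_ereal q) \<le> (2::real) powr 0"
  proof (intro powr_mono mult_nonpos_nonneg)
    show "0 \<le> real_of_ereal q" using q1 by (cases q) auto
  qed (use False in auto)
  then have "2 powr (real k * p) * 2 powr ((real j - real k) * real_of_ereal q) \<le> (2::real) powr (real k * p) * 1"
    by (intro mult_left_mono) auto
  moreover have "level_weight p q k j = 2 powr (real k * p) * 2 powr ((real j - real k) * real_of_ereal q)"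
    using False by (simp add: level_weight_def)
  moreover have "0 \<le> ((2::real) ^ j) powr p" by simp
  ultimately show ?thesis by linarith
qed

lemma bound_integrable: "integrable unit_int (\<lambda>t. 2 powr (real k * p) + (2 ^ J t) powr p)"
  by (intro Bochner_Integration.integrable_add finite_measure.integrable_const finite_measure_unit_int
      integrable_powr_E[OF JE]) auto

lemma level_weight_integrable: "integrable unit_int (\<lambda>t. level_weight p q k (J t))"
  by (rule Bochner_Integration.integrable_bound[OF bound_integrable[of k] J_compose])
    (auto simp: abs_of_nonneg level_weight_nonneg intro!: AE_I2 level_weight_bound)

lemma level_weight_integral_pos: "0 < (\<integral>t. level_weight p q k (J t) \<partial>unit_int)"
proof -
  obtain i where i: "k \<le> i" "0 < \<nu> i" using \<nu>_unbounded by blast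
  have "0 < level_weight p q k i * \<nu> i" using i level_weight_pos by simp
  also have "\<dots> \<le> (\<Sum>j<Suc i. level_weight p q k j * \<nu> j)"
    using \<nu>_nonneg level_weight_nonneg by (intro member_le_sum) auto
  also have "\<dots> \<le> (\<integral>t. level_weight p q k (J t) \<partial>unit_int)"
    by (intro sum_\<nu>_le_integral level_weight_nonneg level_weight_integrable)
  finally show ?thesis .
qed

text \<open>\<open>step_norm_bound\<close> needs a bounded J. Truncated integrals converge by
  dominated convergence, and positivity of the limit makes them exceed its half eventually.\<close>

lemma truncated_integral:
  "\<exists>n0. \<forall>n\<ge>n0. (\<integral>t. level_weight p q k (J t) \<partial>unit_int) \<le> 2 * (\<integral>t. level_weight p q k (min (J t) n) \<partial>unit_int)"
proof -
  define G where "G = (\<integral>t. level_weight p q k (J t) \<partial>unit_int)"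
  have "(\<lambda>n. \<integral>t. level_weight p q k (min (J t) n) \<partial>unit_int) \<longlonglongrightarrow> G"
    unfolding G_def
  proof (rule integral_dominated_convergence[OF J_compose _ bound_integrable[of k]])
    show "(\<lambda>t. level_weight p q k (min (J t) n)) \<in> borel_measurable unit_int" for n
      by (rule J_compose)
    show "AE t in unit_int. (\<lambda>n. level_weight p q k (min (J t) n)) \<longlonglongrightarrow> level_weight p q k (J t)"
    proof (intro AE_I2)
      fix t
      have "eventually (\<lambda>n. level_weight p q k (min (J t) n) = level_weight p q k (J t)) sequentially"
        using eventually_ge_at_top[of "J t"] by eventually_elim (simp add: min_absorb1)
      then show "(\<lambda>n. level_weight p q k (min (J t) n)) \<longlonglongrightarrow> level_weight p q k (J t)"
        by (rule tendsto_eventually)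
    qed
    show "AE t in unit_int. norm (level_weight p q k (min (J t) n)) \<le> 2 powr (real k * p) + (2 ^ J t) powr p" for n
    proof (intro AE_I2)
      fix t
      have "level_weight p q k (min (J t) n) \<le> 2 powr (real k * p) + (2 ^ min (J t) n) powr p"
        by (rule level_weight_bound)
      also have "\<dots> \<le> 2 powr (real k * p) + (2 ^ J t) powr p"
        using p1 by (intro add_left_mono powr_mono2 power_increasing) auto
      finally show "norm (level_weight p q k (min (J t) n)) \<le> 2 powr (real k * p) + (2 ^ J t) powr p"
        using level_weight_nonneg by simp
    qed
  qed
  moreover have "G / 2 < G" using level_weight_integral_pos[of k] by (simp add: G_def)
  ultimately have "eventually (\<lambda>n. G / 2 < (\<integral>t. level_weight p q k (min (J t) n) \<partial>unit_int)) sequentially"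
    by (rule order_tendstoD(1))
  then show ?thesis unfolding G_def[symmetric] eventually_sequentially by (force simp: field_simps)
qed

text \<open>Otherwise the level functions, divided by their integrals I over 2^J, are majorants with
  small sums. As I is at most twice the weight integral G k, this gives weight sums of z at most G k
  / 4, hence at most half the weight integral of a truncated J, and \<open>step_norm_bound\<close>
  contradicts \<open>big\<close>.\<close>

lemma single_vector:
  assumes z: "substochastic L z" and big: "2 * cI * C < N (step L z)"
  shows "\<exists>M\<in>majorants \<nu>. \<kappa> / 8 \<le> (\<Sum>j<L. M (2 ^ j) * z j)"
proof (rule ccontr)
  assume "\<not> (\<exists>M\<in>majorants \<nu>. \<kappa> / 8 \<le> (\<Sum>j<L. M (2 ^ j) * z j))"
  then have small: "(\<Sum>j<L. M (2 ^ j) * z j) < \<kappa> / 8" if "M \<in> majorants \<nu>" for M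
    using that by (meson not_less)
  define G where "G k = (\<integral>t. level_weight p q k (J t) \<partial>unit_int)" for k
  have z0: "0 \<le> z j" for j using z by (simp add: substochastic_def)
  have main: "(\<Sum>j<L. level_weight p q k j * z j) \<le> G k / 4" for k
  proof -
    obtain M where M: "M \<in> orlicz_cone p q" "\<And>j. \<kappa> * level_weight p q k j \<le> M (2 ^ j)"
      "\<And>j. M (2 ^ j) \<le> 2 * level_weight p q k j"
      using level_function by blast
    have Mi: "integrable unit_int (\<lambda>t. M (2 ^ J t))"
    proof (rule Bochner_Integration.integrable_bound[OF integrable_mult_right[OF level_weight_integrable, of 2 k] J_compose])
      show "AE t in unit_int. norm (M (2 ^ J t)) \<le> norm (2 * level_weight p q k (J t))"
        using M orlicz_coneD(5)[OF M(1)] level_weight_nonneg by (auto intro!: AE_I2)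
    qed
    define I where "I = (\<integral>t. M (2 ^ J t) \<partial>unit_int)"
    have "\<kappa> * G k = (\<integral>t. \<kappa> * level_weight p q k (J t) \<partial>unit_int)" by (simp add: G_def)
    also have "\<dots> \<le> I" unfolding I_def
      using M by (intro integral_mono integrable_mult_right level_weight_integrable Mi)
    finally have I0: "0 < I"
      using \<kappa> level_weight_integral_pos[of k] by (simp add: G_def) (smt (verit) mult_pos_pos)
    have "I \<le> (\<integral>t. 2 * level_weight p q k (J t) \<partial>unit_int)" unfolding I_def
      using M by (intro integral_mono integrable_mult_right level_weight_integrable Mi)
    then have I2: "I \<le> 2 * G k" by (simp add: G_def)
    have "(\<lambda>u. (1 / I) * M u) \<in> majorants \<nu>"
    proof -
      have "(\<Sum>j<L. (1 / I) * M (2 ^ j) * \<nu> j) \<le> 1" for L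
      proof -
        have "(\<Sum>j<L. M (2 ^ j) * \<nu> j) \<le> I"
          unfolding I_def using orlicz_coneD(5)[OF M(1)] Mi by (intro sum_\<nu>_le_integral)
        then show ?thesis using I0 by (simp add: sum_divide_distrib[symmetric])
      qed
      then show ?thesis using orlicz_cone_scale[OF M(1), of "1 / I"] I0 by (simp add: majorants_def)
    qed
    from small[OF this] have "(\<Sum>j<L. M (2 ^ j) * z j) / I < \<kappa> / 8"
      by (simp add: sum_divide_distrib)
    then have "(\<Sum>j<L. M (2 ^ j) * z j) < \<kappa> / 8 * I" using I0 by (simp add: pos_divide_less_eq)
    also have "\<dots> \<le> \<kappa> / 8 * (2 * G k)" using I2 \<kappa> by (intro mult_left_mono) auto
    finally have 1: "(\<Sum>j<L. M (2 ^ j) * z j) < \<kappa> * (G k / 4)" by simp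
    have "\<kappa> * (\<Sum>j<L. level_weight p q k j * z j) = (\<Sum>j<L. (\<kappa> * level_weight p q k j) * z j)"
      by (simp add: sum_distrib_left mult.assoc)
    also have "\<dots> \<le> (\<Sum>j<L. M (2 ^ j) * z j)" using M z0 by (intro sum_mono mult_right_mono)
    finally have "\<kappa> * (\<Sum>j<L. level_weight p q k j * z j) < \<kappa> * (G k / 4)" using 1 by linarith
    then show ?thesis using \<kappa> by simp
  qed
  have "\<forall>k. \<exists>n0. \<forall>n\<ge>n0. G k \<le> 2 * (\<integral>t. level_weight p q k (min (J t) n) \<partial>unit_int)"
    using truncated_integral by (simp add: G_def)
  then obtain n0 where n0: "\<And>k n. n0 k \<le> n \<Longrightarrow> G k \<le> 2 * (\<integral>t. level_weight p q k (min (J t) n) \<partial>unit_int)"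
    by metis
  define n where "n = Max (insert 0 (n0 ` {..<L}))"
  have n: "n0 k \<le> n" if "k < L" for k unfolding n_def using that by (intro Max_ge) auto
  have "N (step L z) \<le> 2 * cI * N (\<lambda>t. 2 ^ min (J t) n)"
  proof (rule step_norm_bound[where n = n, OF _ _ z])
    show "(\<lambda>t. min (J t) n) \<in> measurable unit_int (count_space UNIV)"
      using J by (rule measurable_compose) simp
    show "(\<Sum>j<L. level_weight p q k j * z j) \<le> 1 / 2 * (\<integral>t. level_weight p q k (min (J t) n) \<partial>unit_int)" if "k < L" for k
      using main[of k] n0[OF n[OF that]] by linarith
  qed simp
  also have "N (\<lambda>t. 2 ^ min (J t) n) \<le> N (\<lambda>t. 2 ^ J t)"
  proof (rule dominated_le(2)[OF JE J_compose])
    show "\<bar>2 ^ min (J t) n\<bar> \<le> \<bar>2 ^ J t :: real\<bar>" for t using power_increasing[of "min (J t) n" "J t" "2::real"] by simp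
  qed
  also note JC
  finally have "N (step L z) \<le> 2 * cI * C" using cI by simp
  then show False using big by simp
qed

text \<open>If no M serves all of F, \<open>finite_minimax\<close> gives weights l whose combined
  sum is at most \<kappa> / 32 for every M. An average of members of F has norm above 2 * cI * C by
  \<open>average_norm\<close>, hence an M with sum at least \<kappa> / 8, against the upper bound 2
  * \<kappa> / 32.\<close>

lemma finite_family:
  assumes F: "finite F" and sub: "\<And>m. m \<in> F \<Longrightarrow> substochastic L m"
    and big: "\<And>m. m \<in> F \<Longrightarrow> cD * (2 * cI * C) < N (step L m)"
  shows "\<exists>M\<in>majorants \<nu>. \<forall>m\<in>F. \<kappa> / 32 < (\<Sum>j<L. M (2 ^ j) * m j)"
proof (rule ccontr)
  assume no: "\<not> (\<exists>M\<in>majorants \<nu>. \<forall>m\<in>F. \<kappa> / 32 < (\<Sum>j<L. M (2 ^ j) * m j))"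
  define f where "f m M = (\<Sum>j<L. M (2 ^ j) * m j) - \<kappa> / 32" for m :: "nat \<Rightarrow> real" and M :: "real \<Rightarrow> real"
  have "\<exists>l. (\<forall>m\<in>F. 0 \<le> l m) \<and> sum l F = 1 \<and> (\<forall>M\<in>majorants \<nu>. (\<Sum>m\<in>F. l m * f m M) \<le> 0)"
  proof (rule finite_minimax[OF F])
    show "majorants \<nu> \<noteq> {}" using zero_majorant by blast
    show "\<exists>m\<in>F. f m M \<le> 0" if "M \<in> majorants \<nu>" for M
      using no that by (auto simp: f_def not_less)
    fix M M' a assume a: "M \<in> majorants \<nu>" "M' \<in> majorants \<nu>" "0 \<le> (a::real)" "a \<le> 1"
    have "a * f m M + (1 - a) * f m M' = f m (\<lambda>u. a * M u + (1 - a) * M' u)" for m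
    proof -
      have e: "(\<Sum>j<L. (a * M (2 ^ j) + (1 - a) * M' (2 ^ j)) * m j)
          = a * (\<Sum>j<L. M (2 ^ j) * m j) + (1 - a) * (\<Sum>j<L. M' (2 ^ j) * m j)"
        by (simp add: sum_distrib_left sum.distrib[symmetric] distrib_right mult.assoc)
      have "a * (A - c) + (1 - a) * (B - c) = (a * A + (1 - a) * B) - c" for A B c :: real
        by (simp add: algebra_simps)
      then show ?thesis by (simp only: f_def e)
    qed
    then show "\<exists>z\<in>majorants \<nu>. \<forall>i\<in>F. a * f i M + (1 - a) * f i M' \<le> f i z"
      by (intro bexI[OF _ majorants_convex[OF a]]) simp
  qed
  then obtain l where l: "\<And>m. m \<in> F \<Longrightarrow> 0 \<le> l m" "sum l F = 1"
    "\<And>M. M \<in> majorants \<nu> \<Longrightarrow> (\<Sum>m\<in>F. l m * f m M) \<le> 0" by blast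
  have lf: "(\<Sum>m\<in>F. l m * (\<Sum>j<L. M (2 ^ j) * m j)) \<le> \<kappa> / 32" if "M \<in> majorants \<nu>" for M
  proof -
    have "(\<Sum>m\<in>F. l m * f m M) = (\<Sum>m\<in>F. l m * (\<Sum>j<L. M (2 ^ j) * m j)) - sum l F * (\<kappa> / 32)"
      by (simp add: f_def right_diff_distrib sum_subtractf sum_distrib_right)
    then show ?thesis using l(2) l(3)[OF that] by simp
  qed
  have F0: "card F > 0" using l(2) F by (auto simp: card_gt_0_iff)
  \<comment> \<open>Convex combinations are replaced by averages with multiplicities \<open>r m\<close>, at the cost of a factor 2.\<close>
  define R where "R = 2 * real (card F)"
  define r where "r m = nat \<lfloor>l m * R\<rfloor>" for m
  have R0: "R > 0" using F0 by (simp add: R_def)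
  have r1: "real (r m) \<le> l m * R" "l m * R - 1 \<le> real (r m)" if "m \<in> F" for m
  proof -
    have "0 \<le> l m * R" using l(1)[OF that] R0 by simp
    then show "real (r m) \<le> l m * R" "l m * R - 1 \<le> real (r m)" by (simp_all add: r_def)
  qed
  define n where "n = (\<Sum>m\<in>F. r m)"
  \<comment> \<open>Rounding down loses at most 1 for each of the card F = R / 2 members, so at
    least half of the total R survives; this is the factor 2.\<close>
  have "R / 2 = (\<Sum>m\<in>F. l m * R - 1)"
    using l(2) by (simp add: sum_subtractf sum_distrib_right[symmetric] R_def)
  also have "\<dots> \<le> (\<Sum>m\<in>F. real (r m))" using r1 by (intro sum_mono)
  finally have nR: "R / 2 \<le> real n" by (simp add: n_def)
  have n1: "1 \<le> n" using nR R0 by (cases n) auto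
  \<comment> \<open>Each m is listed r m times, because D*-convexity speaks of families indexed by
    1..n without weights.\<close>
  define P where "P = Sigma F (\<lambda>m. {..<r m})"
  have "card P = n" using F by (simp add: P_def n_def)
  moreover have "finite P" using F by (simp add: P_def)
  ultimately obtain h where h: "bij_betw h {1..n} P" using ex_bij_betw_nat_finite_1 by metis
  define ms where "ms k = fst (h k)" for k
  have msF: "ms k \<in> F" if "k \<in> {1..n}" for k
  proof -
    have "h k \<in> P" using bij_betwE[OF h] that by blast
    then show ?thesis by (cases "h k") (simp add: ms_def P_def)
  qed
  have sum_ms: "(\<Sum>k=1..n. ms k j) = (\<Sum>m\<in>F. real (r m) * m j)" for j
  proof -
    have "(\<Sum>k=1..n. ms k j) = (\<Sum>x\<in>P. fst x j)"
      unfolding ms_def by (rule sum.reindex_bij_betw[OF h])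
    also have "\<dots> = (\<Sum>m\<in>F. \<Sum>i<r m. m j)"
      unfolding P_def using F by (subst sum.Sigma) (auto simp: case_prod_beta)
    finally show ?thesis by simp
  qed
  define z where "z j = (\<Sum>k=1..n. ms k j) / real n" for j
  have "cD * (2 * cI * C) / cD < N (step L z)"
    unfolding z_def using n1 sub big msF by (intro average_norm) auto
  then have zbig: "2 * cI * C < N (step L z)" using cD by simp
  have m0: "0 \<le> m j" if "m \<in> F" for m j using sub[OF that] by (simp add: substochastic_def)
  have zs: "substochastic L z"
    unfolding z_def using sub[OF msF] by (intro substochastic_average n1) auto
  obtain M where M: "M \<in> majorants \<nu>" "\<kappa> / 8 \<le> (\<Sum>j<L. M (2 ^ j) * z j)"
    using single_vector[OF zs zbig] by blast
  have M0: "0 \<le> M u" for u using M(1) orlicz_coneD(5) by (auto simp: majorants_def)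
  have zl: "z j \<le> 2 * (\<Sum>m\<in>F. l m * m j)" for j
  proof -
    have S0: "0 \<le> (\<Sum>m\<in>F. l m * m j)" using l m0 by (intro sum_nonneg) auto
    have "(\<Sum>m\<in>F. real (r m) * m j) \<le> (\<Sum>m\<in>F. l m * R * m j)"
      using r1 m0 by (intro sum_mono mult_right_mono) auto
    also have "\<dots> = R * (\<Sum>m\<in>F. l m * m j)" by (simp add: sum_distrib_left mult_ac)
    also have "\<dots> \<le> (2 * real n) * (\<Sum>m\<in>F. l m * m j)" using nR S0 by (intro mult_right_mono) auto
    finally show ?thesis unfolding z_def sum_ms using n1 by (simp add: divide_le_eq mult_ac)
  qed
  have "(\<Sum>j<L. M (2 ^ j) * z j) \<le> (\<Sum>j<L. M (2 ^ j) * (2 * (\<Sum>m\<in>F. l m * m j)))"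
    using M0 zl by (intro sum_mono mult_left_mono)
  also have "\<dots> = 2 * (\<Sum>m\<in>F. l m * (\<Sum>j<L. M (2 ^ j) * m j))"
    unfolding sum_distrib_left by (subst sum.swap) (simp add: mult_ac)
  also have "\<dots> \<le> 2 * (\<kappa> / 32)" using lf[OF M(1)] by simp
  finally show False using M(2) \<kappa> by simp
qed

text \<open>Finite intersection property: each condition on M involves finitely many coordinates and
  is closed in its non-strict form, and \<open>finite_family\<close> meets any finitely many of
  them.\<close>

lemma uniform_majorant:
  "\<exists>M\<in>majorants \<nu>. \<forall>L m. substochastic L m \<and> (\<forall>j\<ge>L. m j = 0) \<and> cD * (2 * cI * C) < N (step L m)
     \<longrightarrow> \<kappa> / 32 \<le> (\<Sum>j<L. M (2 ^ j) * m j)"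
proof -
  define V where "V = {(L, m). substochastic L m \<and> (\<forall>j\<ge>L. m j = 0) \<and> cD * (2 * cI * C) < N (step L m)}"
  define S where "S x = {M :: real \<Rightarrow> real. \<kappa> / 32 \<le> (\<Sum>j<fst x. M (2 ^ j) * snd x j)}" for x :: "nat \<times> (nat \<Rightarrow> real)"
  have "majorants \<nu> \<inter> (\<Inter>x\<in>V. S x) \<noteq> {}"
  proof (rule compact_imp_fip_image[OF majorants_compact[OF \<nu>_nonneg \<nu>_unbounded]])
    show "closed (S x)" for x
      unfolding S_def
      by (intro closed_Collect_le continuous_on_sum continuous_on_mult
          continuous_on_const continuous_on_product_coordinates)
    fix I assume I: "finite I" "I \<subseteq> V"
    \<comment> \<open>A common length for the finite family; the masses vanish beyond their own
      lengths, so neither the sums nor the step functions change.\<close>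
    define L where "L = Max (insert 0 (fst ` I))"
    have L: "fst x \<le> L" if "x \<in> I" for x unfolding L_def using I that by (intro Max_ge) auto
    have zero: "snd x j = 0" if "x \<in> I" "fst x \<le> j" for x j using that I by (auto simp: V_def)
    have sums: "(\<Sum>j<L. g j * snd x j) = (\<Sum>j<fst x. g j * snd x j)" if "x \<in> I" for x and g :: "nat \<Rightarrow> real"
      using L[OF that] zero[OF that] by (intro sum.mono_neutral_right) auto
    have "\<exists>M\<in>majorants \<nu>. \<forall>m\<in>snd ` I. \<kappa> / 32 < (\<Sum>j<L. M (2 ^ j) * m j)"
    proof (rule finite_family)
      fix m assume "m \<in> snd ` I"
      then obtain x where x: "x \<in> I" "m = snd x" by blast
      show "substochastic L m"
        using sums[OF x(1), of "\<lambda>_. 1"] x I by (auto simp: substochastic_def V_def)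
      show "cD * (2 * cI * C) < N (step L m)"
        using step_extend[OF L[OF x(1)], of "snd x"] zero[OF x(1)] x I by (auto simp: V_def)
    qed (use I in auto)
    then obtain M where "M \<in> majorants \<nu>" "\<forall>m\<in>snd ` I. \<kappa> / 32 < (\<Sum>j<L. M (2 ^ j) * m j)" by blast
    then have "M \<in> majorants \<nu> \<inter> (\<Inter>x\<in>I. S x)" by (force simp: S_def sums)
    then show "majorants \<nu> \<inter> (\<Inter>x\<in>I. S x) \<noteq> {}" by blast
  qed
  then obtain M where M: "M \<in> majorants \<nu>" "\<And>x. x \<in> V \<Longrightarrow> M \<in> S x" by blast
  show ?thesis
  proof (intro bexI[OF _ M(1)] allI impI)
    fix L m assume "substochastic L m \<and> (\<forall>j\<ge>L. m j = 0) \<and> cD * (2 * cI * C) < N (step L m)"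
    then have "M \<in> S (L, m)" by (intro M(2)) (simp add: V_def)
    then show "\<kappa> / 32 \<le> (\<Sum>j<L. M (2 ^ j) * m j)" by (simp add: S_def)
  qed
qed

lemma majorant_integral:
  assumes M: "M \<in> majorants \<nu>"
  shows "(\<integral>\<^sup>+t. ennreal (M (2 ^ J t)) \<partial>unit_int) \<le> 1"
proof -
  have M0: "0 \<le> M u" for u using M orlicz_coneD(5) by (auto simp: majorants_def)
  have "(\<integral>\<^sup>+t. ennreal (M (2 ^ J t)) \<partial>unit_int)
      = (\<integral>\<^sup>+t. (SUP L. \<Sum>j<L. ennreal (M (2 ^ j)) * indicator {t \<in> {0..1}. J t = j} t) \<partial>unit_int)"
  proof (rule nn_integral_cong)
    fix t assume t: "t \<in> space unit_int"
    have e: "(\<Sum>j<L. ennreal (M (2 ^ j)) * indicator {t \<in> {0..1}. J t = j} t)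
        = (if J t < L then ennreal (M (2 ^ J t)) else 0)" for L
    proof -
      have "(\<Sum>j<L. ennreal (M (2 ^ j)) * indicator {t \<in> {0..1}. J t = j} t)
          = (\<Sum>j<L. if J t = j then ennreal (M (2 ^ j)) else 0)"
        using t by (intro sum.cong) (auto simp: indicator_def)
      then show ?thesis by (simp add: sum.delta')
    qed
    show "ennreal (M (2 ^ J t)) = (SUP L. \<Sum>j<L. ennreal (M (2 ^ j)) * indicator {t \<in> {0..1}. J t = j} t)"
      unfolding e by (intro antisym SUP_upper2[of "Suc (J t)"] SUP_least) auto
  qed
  also have "\<dots> = (SUP L. \<integral>\<^sup>+t. (\<Sum>j<L. ennreal (M (2 ^ j)) * indicator {t \<in> {0..1}. J t = j} t) \<partial>unit_int)"
  proof (rule nn_integral_monotone_convergence_SUP)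
    show "incseq (\<lambda>L t. \<Sum>j<L. ennreal (M (2 ^ j)) * indicator {t \<in> {0..1}. J t = j} t)"
      by (intro incseq_SucI le_funI) simp
    note [measurable] = J_sets(1)
    show "(\<lambda>t. \<Sum>j<L. ennreal (M (2 ^ j)) * indicator {t \<in> {0..1}. J t = j} t) \<in> borel_measurable unit_int" for L
      by measurable
  qed
  also have "\<dots> \<le> 1"
  proof (rule SUP_least)
    fix L
    have "(\<integral>\<^sup>+t. (\<Sum>j<L. ennreal (M (2 ^ j)) * indicator {t \<in> {0..1}. J t = j} t) \<partial>unit_int)
       = (\<Sum>j<L. ennreal (M (2 ^ j)) * emeasure unit_int {t \<in> {0..1}. J t = j})"
      using J_sets(1) by (subst nn_integral_sum) (auto simp: nn_integral_cmult_indicator)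
    also have "\<dots> = ennreal (\<Sum>j<L. M (2 ^ j) * \<nu> j)"
      using M0 by (subst sum_ennreal[symmetric])
        (auto simp: \<nu>_def ennreal_mult finite_measure.emeasure_eq_measure intro!: sum.cong)
    also have "\<dots> \<le> 1" using M by (auto simp: majorants_def)
    finally show "(\<integral>\<^sup>+t. (\<Sum>j<L. ennreal (M (2 ^ j)) * indicator {t \<in> {0..1}. J t = j} t) \<partial>unit_int) \<le> 1" .
  qed
  finally show ?thesis .
qed

end

subsection \<open>Equivalence with an infimum of Orlicz norms\<close>

lemma orlicz_norm_le:
  assumes "0 < l" "(\<integral>\<^sup>+ t. ennreal (M (\<bar>x t\<bar> / l)) \<partial>unit_int) \<le> 1"
  shows "orlicz_norm M x \<le> ennreal l"
  unfolding orlicz_norm_def using assms by (intro INF_lower) simp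

lemma orlicz_norm_le_limit:
  assumes "0 \<le> a" "\<And>l. a < l \<Longrightarrow> (\<integral>\<^sup>+ t. ennreal (M (\<bar>x t\<bar> / l)) \<partial>unit_int) \<le> 1"
  shows "orlicz_norm M x \<le> ennreal a"
proof (rule ennreal_le_epsilon)
  fix e :: real assume "0 < e"
  then have "orlicz_norm M x \<le> ennreal (a + e)" using assms by (intro orlicz_norm_le) auto
  then show "orlicz_norm M x \<le> ennreal a + ennreal e" using assms(1) \<open>0 < e\<close> by simp
qed

lemma orlicz_cone_borel: "M \<in> orlicz_cone p q \<Longrightarrow> M \<in> borel_measurable borel"
  using orlicz_coneD(6) by (intro borel_measurable_mono) (auto simp: mono_def)

lemma nn_integral_scale_cone:
  assumes M: "M \<in> orlicz_cone p q" and [measurable]: "y \<in> borel_measurable unit_int" and a: "0 \<le> a"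
  shows "(\<integral>\<^sup>+ t. ennreal (a * M \<bar>y t\<bar>) \<partial>unit_int) = ennreal a * modular M y"
proof -
  note [measurable] = orlicz_cone_borel[OF M]
  show ?thesis using a orlicz_coneD(5)[OF M] by (subst nn_integral_cmult[symmetric]) (auto simp: ennreal_mult)
qed

lemma (in ri) orlicz_norm_null:
  assumes M: "M \<in> orlicz_cone p q" and x: "x \<in> E" "N x = 0"
  shows "orlicz_norm M x = 0"
proof -
  have "AE t in unit_int. x t = 0" using x norm_eq_0_iff by simp
  then have "(\<integral>\<^sup>+ t. ennreal (M (\<bar>x t\<bar> / l)) \<partial>unit_int) = (\<integral>\<^sup>+ t. 0 \<partial>unit_int)" for l
    using orlicz_coneD(4)[OF M, of 0] by (intro nn_integral_cong_AE) auto
  then have "orlicz_norm M x \<le> ennreal 0" by (intro orlicz_norm_le_limit) auto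
  then show ?thesis by simp
qed

lemma ennreal_le_mult_INF:
  assumes C: "0 < C" and a: "0 \<le> a" and le: "\<And>M. M \<in> F \<Longrightarrow> ennreal (a / C) \<le> g M"
  shows "ennreal a \<le> ennreal C * (INF M\<in>F. g M)"
proof -
  have "ennreal a = ennreal C * ennreal (a / C)" using C a by (simp add: ennreal_mult[symmetric])
  also have "\<dots> \<le> ennreal C * (INF M\<in>F. g M)" using le by (intro mult_left_mono INF_greatest) auto
  finally show ?thesis .
qed

lemma (in orlicz_setting) orlicz_majorant:
  assumes u: "u \<in> E" "\<And>b. 0 < distr_fun u b"
  shows "\<exists>C\<ge>1. \<forall>x\<in>E. N x \<le> 1 \<longrightarrow> (\<exists>M\<in>orlicz_cone p q. modular M x \<le> 1
     \<and> (\<forall>y\<in>E. C \<le> N y \<longrightarrow> ennreal (inverse C) \<le> modular M y))"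
proof -
  obtain \<kappa> where \<kappa>: "0 < \<kappa>" "\<And>k. \<exists>M\<in>orlicz_cone p q.
     \<forall>j. \<kappa> * level_weight p q k j \<le> M (2 ^ j) \<and> M (2 ^ j) \<le> 2 * level_weight p q k j"
    using level_function_exists[OF p1 pq] by blast
  define C0 where "C0 = 2 * (N (\<lambda>_. 1) + 2)"
  define A where "A = cD * (2 * cI * C0)"
  \<comment> \<open>The second entry gives the dyadic minorant of y a norm above A, the threshold of
    \<open>uniform_majorant\<close>; the third makes inverse C at most \<kappa> / 32. None depends
    on x, since C0 bounds the majorants of the whole unit ball.\<close>
  define C where "C = max 1 (max (N (\<lambda>_. 1) + 2 * A + 1) (32 / \<kappa>))"
  have C: "1 \<le> C" "N (\<lambda>_. 1) + 2 * A < C" "32 / \<kappa> \<le> C" by (auto simp: C_def)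
  have iC: "inverse C \<le> \<kappa> / 32" using C \<kappa>(1) by (simp add: field_simps)
  have "\<exists>M\<in>orlicz_cone p q. modular M x \<le> 1
     \<and> (\<forall>y\<in>E. C \<le> N y \<longrightarrow> ennreal (inverse C) \<le> modular M y)"
    if x: "x \<in> E" "N x \<le> 1" for x
  proof -
    obtain J where dom: "J \<in> measurable unit_int (count_space UNIV)" "\<And>t. \<bar>x t\<bar> \<le> 2 ^ J t" "(\<lambda>t. 2 ^ J t) \<in> E"
       "N (\<lambda>t. 2 ^ J t) \<le> C0" "\<And>j. 0 < measure unit_int {t \<in> {0..1}. j \<le> J t}"
      using dominating_dyadic[OF u x] unfolding C0_def by blast
    interpret dyadic_majorant E N p q cI cD J C0 \<kappa>
      by unfold_locales (fact dom \<kappa>)+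
    obtain M where M: "M \<in> majorants \<nu>"
      "\<And>L m. substochastic L m \<Longrightarrow> (\<forall>j\<ge>L. m j = 0) \<Longrightarrow> A < N (step L m) \<Longrightarrow> \<kappa> / 32 \<le> (\<Sum>j<L. M (2 ^ j) * m j)"
      using uniform_majorant unfolding A_def by blast
    have cone: "M \<in> orlicz_cone p q" using M(1) by (simp add: majorants_def)
    have "modular M x \<le> (\<integral>\<^sup>+ t. ennreal (M (2 ^ J t)) \<partial>unit_int)"
      using dom(2) by (intro nn_integral_mono ennreal_leI orlicz_coneD(6)[OF cone])
    also have "\<dots> \<le> 1" by (rule majorant_integral[OF M(1)])
    finally have "modular M x \<le> 1" .
    moreover have "ennreal (inverse C) \<le> modular M y" if y: "y \<in> E" "C \<le> N y" for y
    proof -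
      have "N (\<lambda>_. 1) + 2 * A < N y" using C y by linarith
      then obtain L m where m: "substochastic L m" "\<forall>j\<ge>L. m j = 0"
         "(N (\<lambda>_. 1) + 2 * A - N (\<lambda>_. 1)) / 2 < N (step L m)"
         "\<forall>M\<in>orlicz_cone p q. ennreal (\<Sum>j<L. M (2 ^ j) * m j) \<le> modular M y"
        using dyadic_minorant[OF y(1)] by blast
      have "inverse C \<le> (\<Sum>j<L. M (2 ^ j) * m j)" using M(2)[OF m(1,2)] m(3) iC by simp
      then have "ennreal (inverse C) \<le> ennreal (\<Sum>j<L. M (2 ^ j) * m j)" by (rule ennreal_leI)
      also have "\<dots> \<le> modular M y" using m(4) cone by blast
      finally show ?thesis .
    qed
    ultimately show ?thesis using cone by blast
  qed
  then show ?thesis using C(1) by blast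
qed

definition orlicz_equivalent :: "(real \<Rightarrow> real) set \<Rightarrow> ((real \<Rightarrow> real) \<Rightarrow> real) \<Rightarrow> real \<Rightarrow> ereal \<Rightarrow> bool" where
  "orlicz_equivalent E N p q \<longleftrightarrow>
     (\<exists>F. (\<forall>M\<in>F. increasing_fun M \<and> p_convex p M \<and> q_concave q M) \<and>
              (\<exists>C>0. \<forall>x\<in>E.
                 ennreal (N x) \<le> ennreal C * (INF M\<in>F. orlicz_norm M x) \<and>
                 (INF M\<in>F. orlicz_norm M x) \<le> ennreal C * ennreal (N x)))"

text \<open>F collects all M of the cone whose modular unit ball lies in the ball of radius C, so
  the lower estimate is built in. It is rich enough: 2 * C times a function from \<open>maj\<close>
  lies in F, as its modular is at least 2 once N y \<ge> C. For the upper estimate, shrinking the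
  argument by 2 * C shrinks M by at least that factor because p \<ge> 1.\<close>

lemma (in ri_one) orlicz_equivalent_if_majorants:
  assumes p: "1 \<le> p" and C: "1 \<le> C"
    and maj: "\<And>x. x \<in> E \<Longrightarrow> N x \<le> 1 \<Longrightarrow> \<exists>M\<in>orlicz_cone p q. modular M x \<le> 1
     \<and> (\<forall>y\<in>E. C \<le> N y \<longrightarrow> ennreal (inverse C) \<le> modular M y)"
  shows "orlicz_equivalent E N p q"
proof -
  define F where "F = {M \<in> orlicz_cone p q. \<forall>y\<in>E. modular M y \<le> 1 \<longrightarrow> N y \<le> C}"
  have good: "\<exists>M\<in>F. modular M x \<le> ennreal (2 * C)" if x: "x \<in> E" "N x \<le> 1" for x
  proof -
    obtain M where M: "M \<in> orlicz_cone p q" "modular M x \<le> 1"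
      "\<And>y. y \<in> E \<Longrightarrow> C \<le> N y \<Longrightarrow> ennreal (inverse C) \<le> modular M y"
      using maj[OF x] by blast
    have "N y \<le> C" if y: "y \<in> E" "(\<integral>\<^sup>+ t. ennreal (2 * C * M \<bar>y t\<bar>) \<partial>unit_int) \<le> 1" for y
    proof (rule ccontr)
      assume "\<not> N y \<le> C"
      then have "ennreal (2 * C) * ennreal (inverse C) \<le> ennreal (2 * C) * modular M y"
        using M(3)[OF y(1)] by (intro mult_left_mono) auto
      also have "\<dots> \<le> 1"
        using nn_integral_scale_cone[OF M(1) measurable_E[OF y(1)], of "2 * C"] y(2) C by simp
      also have "ennreal (2 * C) * ennreal (inverse C) = ennreal 2"
      proof -
        have "ennreal (2 * C) * ennreal (inverse C) = ennreal (2 * C * inverse C)"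
          using C by (intro ennreal_mult[symmetric]) auto
        also have "2 * C * inverse C = 2" using C by simp
        finally show ?thesis .
      qed
      finally show False by simp
    qed
    then have "(\<lambda>u. 2 * C * M u) \<in> F" using orlicz_cone_scale[OF M(1), of "2 * C"] C by (auto simp: F_def)
    moreover have "(\<integral>\<^sup>+ t. ennreal (2 * C * M \<bar>x t\<bar>) \<partial>unit_int) \<le> ennreal (2 * C)"
    proof -
      have "(\<integral>\<^sup>+ t. ennreal (2 * C * M \<bar>x t\<bar>) \<partial>unit_int) = ennreal (2 * C) * modular M x"
        using C by (intro nn_integral_scale_cone[OF M(1) measurable_E[OF x(1)]]) auto
      also have "\<dots> \<le> ennreal (2 * C) * 1" using M(2) by (intro mult_left_mono) auto
      finally show ?thesis by simp
    qed
    ultimately show ?thesis by (intro bexI[of _ "\<lambda>u. 2 * C * M u"])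
  qed
  have lower: "ennreal (N x / (2 * C)) \<le> orlicz_norm M x" if x: "x \<in> E" and M: "M \<in> F" for x M
    unfolding orlicz_norm_def
  proof (rule INF_greatest)
    fix l assume "l \<in> {l. 0 < l \<and> (\<integral>\<^sup>+ t. ennreal (M (\<bar>x t\<bar> / l)) \<partial>unit_int) \<le> 1}"
    then have l: "0 < l" "(\<integral>\<^sup>+ t. ennreal (M \<bar>(1 / l) * x t\<bar>) \<partial>unit_int) \<le> 1"
      by (auto simp: abs_mult)
    then have "N (\<lambda>t. (1 / l) * x t) \<le> C"
      using M scale_in_E[OF x, of "1 / l"] by (auto simp: F_def)
    then have "N x / l \<le> C" using norm_scale[OF x, of "1 / l"] l(1) by simp
    then have "N x \<le> C * l" using l(1) by (simp add: field_simps)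
    also have "\<dots> \<le> 2 * C * l" using C l(1) by simp
    finally show "ennreal (N x / (2 * C)) \<le> ennreal l" using C by (intro ennreal_leI) (simp add: field_simps)
  qed
  have upper: "(INF M\<in>F. orlicz_norm M x) \<le> ennreal (2 * C) * ennreal (N x)" if x: "x \<in> E" for x
  proof (cases "N x = 0")
    case True
    obtain M where M: "M \<in> F" using good[OF zero_in_E] norm_zero by auto
    then have "orlicz_norm M x = 0" using orlicz_norm_null[OF _ x True] by (auto simp: F_def)
    then show ?thesis using M INF_lower[of M F "\<lambda>M. orlicz_norm M x"] by simp
  next
    case False
    define a where "a = N x"
    have a: "a > 0" using False norm_nonneg[OF x] by (simp add: a_def)
    have "(\<lambda>t. (1 / a) * x t) \<in> E" "N (\<lambda>t. (1 / a) * x t) \<le> 1"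
      using scale_in_E[OF x, of "1 / a"] norm_scale[OF x, of "1 / a"] a by (auto simp: a_def)
    then obtain M where M: "M \<in> F" "(\<integral>\<^sup>+ t. ennreal (M \<bar>(1 / a) * x t\<bar>) \<partial>unit_int) \<le> ennreal (2 * C)"
      using good by blast
    have cone: "M \<in> orlicz_cone p q" using M by (simp add: F_def)
    have "(\<integral>\<^sup>+ t. ennreal (M (\<bar>x t\<bar> / (2 * C * a))) \<partial>unit_int)
        \<le> (\<integral>\<^sup>+ t. ennreal (1 / (2 * C) * M \<bar>(1 / a) * x t\<bar>) \<partial>unit_int)"
    proof (intro nn_integral_mono ennreal_leI)
      fix t
      have "M (\<bar>x t\<bar> / (2 * C * a)) = M (1 / (2 * C) * \<bar>(1 / a) * x t\<bar>)"
        using a by (simp add: abs_mult)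
      also have "\<dots> \<le> (1 / (2 * C)) powr p * M \<bar>(1 / a) * x t\<bar>"
        using C by (intro p_convex_contract[OF cone p]) auto
      also have "\<dots> \<le> (1 / (2 * C)) powr 1 * M \<bar>(1 / a) * x t\<bar>"
        using C p orlicz_coneD(5)[OF cone] by (intro mult_right_mono powr_mono') auto
      finally show "M (\<bar>x t\<bar> / (2 * C * a)) \<le> 1 / (2 * C) * M \<bar>(1 / a) * x t\<bar>" using C by simp
    qed
    also have "\<dots> = ennreal (1 / (2 * C)) * (\<integral>\<^sup>+ t. ennreal (M \<bar>(1 / a) * x t\<bar>) \<partial>unit_int)"
      by (rule nn_integral_scale_cone[OF cone measurable_E[OF scale_in_E[OF x]]]) (use C in simp)
    also have "\<dots> \<le> ennreal (1 / (2 * C)) * ennreal (2 * C)" using M(2) by (intro mult_left_mono) auto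
    also have "\<dots> = 1" using C by (simp add: ennreal_mult[symmetric])
    finally have "orlicz_norm M x \<le> ennreal (2 * C * a)" using C a by (intro orlicz_norm_le) auto
    then have "orlicz_norm M x \<le> ennreal (2 * C) * ennreal (N x)" using C a by (simp add: a_def ennreal_mult)
    then show ?thesis using INF_lower[OF M(1), of "\<lambda>M. orlicz_norm M x"] by (rule order_trans[rotated])
  qed
  have "\<forall>M\<in>F. increasing_fun M \<and> p_convex p M \<and> q_concave q M" by (auto simp: F_def orlicz_cone_def)
  moreover have "ennreal (N x) \<le> ennreal (2 * C) * (INF M\<in>F. orlicz_norm M x)" if "x \<in> E" for x
    using C lower[OF that] norm_nonneg[OF that] by (intro ennreal_le_mult_INF) auto
  ultimately show ?thesis
    unfolding orlicz_equivalent_def using upper C by (intro exI[of _ F] conjI exI[of _ "2 * C"]) auto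
qed

lemma (in ri) orlicz_equivalent_null:
  assumes p: "1 \<le> p" "ereal p < q" and 0: "\<And>x. x \<in> E \<Longrightarrow> N x = 0"
  shows "orlicz_equivalent E N p q"
proof -
  obtain M where M: "M \<in> orlicz_cone p q" using level_function_exists[OF p] by blast
  have "orlicz_norm M x = 0" if "x \<in> E" for x using orlicz_norm_null[OF M that 0[OF that]] .
  then show ?thesis
    unfolding orlicz_equivalent_def using 0 orlicz_coneD[OF M]
    by (intro exI[of _ "{M}"] conjI exI[of _ "1::real"]) auto
qed

text \<open>If the norms of indicators are bounded below, then \<open>E\<close> is \<open>L\<^sub>\<infinity>\<close> up to equivalence of norms.
  Its norm is the Orlicz norm of a function with value \<open>1\<close> on \<open>{0..1}\<close>, as a function vanishing
  at \<open>0\<close> cannot detect large values on small sets.\<close>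

lemma (in ri_one) orlicz_equivalent_bounded:
  assumes p: "1 \<le> p" and a0: "0 < a0" and low: "\<And>t. 0 < t \<Longrightarrow> t \<le> 1 \<Longrightarrow> a0 \<le> N (indicator {0..t})"
  shows "orlicz_equivalent E N p \<infinity>"
proof -
  define g :: "real \<Rightarrow> real" where "g = (\<lambda>u. max 0 (max 0 u powr p - 1 powr p))"
  have g: "g \<in> orlicz_cone p \<infinity>" unfolding g_def by (rule orlicz_cone_inf[OF p]) simp
  note g0 = orlicz_coneD(5)[OF g]
  define M where "M u = g u + 1" for u
  have gz: "g u = 0 \<longleftrightarrow> u \<le> 1" for u
  proof (cases "u \<le> 1")
    case True
    then have "max 0 u powr p \<le> 1 powr p" using p by (intro powr_mono2) auto
    then show ?thesis using True by (simp add: g_def)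
  next
    case False
    then have less: "1 powr p < u powr p" using p by (intro powr_less_mono2) auto
    have "max 0 u = u" using False by simp
    then have "0 < g u" using less unfolding g_def by linarith
    then show ?thesis using False by simp
  qed
  have Mprop: "increasing_fun M" "p_convex p M" "q_concave \<infinity> M"
    using orlicz_coneD(1,2)[OF g] unfolding M_def[abs_def] increasing_fun_def p_convex_def q_concave_def mono_on_def
    by (auto intro!: convex_on_add convex_on_const[THEN iffD2] add_nonneg_nonneg)
  \<comment> \<open>The summand 1 in M already integrates to 1, so the modular is at most 1 only if
    g (|x| / l) vanishes almost everywhere.\<close>
  have iff: "(\<integral>\<^sup>+ t. ennreal (M (\<bar>x t\<bar> / l)) \<partial>unit_int) \<le> 1 \<longleftrightarrow> (AE t in unit_int. \<bar>x t\<bar> \<le> l)"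
    if [measurable]: "x \<in> borel_measurable unit_int" and l: "0 < l" for x l
  proof -
    note [measurable] = orlicz_cone_borel[OF g]
    have "(\<integral>\<^sup>+ t. ennreal (M (\<bar>x t\<bar> / l)) \<partial>unit_int) = (\<integral>\<^sup>+ t. ennreal (g (\<bar>x t\<bar> / l)) + 1 \<partial>unit_int)"
      using g0 by (intro nn_integral_cong) (simp add: M_def)
    also have "\<dots> = (\<integral>\<^sup>+ t. ennreal (g (\<bar>x t\<bar> / l)) \<partial>unit_int) + 1"
      using emeasure_unit_int_space by (subst nn_integral_add) auto
    finally have "(\<integral>\<^sup>+ t. ennreal (M (\<bar>x t\<bar> / l)) \<partial>unit_int) \<le> 1
        \<longleftrightarrow> (\<integral>\<^sup>+ t. ennreal (g (\<bar>x t\<bar> / l)) \<partial>unit_int) + 1 \<le> 0 + 1" by simp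
    also have "\<dots> \<longleftrightarrow> (\<integral>\<^sup>+ t. ennreal (g (\<bar>x t\<bar> / l)) \<partial>unit_int) = 0"
      using ennreal_add_left_cancel_le[of 1 "\<integral>\<^sup>+ t. ennreal (g (\<bar>x t\<bar> / l)) \<partial>unit_int" 0]
      by (simp add: add.commute)
    also have "\<dots> \<longleftrightarrow> (AE t in unit_int. g (\<bar>x t\<bar> / l) = 0)"
      using g0 by (subst nn_integral_0_iff_AE) (auto simp: ennreal_eq_0_iff intro: order_antisym)
    also have "\<dots> \<longleftrightarrow> (AE t in unit_int. \<bar>x t\<bar> \<le> l)" using l by (simp add: gz)
    finally show ?thesis .
  qed
  have lower: "ennreal (N x / N (\<lambda>_. 1)) \<le> orlicz_norm M x" if x: "x \<in> E" for x
    unfolding orlicz_norm_def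
  proof (rule INF_greatest)
    fix l assume "l \<in> {l. 0 < l \<and> (\<integral>\<^sup>+ t. ennreal (M (\<bar>x t\<bar> / l)) \<partial>unit_int) \<le> 1}"
    then have l: "0 < l" "AE t in unit_int. \<bar>x t\<bar> \<le> l" using iff[OF measurable_E[OF x]] by auto
    have "N x \<le> N (\<lambda>t. l * 1)"
      using l by (intro dominated_AE(2)[OF scale_in_E[OF one_in] measurable_E[OF x]]) auto
    then have "N x \<le> l * N (\<lambda>_. 1)" using norm_scale[OF one_in, of l] l by simp
    then show "ennreal (N x / N (\<lambda>_. 1)) \<le> ennreal l"
      using norm_one_pos by (intro ennreal_leI) (simp add: field_simps)
  qed
  have upper: "orlicz_norm M x \<le> ennreal (N x / a0)" if x: "x \<in> E" for x
  proof (rule orlicz_norm_le_limit)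
    show nn: "0 \<le> N x / a0" using a0 norm_nonneg[OF x] by simp
    fix l assume l: "N x / a0 < l"
    then have l0: "0 < l" using nn by linarith
    define t where "t = distr_fun x l"
    \<comment> \<open>Otherwise l times the indicator of [0, t] is dominated by x in distribution,
      and the lower bound on indicator norms gives l * a0 \<le> N x.\<close>
    have "t = 0"
    proof (rule ccontr)
      assume "t \<noteq> 0"
      have "t \<le> measure unit_int (space unit_int)"
        unfolding t_def distr_fun_def by (rule finite_measure.bounded_measure) simp
      then have t: "0 < t" "t \<le> 1"
        using \<open>t \<noteq> 0\<close> measure_nonneg[of unit_int] measure_unit_int_subinterval(1)[of 0 1]
        by (auto simp: t_def distr_fun_def less_le)
      have "N (\<lambda>s. l * indicator {0..t} s) \<le> N x"
      proof (rule dominated(2)[OF x])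
        show "(\<lambda>s. l * indicator {0..t} s) \<in> borel_measurable unit_int"
          using measurable_E[OF scale_in_E[OF initial_in_E]] by blast
        fix s :: real assume s: "0 \<le> s"
        show "distr_fun (\<lambda>s. l * indicator {0..t} s) s \<le> distr_fun x s"
        proof (cases "s < l")
          case True
          have "{v \<in> {0..1}. s < \<bar>l * indicator {0..t} v\<bar>} = {0..t}"
            using True s t l0 by (auto simp: indicator_def)
          then have "distr_fun (\<lambda>s. l * indicator {0..t} s) s = distr_fun x l"
            using t measure_unit_int_subinterval(1)[of 0 t] by (simp add: distr_fun_def t_def)
          also have "\<dots> \<le> distr_fun x s" using True by (intro distr_fun_antimono measurable_E[OF x]) simp
          finally show ?thesis .
        next
          case False
          then have "{v \<in> {0..1}. s < \<bar>l * indicator {0..t} v\<bar>} = {}"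
            using s l0 by (auto simp: indicator_def)
          then show ?thesis unfolding distr_fun_def by (metis measure_empty measure_nonneg)
        qed
      qed
      then have "l * N (indicator {0..t}) \<le> N x" using norm_scale[OF initial_in_E, of l t] l0 by simp
      moreover have "l * a0 \<le> l * N (indicator {0..t})" using low[OF t] l0 by (intro mult_left_mono) auto
      ultimately have "l * a0 \<le> N x" by linarith
      then show False using l a0 by (simp add: field_simps)
    qed
    then have "{v \<in> {0..1}. l < \<bar>x v\<bar>} \<in> null_sets unit_int"
      using level_set_measurable[OF measurable_E[OF x]]
      by (auto simp: null_sets_def finite_measure.emeasure_eq_measure t_def distr_fun_def)
    then have "AE t in unit_int. \<bar>x t\<bar> \<le> l" by (rule AE_I') auto
    then show "(\<integral>\<^sup>+ t. ennreal (M (\<bar>x t\<bar> / l)) \<partial>unit_int) \<le> 1" using iff[OF measurable_E[OF x] l0] by simp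
  qed
  define C where "C = max (N (\<lambda>_. 1)) (1 / a0)"
  have C: "0 < C" "N (\<lambda>_. 1) \<le> C" "1 / a0 \<le> C" using norm_one_pos by (auto simp: C_def)
  have "ennreal (N x) \<le> ennreal C * (INF M\<in>{M}. orlicz_norm M x)" if x: "x \<in> E" for x
  proof (rule ennreal_le_mult_INF[OF C(1) norm_nonneg[OF x]])
    have "N x / C \<le> N x / N (\<lambda>_. 1)" using C norm_one_pos norm_nonneg[OF x] by (intro divide_left_mono) auto
    then show "ennreal (N x / C) \<le> orlicz_norm M' x" if "M' \<in> {M}" for M'
      using lower[OF x] that by (auto intro: order_trans[OF ennreal_leI])
  qed
  moreover have "(INF M\<in>{M}. orlicz_norm M x) \<le> ennreal C * ennreal (N x)" if x: "x \<in> E" for x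
  proof -
    have "N x / a0 \<le> C * N x" using mult_right_mono[OF C(3) norm_nonneg[OF x]] by simp
    then have "ennreal (N x / a0) \<le> ennreal (C * N x)" by (rule ennreal_leI)
    then show ?thesis using upper[OF x] C(1) norm_nonneg[OF x] by (simp add: ennreal_mult)
  qed
  ultimately show ?thesis
    unfolding orlicz_equivalent_def using Mprop C(1) by (intro exI[of _ "{M}"] conjI exI[of _ C]) auto
qed

text \<open>Constant functions \<open>M\<close> are admitted by the definitions. They give the first assertion of the theorem in the
  degenerate cases where \<open>E\<close> is null or equivalent to \<open>L\<^sub>\<infinity>\<close>.\<close>

lemma constant_majorant:
  "\<exists>M. increasing_fun M \<and> p_convex p M \<and> q_concave q M \<and>
     (\<integral>\<^sup>+ s. ennreal (M \<bar>x s\<bar>) \<partial>unit_int) \<le> ennreal 1 \<and>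
     (\<forall>y\<in>E. N y \<ge> 1 \<longrightarrow> (\<integral>\<^sup>+ s. ennreal (M \<bar>y s\<bar>) \<partial>unit_int) \<ge> ennreal (inverse 1))"
  by (rule exI[of _ "\<lambda>_. 1"])
    (simp add: increasing_fun_def mono_on_def p_convex_def q_concave_def convex_on_const emeasure_unit_int_space)

theorem theorem22:
  fixes p :: real and q :: ereal
    and E :: "(real \<Rightarrow> real) set" and N :: "(real \<Rightarrow> real) \<Rightarrow> real"
  assumes "1 \<le> p" and "ereal p < q"
    and "ri_space E N"
    and "maximal_space E N \<or> minimal_space E N"
    and "D_star_convex E N"
    and "interpolation_space E N (ereal p) q"
  shows "(\<exists>c>0. \<forall>x\<in>E. N x = 1 \<longrightarrow>
            (\<exists>M. increasing_fun M \<and> p_convex p M \<and> q_concave q M \<and>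
                 (\<integral>\<^sup>+ s. ennreal (M \<bar>x s\<bar>) \<partial>unit_int) \<le> ennreal c \<and>
                 (\<forall>y\<in>E. N y \<ge> c \<longrightarrow>
                    (\<integral>\<^sup>+ s. ennreal (M \<bar>y s\<bar>) \<partial>unit_int) \<ge> ennreal (inverse c))))
       \<and> (\<exists>F. (\<forall>M\<in>F. increasing_fun M \<and> p_convex p M \<and> q_concave q M) \<and>
              (\<exists>C>0. \<forall>x\<in>E.
                 ennreal (N x) \<le> ennreal C * (INF M\<in>F. orlicz_norm M x) \<and>
                 (INF M\<in>F. orlicz_norm M x) \<le> ennreal C * ennreal (N x)))"
proof -
  have trivial: "\<exists>c>0. \<forall>x\<in>E. N x = 1 \<longrightarrow>
            (\<exists>M. increasing_fun M \<and> p_convex p M \<and> q_concave q M \<and>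
                 (\<integral>\<^sup>+ s. ennreal (M \<bar>x s\<bar>) \<partial>unit_int) \<le> ennreal c \<and>
                 (\<forall>y\<in>E. N y \<ge> c \<longrightarrow>
                    (\<integral>\<^sup>+ s. ennreal (M \<bar>y s\<bar>) \<partial>unit_int) \<ge> ennreal (inverse c)))"
    by (intro exI[of _ "1::real"] conjI ballI impI constant_majorant zero_less_one)
  interpret ri E N by unfold_locales fact
  show ?thesis
  proof (cases "\<forall>x\<in>E. N x = 0")
    case True
    then show ?thesis
      using trivial orlicz_equivalent_null[OF assms(1,2)] unfolding orlicz_equivalent_def by blast
  next
    case False
    then have one: "(\<lambda>_. 1) \<in> E" using one_in_E by blast
    obtain cI where cI: "cI > 0" "\<And>T x.
        (\<forall>x\<in>L_space p \<inter> L_space q. T x \<in> L_space p \<inter> L_space q) \<and>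
        (\<forall>x\<in>L_space p \<inter> L_space q. \<forall>y\<in>L_space p \<inter> L_space q.
           AE t in unit_int. T (\<lambda>s. x s + y s) t = T x t + T y t) \<and>
        (\<forall>x\<in>L_space p \<inter> L_space q. \<forall>a. AE t in unit_int. T (\<lambda>s. a * x s) t = a * T x t) \<and>
        (\<forall>x\<in>L_space p \<inter> L_space q. L_norm p (T x) \<le> L_norm p x) \<and>
        (\<forall>x\<in>L_space p \<inter> L_space q. L_norm q (T x) \<le> L_norm q x) \<Longrightarrow>
        x\<in>E \<inter> L_space p \<inter> L_space q \<Longrightarrow> T x \<in> E \<and> N (T x) \<le> cI * N x"
      using assms(6) unfolding interpolation_space_def by blast
    obtain cD where cD: "cD > 0" "\<And>n x. 1 \<le> n \<Longrightarrow> (\<And>k. k \<in> {1..n} \<Longrightarrow> x k \<in> E) \<Longrightarrow>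
        inverse cD * (INF k\<in>{1..n}. N (x k)) \<le> N (dilated_disjoint_sum n x)"
      using assms(5) unfolding D_star_convex_def by blast
    interpret ri_one E N by unfold_locales fact
    interpret orlicz_setting E N p q cI cD
    proof unfold_locales
      fix T :: "(real \<Rightarrow> real) \<Rightarrow> real \<Rightarrow> real" and x
      assume "\<And>x. x \<in> L_space (ereal p) \<inter> L_space q \<Longrightarrow> T x \<in> L_space (ereal p) \<inter> L_space q"
        "\<And>x y. x \<in> L_space (ereal p) \<inter> L_space q \<Longrightarrow> y \<in> L_space (ereal p) \<inter> L_space q \<Longrightarrow>
           AE t in unit_int. T (\<lambda>s. x s + y s) t = T x t + T y t"
        "\<And>x a. x \<in> L_space (ereal p) \<inter> L_space q \<Longrightarrow> AE t in unit_int. T (\<lambda>s. a * x s) t = a * T x t"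
        "\<And>x. x \<in> L_space (ereal p) \<inter> L_space q \<Longrightarrow> L_norm (ereal p) (T x) \<le> L_norm (ereal p) x"
        "\<And>x. x \<in> L_space (ereal p) \<inter> L_space q \<Longrightarrow> L_norm q (T x) \<le> L_norm q x"
        "x \<in> E \<inter> L_space (ereal p) \<inter> L_space q"
      then show "T x \<in> E \<and> N (T x) \<le> cI * N x" by (intro cI(2)) blast+
    qed (use assms cI cD in auto)
    show ?thesis
    proof (cases "\<exists>a>0. \<forall>t. 0 < t \<and> t \<le> 1 \<longrightarrow> a \<le> N (indicator {0..t})")
      case True
      then obtain a where a: "a > 0" "\<And>t. 0 < t \<Longrightarrow> t \<le> 1 \<Longrightarrow> a \<le> N (indicator {0..t})" by blast
      \<comment> \<open>For finite q the norms of short indicators tend to 0, so a positive lower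
        bound excludes it.\<close>
      have "q = \<infinity>" using initial_norm_small[of a] a by (meson not_less)
      then have "orlicz_equivalent E N p q" using orlicz_equivalent_bounded[OF assms(1) a] by simp
      then show ?thesis using trivial unfolding orlicz_equivalent_def by blast
    next
      case False
      then have "\<exists>t. 0 < t \<and> t \<le> 1 \<and> N (indicator {0..t}) < e" if "e > 0" for e
        using that by (meson not_less)
      then obtain u where "u \<in> E" "\<And>b. 0 < distr_fun u b" using unbounded_exists by blast
      then obtain C where C: "1 \<le> C" "\<And>x. x \<in> E \<Longrightarrow> N x \<le> 1 \<Longrightarrow> \<exists>M\<in>orlicz_cone p q.
           modular M x \<le> 1
           \<and> (\<forall>y\<in>E. C \<le> N y \<longrightarrow> ennreal (inverse C) \<le> modular M y)"
        using orlicz_majorant[of u] by auto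
      have "orlicz_equivalent E N p q" by (rule orlicz_equivalent_if_majorants[OF assms(1) C])
      moreover have "\<exists>M. increasing_fun M \<and> p_convex p M \<and> q_concave q M \<and>
                 (\<integral>\<^sup>+ s. ennreal (M \<bar>x s\<bar>) \<partial>unit_int) \<le> ennreal C \<and>
                 (\<forall>y\<in>E. N y \<ge> C \<longrightarrow>
                    (\<integral>\<^sup>+ s. ennreal (M \<bar>y s\<bar>) \<partial>unit_int) \<ge> ennreal (inverse C))" if x: "x \<in> E" "N x = 1" for x
      proof -
        obtain M where M: "M \<in> orlicz_cone p q" "modular M x \<le> 1"
          "\<forall>y\<in>E. C \<le> N y \<longrightarrow> ennreal (inverse C) \<le> modular M y"
          using C(2)[OF x(1)] x(2) by auto
        have "(1::ennreal) \<le> ennreal C" using C(1) by simp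
        then have "modular M x \<le> ennreal C" using M(2) by (rule order_trans[rotated])
        then show ?thesis using M orlicz_coneD(1-3)[OF M(1)] by blast
      qed
      ultimately show ?thesis
        using C(1) unfolding orlicz_equivalent_def by (intro conjI exI[of _ C]) auto
    qed
  qed
qed

end
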